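(* Let $f:\Sigma\to\Sigma$ be a subshift of finite type, let $\mu$ be an ergodic, fully supported $f$-invariant probability measure on $\Sigma$ with local product structure, and let $\mathcal{A}$ be an $\alpha$-Hölder continuous linear cocycle over $f$ with generator $A:\Sigma\to GL(d,\mathbb{R})$. Suppose that there is a measurable function $P:\Sigma\to GL(d,\mathbb{R})$ such that \[ A(x) = P(f(x))P(x)^{-1} \quad \text{for } \mu\text{-a.e. } x\in\Sigma. \] Then $P$ coincides $\mu$-a.e. with an $\alpha$-Hölder continuous function $\hat{P}:\Sigma\to GL(d,\mathbb{R})$ satisfying $A(x) = \hat{P}(f(x))\hat{P}(x)^{-1}$ for every $x\in\Sigma$.
   Context: Let $\ell\ge 2$ be an integer, $Q=(q_{ij})_{1\le i,j\le \ell}$ a matrix with entries in $\{0,1\}$, and $\Sigma=\{(x_n)_{n\in\mathbb{Z}} : x_n\in\{1,\dots,\ell\},\ q_{x_nx_{n+1}}=1 \text{ for all } n\in\mathbb{Z}\}$ the associated subshift of finite type, with left shift $f((x_n)_{n})=(x_{n+1})_{n}$. Fix $\tau\in(0,\infty)$ and equip $\Sigma$ with the metric $\rho_\tau(x,y)=e^{-\tau N(x,y)}$, where $N(x,y)=\max\{N\ge 0 : x_n=y_n \text{ for all } |n|<N\}$ (and $\rho_\tau(x,x)=0$). Hölder continuity on $\Sigma$ is with respect to $\rho_\tau$. Let $d\ge1$ be an integer. The linear cocycle $\mathcal{A}$ over $f$ generated by a measurable map $A:\Sigma\to GL(d,\mathbb{R})$ is given by $A^n(x)=A(f^{n-1}(x))\cdots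 A(f(x))A(x)$ for $n>0$, $A^0(x)=I$, and $A^{n}(x)=A(f^{n}(x))^{-1}\cdots A(f^{-1}(x))^{-1}$ for $n<0$. It is $\alpha$-Hölder continuous if $A$ is. Local product structure: let $\Sigma^u=\{(x_n)_{n\ge0}: q_{x_nx_{n+1}}=1\ \forall n\ge 0\}$ and $\Sigma^s=\{(x_n)_{n<0}: q_{x_nx_{n+1}}=1\ \forall n\le -2\}$, with the projections $\pi_u:\Sigma\to\Sigma^u$, $\pi_s:\Sigma\to\Sigma^s$ dropping the negative, respectively nonnegative, coordinates. Let $\mu^u=(\pi_u)_*\mu$, $\mu^s=(\pi_s)_*\mu$, and $[0;i]=\{x\in\Sigma: x_0=i\}$. The map $\pi_s\times\pi_u$ identifies $[0;i]$ with $\pi_s([0;i])\times\pi_u([0;i])$. The measure $\mu$ has local product structure if there is a continuous function $\xi:\Sigma\to(0,\infty)$ such that for each $1\le i\le \ell$, $\mu|[0;i]=\xi\cdot(\mu^s|\pi_s([0;i])\times\mu^u|\pi_u([0;i]))$. *)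

theory Defs
  imports "HOL-Probability.Probability"
begin

text \<open>The alphabet is \<open>{1..l}\<close>, so that only the entries \<open>q i j\<close> with \<open>i, j \<in> {1..l}\<close> matter. Points
  of the shift spaces are functions \<open>int \<Rightarrow> nat\<close>, and the topology is the restriction of the product
  topology on that type.\<close>

definition subshift :: "nat \<Rightarrow> (nat \<Rightarrow> nat \<Rightarrow> nat) \<Rightarrow> (int \<Rightarrow> nat) set" where
  "subshift l q = {x. \<forall>n. x n \<in> {1..l} \<and> q (x n) (x (n + 1)) = 1}"

definition left_shift :: "(int \<Rightarrow> nat) \<Rightarrow> (int \<Rightarrow> nat)" where
  "left_shift x = (\<lambda>n. x (n + 1))"

definition agreement :: "(int \<Rightarrow> nat) \<Rightarrow> (int \<Rightarrow> nat) \<Rightarrow> nat" where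
  "agreement x y = Max {N. \<forall>n. \<bar>n\<bar> < int N \<longrightarrow> x n = y n}"

definition rho :: "real \<Rightarrow> (int \<Rightarrow> nat) \<Rightarrow> (int \<Rightarrow> nat) \<Rightarrow> real" where
  "rho \<tau> x y = (if x = y then 0 else exp (- \<tau> * real (agreement x y)))"

definition holder_on :: "(int \<Rightarrow> nat) set \<Rightarrow> real \<Rightarrow> real \<Rightarrow> ((int \<Rightarrow> nat) \<Rightarrow> 'b::real_normed_vector) \<Rightarrow> bool" where
  "holder_on S \<tau> \<alpha> g \<longleftrightarrow> (\<exists>C. \<forall>x\<in>S. \<forall>y\<in>S. norm (g x - g y) \<le> C * rho \<tau> x y powr \<alpha>)"

definition ergodic_measure :: "('a \<Rightarrow> 'a) \<Rightarrow> 'a measure \<Rightarrow> bool" where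
  "ergodic_measure f M \<longleftrightarrow>
     prob_space M \<and> f \<in> measurable M M \<and> distr M M f = M \<and>
     (\<forall>B\<in>sets M. f -` B \<inter> space M = B \<longrightarrow> measure M B = 0 \<or> measure M B = 1)"

definition fully_supported_on :: "'a::topological_space set \<Rightarrow> 'a measure \<Rightarrow> bool" where
  "fully_supported_on S M \<longleftrightarrow> (\<forall>U. open U \<and> U \<inter> S \<noteq> {} \<longrightarrow> emeasure M (U \<inter> S) > 0)"

text \<open>One-sided sequences are functions on \<open>int\<close> that are \<open>undefined\<close> off their index set.\<close>

definition proj_u :: "(int \<Rightarrow> nat) \<Rightarrow> (int \<Rightarrow> nat)" where
  "proj_u x = restrict x {0..}"

definition proj_s :: "(int \<Rightarrow> nat) \<Rightarrow> (int \<Rightarrow> nat)" where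
  "proj_s x = restrict x {..<0}"

definition subshift_u :: "nat \<Rightarrow> (nat \<Rightarrow> nat \<Rightarrow> nat) \<Rightarrow> (int \<Rightarrow> nat) set" where
  "subshift_u l q =
     {x \<in> extensional {0..}. (\<forall>n\<ge>0. x n \<in> {1..l}) \<and> (\<forall>n\<ge>0. q (x n) (x (n + 1)) = 1)}"

definition subshift_s :: "nat \<Rightarrow> (nat \<Rightarrow> nat \<Rightarrow> nat) \<Rightarrow> (int \<Rightarrow> nat) set" where
  "subshift_s l q =
     {x \<in> extensional {..<0}. (\<forall>n<0. x n \<in> {1..l}) \<and> (\<forall>n\<le>-2. q (x n) (x (n + 1)) = 1)}"

definition measure_u :: "nat \<Rightarrow> (nat \<Rightarrow> nat \<Rightarrow> nat) \<Rightarrow> (int \<Rightarrow> nat) measure \<Rightarrow> (int \<Rightarrow> nat) measure" where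
  "measure_u l q \<mu> = distr \<mu> (restrict_space borel (subshift_u l q)) proj_u"

definition measure_s :: "nat \<Rightarrow> (nat \<Rightarrow> nat \<Rightarrow> nat) \<Rightarrow> (int \<Rightarrow> nat) measure \<Rightarrow> (int \<Rightarrow> nat) measure" where
  "measure_s l q \<mu> = distr \<mu> (restrict_space borel (subshift_s l q)) proj_s"

definition cyl :: "nat \<Rightarrow> (nat \<Rightarrow> nat \<Rightarrow> nat) \<Rightarrow> nat \<Rightarrow> (int \<Rightarrow> nat) set" where
  "cyl l q i = {x \<in> subshift l q. x 0 = i}"

definition glue :: "(int \<Rightarrow> nat) \<times> (int \<Rightarrow> nat) \<Rightarrow> (int \<Rightarrow> nat)" where
  "glue = (\<lambda>(y, z) n. if n < 0 then y n else z n)"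

text \<open>By \<open>bij_betw_proj\<close> and \<open>glue_proj\<close> below, \<open>glue\<close> inverts the identification
  \<open>x \<mapsto> (proj_s x, proj_u x)\<close> of \<open>cyl l q i\<close> with a product; the product measure with density is
  transported back to \<open>cyl l q i\<close> along it.\<close>

definition local_product_structure :: "nat \<Rightarrow> (nat \<Rightarrow> nat \<Rightarrow> nat) \<Rightarrow> (int \<Rightarrow> nat) measure \<Rightarrow> bool" where
  "local_product_structure l q \<mu> \<longleftrightarrow>
     (\<exists>\<xi> :: (int \<Rightarrow> nat) \<Rightarrow> real.
        continuous_on (subshift l q) \<xi> \<and> (\<forall>x\<in>subshift l q. \<xi> x > 0) \<and>
        (\<forall>i\<in>{1..l}.
           restrict_space \<mu> (cyl l q i) =
           distr
             (density
               (restrict_space (measure_s l q \<mu>) (proj_s ` cyl l q i) \<Otimes>\<^sub>M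
                restrict_space (measure_u l q \<mu>) (proj_u ` cyl l q i))
               (\<lambda>p. ennreal (\<xi> (glue p))))
             (restrict_space \<mu> (cyl l q i))
             glue))"

lemma glue_proj: "glue (proj_s x, proj_u x) = x"
  by (auto simp: glue_def proj_s_def proj_u_def fun_eq_iff)

lemma proj_u_in: "x \<in> subshift l q \<Longrightarrow> proj_u x \<in> subshift_u l q"
  by (auto simp: proj_u_def subshift_u_def subshift_def)

lemma proj_s_in: "x \<in> subshift l q \<Longrightarrow> proj_s x \<in> subshift_s l q"
  by (auto simp: proj_s_def subshift_s_def subshift_def)

lemma glue_in_cyl:
  assumes "x \<in> cyl l q i" "y \<in> cyl l q i"
  shows "glue (proj_s x, proj_u y) \<in> cyl l q i"
proof -
  have *: "q (x n) (y (n + 1)) = 1" if "n < 0" "\<not> n + 1 < 0" for n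
  proof -
    from that have "n = -1" by simp
    moreover have "q (x (-1)) (x (-1 + 1)) = 1"
      using assms(1) unfolding cyl_def subshift_def by blast
    ultimately show ?thesis using assms by (simp add: cyl_def)
  qed
  show ?thesis
    using assms * by (auto simp: glue_def proj_s_def proj_u_def cyl_def subshift_def)
qed

lemma bij_betw_proj:
  "bij_betw (\<lambda>x. (proj_s x, proj_u x)) (cyl l q i) (proj_s ` cyl l q i \<times> proj_u ` cyl l q i)"
proof (rule bij_betwI[where g = glue])
  fix p assume "p \<in> proj_s ` cyl l q i \<times> proj_u ` cyl l q i"
  then obtain x y where p: "p = (proj_s x, proj_u y)" by auto
  show "(proj_s (glue p), proj_u (glue p)) = p"
    by (auto simp: p glue_def proj_s_def proj_u_def fun_eq_iff)
qed (auto simp: glue_proj intro: glue_in_cyl)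

lemma rho_le_iff:
  assumes "\<tau> > 0"
  shows "rho \<tau> x y \<le> exp (- \<tau> * real k) \<longleftrightarrow> (\<forall>n. \<bar>n\<bar> < int k \<longrightarrow> x n = y n)"
proof (cases "x = y")
  case True
  then show ?thesis by (simp add: rho_def)
next
  case False
  let ?S = "{N. \<forall>n. \<bar>n\<bar> < int N \<longrightarrow> x n = y n}"
  from False obtain m where m: "x m \<noteq> y m" by auto
  have "?S \<subseteq> {..nat \<bar>m\<bar>}"
  proof
    fix N assume "N \<in> ?S"
    then have "\<not> \<bar>m\<bar> < int N" using m by auto
    then show "N \<in> {..nat \<bar>m\<bar>}" by auto
  qed
  then have fin: "finite ?S" using finite_subset by blast
  have "0 \<in> ?S" by simp
  then have "Max ?S \<in> ?S" by (intro Max_in[OF fin]) blast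
  then have "agreement x y \<in> ?S" by (simp only: agreement_def)
  moreover have "k \<in> ?S \<Longrightarrow> k \<le> agreement x y"
    unfolding agreement_def by (rule Max_ge[OF fin])
  ultimately have "k \<le> agreement x y \<longleftrightarrow> (\<forall>n. \<bar>n\<bar> < int k \<longrightarrow> x n = y n)"
    by auto
  then show ?thesis using assms False by (simp add: rho_def)
qed

lemma Metric_space_rho:
  assumes "\<tau> > 0"
  shows "Metric_space S (rho \<tau>)"
proof
  fix x y z :: "int \<Rightarrow> nat"
  show "0 \<le> rho \<tau> x y" by (simp add: rho_def)
  have "agreement x y = agreement y x" by (simp add: agreement_def eq_commute)
  then show "rho \<tau> x y = rho \<tau> y x" by (auto simp: rho_def)
  show "(rho \<tau> x y = 0) = (x = y)" by (simp add: rho_def)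
  show "rho \<tau> x z \<le> rho \<tau> x y + rho \<tau> y z"
  proof (cases "x = y \<or> y = z")
    case False
    define k where "k = min (agreement x y) (agreement y z)"
    have "rho \<tau> x y \<le> exp (- \<tau> * real k)" "rho \<tau> y z \<le> exp (- \<tau> * real k)"
      using False assms by (auto simp: rho_def k_def)
    then have "rho \<tau> x z \<le> exp (- \<tau> * real k)"
      unfolding rho_le_iff[OF assms] by simp
    also have "\<dots> \<le> rho \<tau> x y + rho \<tau> y z"
      using False by (auto simp: rho_def k_def min_def)
    finally show ?thesis .
  qed (auto simp: rho_def)
qed

text \<open>The metric induces the product topology used for continuity, Borel sets and support.\<close>

lemma mtopology_rho:
  assumes "\<tau> > 0"
  shows "Metric_space.mtopology S (rho \<tau>) = top_of_set S"
proof -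
  interpret Metric_space S "rho \<tau>" by (rule Metric_space_rho[OF assms])
  define Z where "Z k x = {y :: int \<Rightarrow> nat. \<forall>n. \<bar>n\<bar> < int k \<longrightarrow> x n = y n}" for k and x :: "int \<Rightarrow> nat"
  have openZ: "open (Z k x)" for k and x :: "int \<Rightarrow> nat"
  proof -
    have "Z k x = (\<Inter>n\<in>{-int k<..<int k}. (\<lambda>y. y n) -` {x n})"
      unfolding Z_def by (auto simp: abs_less_iff)
    moreover have "open ((\<lambda>y :: int \<Rightarrow> nat. y n) -` {x n})" for n :: int
      by (rule open_vimage[OF Topological_Spaces.open_discrete continuous_on_product_coordinates])
    ultimately show ?thesis by auto
  qed
  have small: "\<exists>k. exp (- \<tau> * real k) < e" if "e > 0" for e
  proof -
    obtain k where "real k > - ln e / \<tau>" using reals_Archimedean2 by blast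
    then have "- \<tau> * real k < ln e" using assms by (simp add: field_simps)
    then show ?thesis using that by (metis exp_less_mono exp_ln)
  qed
  have ZU: "\<exists>k. Z k x \<subseteq> U" if "open U" "x \<in> U" for U x
  proof -
    have "openin (product_topology (\<lambda>_. euclidean) UNIV) U"
      using that(1) by (simp add: open_fun_def)
    from product_topology_open_contains_basis[OF this that(2)]
    obtain X where X: "x \<in> Pi\<^sub>E UNIV X" "finite {i. X i \<noteq> UNIV}" "Pi\<^sub>E UNIV X \<subseteq> U"
      by auto
    define k where "k = Suc (nat (\<Sum>i\<in>{i. X i \<noteq> UNIV}. \<bar>i\<bar>))"
    have "\<bar>i\<bar> < int k" if "X i \<noteq> UNIV" for i
      using member_le_sum[of i "{i. X i \<noteq> UNIV}" abs] X(2) that by (auto simp: k_def)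
    then have "y i \<in> X i" if "y \<in> Z k x" for y i
      using that PiE_mem[OF X(1), of i] unfolding Z_def by (metis (mono_tags) UNIV_I mem_Collect_eq)
    then have "Z k x \<subseteq> Pi\<^sub>E UNIV X" by auto
    then show ?thesis using X(3) by blast
  qed
  show ?thesis
    unfolding topology_eq
  proof (intro allI iffI)
    fix U assume U: "openin mtopology U"
    then have US: "U \<subseteq> S" using openin_mtopology by blast
    have "\<exists>k. Z k x \<inter> S \<subseteq> U" if xU: "x \<in> U" for x
    proof -
      obtain r where r: "r > 0" "mball x r \<subseteq> U" using U xU openin_mtopology by blast
      obtain k where k: "exp (- \<tau> * real k) < r" using small r(1) by blast
      have "rho \<tau> x y < r" if "y \<in> Z k x" for y
        using that k rho_le_iff[OF assms, of x y k] unfolding Z_def by auto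
      then have "Z k x \<inter> S \<subseteq> mball x r" using xU US by (auto simp: in_mball)
      then show ?thesis using r(2) by blast
    qed
    then obtain k where k: "\<And>x. x \<in> U \<Longrightarrow> Z (k x) x \<inter> S \<subseteq> U" by metis
    have "x \<in> Z m x" for m x by (simp add: Z_def)
    then have "U = S \<inter> (\<Union>x\<in>U. Z (k x) x)" using k US by blast
    moreover have "open (\<Union>x\<in>U. Z (k x) x)" using openZ by blast
    ultimately show "openin (top_of_set S) U" unfolding openin_open by blast
  next
    fix U assume "openin (top_of_set S) U"
    then obtain V where V: "open V" "U = S \<inter> V" unfolding openin_open by blast
    have "\<exists>r>0. mball x r \<subseteq> U" if x: "x \<in> U" for x
    proof -
      obtain k where k: "Z k x \<subseteq> V" using ZU V x by blast
      have "mball x (exp (- \<tau> * real k)) \<subseteq> U"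
      proof
        fix y assume y: "y \<in> mball x (exp (- \<tau> * real k))"
        then have "y \<in> Z k x"
          using rho_le_iff[OF assms, of x y k] by (auto simp: in_mball Z_def)
        then show "y \<in> U" using k V y by (auto simp: in_mball)
      qed
      then show ?thesis by (intro exI[of _ "exp (- \<tau> * real k)"]) auto
    qed
    then show "openin mtopology U" unfolding openin_mtopology using V by blast
  qed
qed

end

theory Submission
  imports Defs
begin

text \<open>Write \<open>A\<^sup>n(x)\<close> for the cocycle and let \<open>x, z\<close> have the same coordinates \<open>\<ge> 0\<close>. The equation gives
\<open>A\<^sup>n(z)\<inverse> A\<^sup>n(x) = P(z) \<cdot> P(f\<^sup>n z)\<inverse> P(f\<^sup>n x) \<cdot> P(x)\<inverse>\<close>, and whenever \<open>f\<^sup>n x\<close> and \<open>f\<^sup>n z\<close> lie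
in one set on which \<open>P\<close> is almost uniformly continuous, the middle factor is close to the identity,
because the two orbits converge. So \<open>P(z) P(x)\<inverse>\<close> is controlled as soon as the left-hand side is. Its
increments are \<open>A(f\<^sup>n x) - A(f\<^sup>n z)\<close>, of size \<open>\<theta>\<^sup>n\<close> with \<open>\<theta> = exp (- \<tau> \<alpha>)\<close>, conjugated by \<open>A\<^sup>n(x)\<close>.
They are summable if \<open>A\<^sup>n(x)\<close> and its inverse are at most \<open>C \<kappa>\<^sup>n\<close> with \<open>\<kappa>\<^sup>2 \<theta> < 1\<close>; this is
\<open>norm_conjugacy_drift_le\<close>, and \<open>same_side_drift\<close> is its form for the shift.

No such growth bound is assumed, so the heart of the proof is \<open>subexponential_growth\<close>: the cocycle
grows slower than every exponential, uniformly in \<^emph>\<open>all\<close> points. It is obtained in three steps.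

\<^item> By the maximal ergodic inequality there is a set of large measure whose points spend all but a
  fraction \<open>\<delta>\<close> of every initial time segment in a set where \<open>P\<close> and its inverse are at most \<open>R\<close>. At such
  a point the cocycle grows at most like \<open>M\<^bsup>\<delta> n\<^esup>\<close> (\<open>block_growth\<close>), where \<open>M\<close> bounds \<open>A\<close> and its inverse.
  For small \<open>\<delta>\<close> the first paragraph applies, and \<open>P\<close> is bounded by one constant at almost every
  point that has the same future as such a point (\<open>bounded_on_side_of_block\<close>). The same holds for
  pasts.

\<^item> By local product structure, every finite word occurs in a point whose past before the word and
  whose future after the word are both of this kind. At both ends of the word \<open>P\<close> is then bounded, so
  the product of \<open>A\<close> along the word is bounded, independently of the length
  (\<open>controlled_orbit_segments\<close>).

\<^item> Hence every orbit segment of length \<open>n\<close> is shadowed, up to \<open>\<theta>\<^sup>m\<close>, by one along which the product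
  is at most \<open>B M\<^bsup>2m\<^esup>\<close>. If \<open>r > 0\<close> were the optimal exponential rate, then taking \<open>m\<close> a small multiple of
  \<open>n\<close> and comparing the two products would give a smaller rate (\<open>growth_rate_improve\<close>).

With subexponential growth, \<open>P(z) P(x)\<inverse>\<close> differs from the identity by at most \<open>L \<theta>\<^sup>N\<close> for almost all
\<open>x, z\<close> with equal future or equal past that agree on the window of radius \<open>N\<close>
(\<open>same_side_holder\<close>). Local product structure connects two points with the same zeroth symbol through
the point with the past of the one and the future of the other, so that the estimate holds for almost
every pair (\<open>AE_pairs_holder_same_symbol\<close>). As the measure has full support, \<open>P\<close> then has a Hoelder
continuous version, and the equation passes to every point by continuity (\<open>holder_conjugacy\<close>).

The past and the future are treated simultaneously by a parameter \<open>s \<in> {1, -1}\<close>, the direction of time.\<close>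

section \<open>Matrices with the Euclidean norm\<close>

text \<open>The norm of \<^typ>\<open>real^'n^'m\<close> is the Euclidean norm of the vector of entries; it is submultiplicative by
the Cauchy--Schwarz inequality for the rows of \<open>X\<close> and the columns of \<open>Y\<close>. The identity has norm
\<open>sqrt CARD('n)\<close> rather than \<open>1\<close>, which is why \<open>norm (mat 1)\<close> appears in constants below.\<close>

lemma norm_matrix_mult_le:
  fixes X :: "real^'n^'m" and Y :: "real^'k^'n"
  shows "norm (X ** Y) \<le> norm X * norm Y"
proof -
  have comp: "((X ** Y) $ i $ j)\<^sup>2 \<le> (norm (X $ i))\<^sup>2 * (norm (column j Y))\<^sup>2" for i j
  proof -
    have "(X ** Y) $ i $ j = X $ i \<bullet> column j Y"
      by (simp add: matrix_matrix_mult_def inner_vec_def column_def)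
    then show ?thesis
      using Cauchy_Schwarz_ineq[of "X $ i" "column j Y"] by (simp add: power2_norm_eq_inner)
  qed
  have sq: "(norm Z)\<^sup>2 = (\<Sum>i\<in>UNIV. (norm (Z $ i))\<^sup>2)" for Z :: "'b::real_normed_vector^'c"
    by (simp add: norm_vec_def L2_set_def sum_nonneg)
  have "(norm (X ** Y))\<^sup>2 = (\<Sum>i\<in>UNIV. \<Sum>j\<in>UNIV. ((X ** Y) $ i $ j)\<^sup>2)"
    by (simp add: sq)
  also have "\<dots> \<le> (\<Sum>i\<in>UNIV. \<Sum>j\<in>UNIV. (norm (X $ i))\<^sup>2 * (norm (column j Y))\<^sup>2)"
    by (intro sum_mono comp)
  also have "\<dots> = (norm X)\<^sup>2 * (\<Sum>j\<in>UNIV. (norm (column j Y))\<^sup>2)"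
    by (simp add: sq[of X] sum_product)
  also have "(\<Sum>j\<in>UNIV. (norm (column j Y))\<^sup>2) = (norm Y)\<^sup>2"
    unfolding sq by (subst sum.swap) (simp add: column_def)
  finally show ?thesis
    by (metis mult_nonneg_nonneg norm_ge_zero power2_le_imp_le power_mult_distrib)
qed

lemma bounded_bilinear_matrix_mult:
  "bounded_bilinear (\<lambda>(X :: real^'n^'m) (Y :: real^'k^'n). X ** Y)"
proof
  show "\<exists>K. \<forall>(X :: real^'n^'m) (Y :: real^'k^'n). norm (X ** Y) \<le> norm X * norm Y * K"
    using norm_matrix_mult_le by (intro exI[of _ 1]) auto
qed (simp_all add: vec_eq_iff matrix_matrix_mult_def
       sum_distrib_left sum.distrib algebra_simps)

lemmas matrix_mult_diff_left = bounded_bilinear.diff_left[OF bounded_bilinear_matrix_mult]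
lemmas matrix_mult_diff_right = bounded_bilinear.diff_right[OF bounded_bilinear_matrix_mult]

lemma matrix_inv_right: "invertible (X :: real^'n^'n) \<Longrightarrow> X ** matrix_inv X = mat 1"
  and matrix_inv_left: "invertible (X :: real^'n^'n) \<Longrightarrow> matrix_inv X ** X = mat 1"
  using someI_ex[of "\<lambda>Y. X ** Y = mat 1 \<and> Y ** X = mat 1"]
  unfolding invertible_def matrix_inv_def by auto

lemma matrix_inv_cancel:
  fixes X Y :: "real^'n^'n"
  assumes "invertible X"
  shows "matrix_inv X ** (X ** Y) = Y" "X ** (matrix_inv X ** Y) = Y"
    "Y ** X ** matrix_inv X = Y" "Y ** matrix_inv X ** X = Y"
proof -
  note inv = matrix_inv_right[OF assms] matrix_inv_left[OF assms]
  show "matrix_inv X ** (X ** Y) = Y" "X ** (matrix_inv X ** Y) = Y"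
    by (simp_all add: matrix_mul_assoc inv)
  show "Y ** X ** matrix_inv X = Y" "Y ** matrix_inv X ** X = Y"
    by (simp_all add: inv flip: matrix_mul_assoc)
qed

text \<open>The resolvent identity, from which Lipschitz estimates for inversion follow.\<close>

lemma matrix_inv_diff:
  fixes X Y :: "real^'n^'n"
  assumes "invertible X" "invertible Y"
  shows "matrix_inv X - matrix_inv Y = matrix_inv X ** (Y - X) ** matrix_inv Y"
proof -
  have "matrix_inv X ** (Y - X) ** matrix_inv Y
      = matrix_inv X ** (Y ** matrix_inv Y) - matrix_inv X ** X ** matrix_inv Y"
    by (simp only: matrix_mult_diff_left matrix_mult_diff_right matrix_mul_assoc)
  then show ?thesis
    by (simp only: matrix_inv_right[OF assms(2)] matrix_inv_left[OF assms(1)]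
        matrix_mul_lid matrix_mul_rid)
qed

lemma norm_matrix_inv_diff_le:
  fixes X Y :: "real^'n^'n"
  assumes "invertible X" "invertible Y"
  shows "norm (matrix_inv X - matrix_inv Y)
           \<le> norm (matrix_inv X) * norm (X - Y) * norm (matrix_inv Y)"
proof -
  have "norm (matrix_inv X ** (Y - X) ** matrix_inv Y)
        \<le> norm (matrix_inv X ** (Y - X)) * norm (matrix_inv Y)"
    by (rule norm_matrix_mult_le)
  also have "\<dots> \<le> (norm (matrix_inv X) * norm (Y - X)) * norm (matrix_inv Y)"
    by (intro mult_right_mono norm_matrix_mult_le) auto
  finally show ?thesis by (simp add: matrix_inv_diff[OF assms] norm_minus_commute)
qed

lemma norm_matrix_inv_near:
  fixes X Y :: "real^'n^'n"
  assumes "invertible X" "invertible Y" and near: "norm (matrix_inv X) * norm (Y - X) \<le> 1/2"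
  shows "norm (matrix_inv Y) \<le> 2 * norm (matrix_inv X)"
proof -
  have "norm (matrix_inv Y - matrix_inv X) \<le> norm (matrix_inv Y) * (norm (matrix_inv X) * norm (Y - X))"
    using norm_matrix_inv_diff_le[OF assms(2,1)] by (simp add: mult_ac)
  also have "\<dots> \<le> norm (matrix_inv Y) * (1/2)"
    by (intro mult_left_mono near) auto
  finally show ?thesis
    using norm_triangle_ineq2[of "matrix_inv Y" "matrix_inv X"] by simp
qed

lemma continuous_on_matrix_inv:
  "continuous_on {X. invertible X} (matrix_inv :: real^'n^'n \<Rightarrow> real^'n^'n)"
proof (clarsimp simp: continuous_on_def)
  fix X :: "real^'n^'n" assume X: "invertible X"
  define c where "c = norm (matrix_inv X)"
  have near: "norm (matrix_inv Y - matrix_inv X) \<le> 2 * c * c * norm (Y - X)"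
    if Y: "invertible Y" and d: "c * norm (Y - X) \<le> 1/2" for Y
  proof -
    have "norm (matrix_inv Y - matrix_inv X) \<le> norm (matrix_inv Y) * (c * norm (Y - X))"
      using norm_matrix_inv_diff_le[OF Y X] by (simp add: c_def mult_ac)
    also have "\<dots> \<le> 2 * c * (c * norm (Y - X))"
      using norm_matrix_inv_near[OF X Y] d by (intro mult_right_mono) (auto simp: c_def)
    finally show ?thesis by (simp add: mult_ac)
  qed
  have "((\<lambda>Y. c * norm (Y - X)) \<longlongrightarrow> c * norm (X - X)) (at X within {X. invertible X})"
    by (intro tendsto_intros)
  then have "\<forall>\<^sub>F Y in at X within {X. invertible X}. c * norm (Y - X) < 1/2"
    by (intro order_tendstoD) auto
  moreover have "\<forall>\<^sub>F Y in at X within {X. invertible X}. invertible Y"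
    by (simp add: eventually_at_filter)
  ultimately have "\<forall>\<^sub>F Y in at X within {X. invertible X}.
      norm (matrix_inv Y - matrix_inv X) \<le> 2 * c * c * norm (Y - X)"
    by eventually_elim (use near in auto)
  moreover have "((\<lambda>Y. 2 * c * c * norm (Y - X)) \<longlongrightarrow> 2 * c * c * norm (X - X))
      (at X within {X. invertible X})"
    by (intro tendsto_intros)
  then have "((\<lambda>Y. 2 * c * c * norm (Y - X)) \<longlongrightarrow> 0) (at X within {X. invertible X})"
    by simp
  ultimately have "((\<lambda>Y. matrix_inv Y - matrix_inv X) \<longlongrightarrow> 0) (at X within {X. invertible X})"
    by (rule Lim_null_comparison)
  then show "(matrix_inv \<longlongrightarrow> matrix_inv X) (at X within {X. invertible X})"
    by (simp add: LIM_zero_iff)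
qed

section \<open>Two orbits of matrices that stay close\<close>

lemma matrix_inv_unique:
  fixes X Y :: "real^'n^'n"
  assumes "X ** Y = mat 1"
  shows "matrix_inv X = Y"
proof -
  have "invertible X" using assms by (auto simp: invertible_right_inverse)
  then show ?thesis by (metis assms matrix_inv_cancel(1) matrix_mul_rid)
qed

lemma matrix_inv_mult:
  fixes X Y :: "real^'n^'n"
  assumes "invertible X" "invertible Y"
  shows "matrix_inv (X ** Y) = matrix_inv Y ** matrix_inv X"
  by (rule matrix_inv_unique)
     (simp add: matrix_mul_assoc matrix_inv_cancel assms matrix_inv_right)

text \<open>A discrete Gronwall estimate: relative increments that are geometrically small change the norm by a
bounded factor, and this factor turns them into absolute increments with a convergent sum.\<close>

lemma norm_diff_le_of_geometric_steps:
  fixes X :: "nat \<Rightarrow> 'a::real_normed_vector"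
  assumes step: "\<And>n. norm (X (Suc n) - X n) \<le> c * \<sigma> ^ n * norm (X n)"
    and c: "0 \<le> c" and \<sigma>: "0 \<le> \<sigma>" "\<sigma> < 1"
  shows "norm (X n - X 0) \<le> c / (1 - \<sigma>) * exp (c / (1 - \<sigma>)) * norm (X 0)"
proof -
  have geo: "(\<Sum>k<n. \<sigma> ^ k) \<le> 1 / (1 - \<sigma>)" for n
    using \<sigma> sum_le_suminf[OF summable_geometric, of \<sigma> "{..<n}"] by (simp add: suminf_geometric)
  have growth: "norm (X n) \<le> exp (c * (\<Sum>k<n. \<sigma> ^ k)) * norm (X 0)" for n
  proof (induction n)
    case (Suc n)
    have "norm (X (Suc n)) \<le> norm (X n) + norm (X (Suc n) - X n)"
      using norm_triangle_ineq[of "X n" "X (Suc n) - X n"] by simp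
    also have "\<dots> \<le> (1 + c * \<sigma> ^ n) * norm (X n)"
      using step[of n] by (simp add: algebra_simps)
    also have "\<dots> \<le> exp (c * \<sigma> ^ n) * (exp (c * (\<Sum>k<n. \<sigma> ^ k)) * norm (X 0))"
      using c \<sigma> by (intro mult_mono exp_ge_add_one_self Suc.IH) auto
    finally show ?case by (simp add: exp_add algebra_simps)
  qed simp
  have bound: "norm (X n) \<le> exp (c / (1 - \<sigma>)) * norm (X 0)" for n
  proof -
    have "c * (\<Sum>k<n. \<sigma> ^ k) \<le> c / (1 - \<sigma>)"
      using mult_left_mono[OF geo c, of n] by simp
    then have "exp (c * (\<Sum>k<n. \<sigma> ^ k)) * norm (X 0) \<le> exp (c / (1 - \<sigma>)) * norm (X 0)"
      by (intro mult_right_mono) auto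
    with growth[of n] show ?thesis by linarith
  qed
  have "norm (X n - X 0) \<le> (\<Sum>k<n. c * \<sigma> ^ k * (exp (c / (1 - \<sigma>)) * norm (X 0)))"
  proof (induction n)
    case (Suc n)
    have "norm (X (Suc n) - X 0) \<le> norm (X (Suc n) - X n) + norm (X n - X 0)"
      using norm_triangle_ineq[of "X (Suc n) - X n" "X n - X 0"] by simp
    also have "norm (X (Suc n) - X n) \<le> c * \<sigma> ^ n * (exp (c / (1 - \<sigma>)) * norm (X 0))"
      by (rule order.trans[OF step mult_left_mono[OF bound]]) (use c \<sigma> in auto)
    finally show ?case using Suc.IH by simp
  qed simp
  also have "\<dots> = c * (\<Sum>k<n. \<sigma> ^ k) * (exp (c / (1 - \<sigma>)) * norm (X 0))"
    by (simp add: sum_distrib_left sum_distrib_right mult_ac)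
  also have "\<dots> \<le> c * (1 / (1 - \<sigma>)) * (exp (c / (1 - \<sigma>)) * norm (X 0))"
    using c by (intro mult_right_mono mult_left_mono geo) auto
  finally show ?thesis by (simp add: mult_ac)
qed

text \<open>The sequences \<open>p\<close> and \<open>q\<close> are the values of \<open>P\<close> along two orbits, \<open>a\<close> and \<open>b\<close> those of the generator. One
step changes \<open>q\<^sub>0 q\<^sub>n\<inverse> p\<^sub>n p\<^sub>0\<inverse>\<close> by right multiplication with the identity plus
\<open>p\<^sub>0 p\<^sub>n\<inverse> b\<^sub>n\<inverse> (a\<^sub>n - b\<^sub>n) p\<^sub>n p\<^sub>0\<inverse>\<close>, whose second part is at most \<open>C\<^sup>2 M h (\<kappa>\<^sup>2 \<theta>)\<^sup>n\<close>. Only the growth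
along \<open>p\<close> enters, so control over one of the two orbits suffices. The bound \<open>h0\<close> makes the constant
\<open>L\<close> independent of \<open>h\<close>.\<close>

lemma norm_conjugacy_drift_le:
  fixes p q a b :: "nat \<Rightarrow> real^'n^'n"
  assumes inv: "\<And>n. invertible (p n)" "\<And>n. invertible (q n)"
      "\<And>n. invertible (a n)" "\<And>n. invertible (b n)"
    and p: "\<And>n. p (Suc n) = a n ** p n" and q: "\<And>n. q (Suc n) = b n ** q n"
    and growth: "\<And>n. norm (p n ** matrix_inv (p 0)) \<le> C * \<kappa> ^ n"
      "\<And>n. norm (p 0 ** matrix_inv (p n)) \<le> C * \<kappa> ^ n"
    and M: "\<And>n. norm (matrix_inv (a n)) \<le> M" "\<And>n. norm (matrix_inv (b n)) \<le> M"
    and close: "\<And>n. norm (a n - b n) \<le> h * \<theta> ^ n"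
    and h: "0 \<le> h" "h \<le> h0" and \<kappa>: "0 \<le> \<kappa>" "0 \<le> \<theta>" "\<kappa> * \<kappa> * \<theta> < 1"
  defines "L \<equiv> C * C * M / (1 - \<kappa> * \<kappa> * \<theta>) * exp (C * C * M * h0 / (1 - \<kappa> * \<kappa> * \<theta>)) * norm (mat 1 :: real^'n^'n)"
  shows "norm (q 0 ** matrix_inv (q n) ** p n ** matrix_inv (p 0) - mat 1) \<le> L * h"
    and "norm (p 0 ** matrix_inv (p n) ** q n ** matrix_inv (q 0) - mat 1) \<le> L * h"
proof -
  define \<sigma> where "\<sigma> = \<kappa> * \<kappa> * \<theta>"
  have \<sigma>: "0 \<le> \<sigma>" "\<sigma> < 1" using \<kappa> by (auto simp: \<sigma>_def)
  have C: "0 \<le> C" using growth(1)[of 0] order.trans[OF norm_ge_zero] by fastforce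
  have M0: "0 \<le> M" using M(1)[of 0] norm_ge_zero[of "matrix_inv (a 0)"] by linarith
  define c where "c = C * C * M * h"
  have c: "0 \<le> c" using C M0 h by (simp add: c_def)
  \<comment> \<open>Transported back to time \<open>0\<close>, an error of size \<open>h \<theta>\<^sup>n\<close> is amplified by at most \<open>C\<^sup>2 \<kappa>\<^sup>2\<^sup>n\<close>.\<close>
  have conj: "norm (p 0 ** matrix_inv (p n) ** (Z ** (a n - b n)) ** (p n ** matrix_inv (p 0)))
      \<le> c * \<sigma> ^ n" if Z: "norm Z \<le> M" for Z n
  proof -
    have "norm (p 0 ** matrix_inv (p n) ** (Z ** (a n - b n)) ** (p n ** matrix_inv (p 0)))
      \<le> norm (p 0 ** matrix_inv (p n) ** (Z ** (a n - b n))) * norm (p n ** matrix_inv (p 0))"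
      by (rule norm_matrix_mult_le)
    also have "\<dots> \<le> norm (p 0 ** matrix_inv (p n)) * norm (Z ** (a n - b n)) * norm (p n ** matrix_inv (p 0))"
      by (intro mult_right_mono norm_matrix_mult_le) auto
    also have "\<dots> \<le> norm (p 0 ** matrix_inv (p n)) * (norm Z * norm (a n - b n)) * norm (p n ** matrix_inv (p 0))"
      by (intro mult_right_mono mult_left_mono norm_matrix_mult_le) auto
    also have "\<dots> \<le> (C * \<kappa> ^ n) * (M * (h * \<theta> ^ n)) * (C * \<kappa> ^ n)"
      using C M0 \<kappa> h by (intro mult_mono growth Z close) auto
    also have "\<dots> = c * \<sigma> ^ n" by (simp add: c_def \<sigma>_def power_mult_distrib mult_ac)
    finally show ?thesis .
  qed
  have final: "norm (X n - mat 1) \<le> L * h"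
    if X0: "X 0 = mat 1" and step: "\<And>n. norm (X (Suc n) - X n) \<le> c * \<sigma> ^ n * norm (X n)"
    for X :: "nat \<Rightarrow> real^'n^'n"
  proof -
    have "norm (X n - mat 1) \<le> c / (1 - \<sigma>) * exp (c / (1 - \<sigma>)) * norm (mat 1 :: real^'n^'n)"
      using norm_diff_le_of_geometric_steps[OF step c \<sigma>, of n] X0 by simp
    also have "\<dots> \<le> c / (1 - \<sigma>) * exp (C * C * M * h0 / (1 - \<sigma>)) * norm (mat 1 :: real^'n^'n)"
      unfolding c_def using C M0 \<sigma> h
      by (intro mult_right_mono mult_left_mono) (auto intro!: divide_right_mono mult_left_mono)
    finally show ?thesis by (simp add: L_def c_def \<sigma>_def mult_ac)
  qed
  note inv_prod = matrix_inv_mult[OF inv(3) inv(1)] matrix_inv_mult[OF inv(4) inv(2)]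
  show "norm (q 0 ** matrix_inv (q n) ** p n ** matrix_inv (p 0) - mat 1) \<le> L * h"
  proof (rule final)
    show "q 0 ** matrix_inv (q 0) ** p 0 ** matrix_inv (p 0) = mat 1"
      by (simp add: matrix_inv_right inv)
    fix n
    let ?Y = "\<lambda>n. q 0 ** matrix_inv (q n) ** p n ** matrix_inv (p 0)"
    let ?E = "p 0 ** matrix_inv (p n) ** (matrix_inv (b n) ** (a n - b n)) ** (p n ** matrix_inv (p 0))"
    have "?Y (Suc n) - ?Y n = ?Y n ** ?E"
      by (simp add: p q inv_prod matrix_mul_assoc matrix_inv_cancel inv
          matrix_mult_diff_left matrix_mult_diff_right)
    then show "norm (?Y (Suc n) - ?Y n) \<le> c * \<sigma> ^ n * norm (?Y n)"
      using norm_matrix_mult_le[of "?Y n" ?E] mult_left_mono[OF conj[OF M(2), of n n] norm_ge_zero[of "?Y n"]]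
      by (simp add: mult_ac)
  qed
  show "norm (p 0 ** matrix_inv (p n) ** q n ** matrix_inv (q 0) - mat 1) \<le> L * h"
  proof (rule final)
    show "p 0 ** matrix_inv (p 0) ** q 0 ** matrix_inv (q 0) = mat 1"
      by (simp add: matrix_inv_right inv)
    fix n
    let ?Y = "\<lambda>n. p 0 ** matrix_inv (p n) ** q n ** matrix_inv (q 0)"
    let ?E = "p 0 ** matrix_inv (p n) ** (matrix_inv (a n) ** (a n - b n)) ** (p n ** matrix_inv (p 0))"
    have "?Y n - ?Y (Suc n) = ?E ** ?Y n"
      by (simp add: p q inv_prod matrix_mul_assoc matrix_inv_cancel inv
          matrix_mult_diff_left matrix_mult_diff_right)
    then have "norm (?Y (Suc n) - ?Y n) = norm (?E ** ?Y n)"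
      by (metis norm_minus_commute)
    then show "norm (?Y (Suc n) - ?Y n) \<le> c * \<sigma> ^ n * norm (?Y n)"
      using norm_matrix_mult_le[of ?E "?Y n"] mult_right_mono[OF conj[OF M(1), of n n] norm_ge_zero[of "?Y n"]]
      by (simp add: mult_ac)
  qed
qed

section \<open>Frequent visits to large sets\<close>

text \<open>The maximum of the Birkhoff sums \<open>\<phi> x + \<dots> + \<phi> (T\<^sup>n\<^sup>-\<^sup>1 x)\<close> over \<open>0 \<le> n \<le> N\<close>, in the recursive form that
Garsia's proof of the maximal ergodic inequality uses.\<close>

primrec max_birkhoff_sum :: "('a \<Rightarrow> 'a) \<Rightarrow> ('a \<Rightarrow> real) \<Rightarrow> nat \<Rightarrow> 'a \<Rightarrow> real" where
  "max_birkhoff_sum T \<phi> 0 x = 0"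
| "max_birkhoff_sum T \<phi> (Suc N) x = max 0 (\<phi> x + max_birkhoff_sum T \<phi> N (T x))"

lemma birkhoff_sum_le_max: "n \<le> N \<Longrightarrow> (\<Sum>k<n. \<phi> ((T ^^ k) x)) \<le> max_birkhoff_sum T \<phi> N x"
proof (induction N arbitrary: n x)
  case (Suc N)
  show ?case
  proof (cases n)
    case (Suc m)
    then have "(\<Sum>k<n. \<phi> ((T ^^ k) x)) = \<phi> x + (\<Sum>k<m. \<phi> ((T ^^ k) (T x)))"
      by (simp add: sum.lessThan_Suc_shift funpow_swap1 del: sum.lessThan_Suc)
    then show ?thesis using Suc.IH[of m "T x"] Suc.prems Suc by simp
  qed simp
qed simp

lemma max_birkhoff_sum_mono: "max_birkhoff_sum T \<phi> N x \<le> max_birkhoff_sum T \<phi> (Suc N) x"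
proof (induction N arbitrary: x)
  case (Suc N)
  show ?case using Suc.IH[of "T x"] by simp
qed simp

lemma max_birkhoff_sum_nonneg: "0 \<le> max_birkhoff_sum T \<phi> N x"
  by (cases N) auto

lemma max_birkhoff_sum_bounded:
  assumes "\<And>x. \<bar>\<phi> x\<bar> \<le> c"
  shows "\<bar>max_birkhoff_sum T \<phi> N x\<bar> \<le> N * c"
proof (induction N arbitrary: x)
  case (Suc N)
  have "0 \<le> c" using assms[of x] by linarith
  then show ?case using Suc.IH[of "T x"] assms[of x] by (auto simp: algebra_simps abs_le_iff max_def)
qed simp

lemma borel_measurable_max_birkhoff_sum:
  assumes [measurable]: "T \<in> measurable M M" "\<phi> \<in> borel_measurable M"
  shows "max_birkhoff_sum T \<phi> N \<in> borel_measurable M"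
proof (induction N)
  case (Suc N)
  note [measurable] = Suc.IH
  show ?case by (simp add: max_birkhoff_sum.simps(2)[abs_def])
qed (simp add: max_birkhoff_sum.simps(1)[abs_def])

text \<open>Garsia's argument for \<open>\<phi> = 1\<^sub>B - \<delta>\<close>. Let \<open>F\<close> be the maximal Birkhoff sum. Where \<open>F > 0\<close>, the maximum is
attained after at least one step, so \<open>F \<le> \<phi> + F \<circ> T\<close>; elsewhere \<open>F = 0 \<le> F \<circ> T\<close>. Integrating, the
integral of \<open>\<phi>\<close> over \<open>{F > 0}\<close> is nonnegative because \<open>F\<close> and \<open>F \<circ> T\<close> have the same integral.\<close>

lemma (in prob_space) maximal_ergodic_inequality:
  assumes T [measurable]: "T \<in> measurable M M" and inv: "distr M M T = M"
    and B [measurable]: "B \<in> sets M" and \<delta>: "0 < \<delta>"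
  shows "prob {x \<in> space M. \<exists>n. \<delta> * n < (\<Sum>k<n. indicat_real B ((T ^^ k) x))} \<le> prob B / \<delta>"
proof -
  define \<phi> :: "'a \<Rightarrow> real" where "\<phi> x = indicat_real B x - \<delta>" for x
  have [measurable]: "\<phi> \<in> borel_measurable M" unfolding \<phi>_def
    by (intro borel_measurable_diff borel_measurable_indicator B borel_measurable_const)
  have bnd: "\<bar>\<phi> x\<bar> \<le> 1 + \<delta>" for x
    using \<delta> by (auto simp: \<phi>_def indicator_def)
  define F where "F = max_birkhoff_sum T \<phi>"
  have F [measurable]: "F N \<in> borel_measurable M" for N
    unfolding F_def by (rule borel_measurable_max_birkhoff_sum) measurable
  have Fbnd: "\<bar>F N x\<bar> \<le> N * (1 + \<delta>)" for N x
    unfolding F_def by (rule max_birkhoff_sum_bounded[OF bnd])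
  have int: "integrable M (F N)" for N
    by (rule integrable_const_bound[where B = "N * (1 + \<delta>)"]) (use Fbnd F in auto)
  have intT: "integrable M (\<lambda>x. F N (T x))" "(\<integral>x. F N (T x) \<partial>M) = (\<integral>x. F N x \<partial>M)" for N
  proof -
    have "integrable (distr M M T) (F N)" unfolding inv by (rule int)
    then show "integrable M (\<lambda>x. F N (T x))" using integrable_distr_eq[OF T F] by blast
    show "(\<integral>x. F N (T x) \<partial>M) = (\<integral>x. F N x \<partial>M)"
      using integral_distr[OF T F, of N] unfolding inv by simp
  qed
  define G where "G N = {x \<in> space M. F N x > 0}" for N
  have G [measurable]: "G N \<in> sets M" for N unfolding G_def by measurable
  have G_le: "prob (G N) \<le> prob B / \<delta>" for N
  proof (cases N)
    case 0
    then show ?thesis using \<delta> by (simp add: G_def F_def)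
  next
    case (Suc N')
    have "0 = (\<integral>x. F N x - F N (T x) \<partial>M)"
      using int intT by (simp add: Bochner_Integration.integral_diff)
    also have "\<dots> \<le> (\<integral>x. indicat_real B x - \<delta> * indicat_real (G N) x \<partial>M)"
    proof (rule integral_mono)
      show "integrable M (\<lambda>x. F N x - F N (T x))" using int intT by auto
      show "integrable M (\<lambda>x. indicat_real B x - \<delta> * indicat_real (G N) x)"
        by (intro Bochner_Integration.integrable_diff integrable_mult_right integrable_indicator
          integrable_real_indicator) (auto simp: emeasure_eq_measure)
      fix x assume x: "x \<in> space M"
      show "F N x - F N (T x) \<le> indicat_real B x - \<delta> * indicat_real (G N) x"
      proof (cases "F N x > 0")
        case True
        then have "F N x = \<phi> x + F N' (T x)" using Suc by (auto simp: F_def max_def split: if_splits)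
        moreover have "F N' (T x) \<le> F N (T x)"
          unfolding F_def Suc by (rule max_birkhoff_sum_mono)
        ultimately show ?thesis using True x by (simp add: \<phi>_def G_def)
      next
        case False
        then show ?thesis
          using max_birkhoff_sum_nonneg[of T \<phi> N x] max_birkhoff_sum_nonneg[of T \<phi> N "T x"]
          by (auto simp: F_def G_def indicator_def)
      qed
    qed
    also have "\<dots> = prob B - \<delta> * prob (G N)"
      by (subst Bochner_Integration.integral_diff) (auto simp: emeasure_eq_measure)
    finally show ?thesis using \<delta> by (simp add: field_simps)
  qed
  have "G N \<subseteq> G (Suc N)" for N
    using max_birkhoff_sum_mono[of T \<phi> N] less_le_trans unfolding G_def F_def by blast
  then have "incseq G" by (rule incseq_SucI)
  then have lim: "(\<lambda>N. prob (G N)) \<longlonglongrightarrow> prob (\<Union>N. G N)"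
    by (intro finite_Lim_measure_incseq) auto
  have "{x \<in> space M. \<exists>n. \<delta> * n < (\<Sum>k<n. indicat_real B ((T ^^ k) x))} \<subseteq> (\<Union>N. G N)"
  proof safe
    fix x n assume x: "x \<in> space M" and n: "\<delta> * real n < (\<Sum>k<n. indicat_real B ((T ^^ k) x))"
    have "(\<Sum>k<n. \<phi> ((T ^^ k) x)) > 0" using n by (simp add: \<phi>_def sum_subtractf mult.commute)
    then have "x \<in> G n" using birkhoff_sum_le_max[of n n \<phi> T x] x by (simp add: G_def F_def)
    then show "x \<in> (\<Union>N. G N)" by blast
  qed
  then have "prob {x \<in> space M. \<exists>n. \<delta> * n < (\<Sum>k<n. indicat_real B ((T ^^ k) x))} \<le> prob (\<Union>N. G N)"
    by (rule finite_measure_mono) measurable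
  also have "\<dots> \<le> prob B / \<delta>" using lim by (rule LIMSEQ_le_const2) (use G_le in auto)
  finally show ?thesis .
qed

lemma funpow_measurable [measurable (raw)]:
  "T \<in> measurable M M \<Longrightarrow> (T ^^ k) \<in> measurable M M"
  by (induction k) (auto intro: measurable_comp)

text \<open>The set of points with infinitely many visits to \<open>D\<close> is exactly invariant, and by invariance of the
measure it is as large as the set of points with at least one visit.\<close>

lemma ergodic_AE_visits:
  assumes erg: "ergodic_measure T M" and D [measurable]: "D \<in> sets M" and pos: "measure M D > 0"
  shows "AE x in M. \<exists>m. (T ^^ m) x \<in> D"
proof -
  interpret prob_space M using erg by (simp add: ergodic_measure_def)
  have T [measurable]: "T \<in> measurable M M" and inv: "distr M M T = M"
    using erg by (auto simp: ergodic_measure_def)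
  define V where "V n = {x \<in> space M. \<exists>m\<ge>n. (T ^^ m) x \<in> D}" for n
  have V [measurable]: "V n \<in> sets M" for n unfolding V_def by measurable
  have V_Suc: "T -` V n \<inter> space M = V (Suc n)" for n
  proof -
    have "(\<exists>m\<ge>n. (T ^^ m) (T x) \<in> D) \<longleftrightarrow> (\<exists>m\<ge>Suc n. (T ^^ m) x \<in> D)" for x
    proof -
      have "(\<exists>m\<ge>Suc n. (T ^^ m) x \<in> D) \<longleftrightarrow> (\<exists>m\<ge>n. (T ^^ Suc m) x \<in> D)"
        by (metis Suc_le_D Suc_le_mono)
      then show ?thesis by (simp add: funpow_swap1)
    qed
    then show ?thesis using measurable_space[OF T] by (auto simp: V_def)
  qed
  have "prob (V (Suc n)) = prob (V n)" for n
    using measure_distr[OF T V[of n]] by (simp add: inv V_Suc)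
  then have Vn: "prob (V n) = prob (V 0)" for n by (induction n) auto
  \<comment> \<open>\<open>V n\<close> collects the points with a visit at some time \<open>\<ge> n\<close>, so \<open>W\<close> those with infinitely many visits.\<close>
  define W where "W = (\<Inter>n. V n)"
  have W [measurable]: "W \<in> sets M" unfolding W_def by measurable
  have dec: "decseq V" unfolding V_def by (intro decseq_SucI) (auto dest: Suc_leD)
  have "(\<lambda>n. prob (V n)) \<longlonglongrightarrow> prob W"
    unfolding W_def using dec by (intro finite_Lim_measure_decseq) auto
  moreover have "(\<lambda>n. prob (V n)) = (\<lambda>_. prob (V 0))" using Vn by blast
  ultimately have "prob W = prob (V 0)" by (simp only: LIMSEQ_const_iff)
  moreover have "D \<subseteq> V 0"
    using sets.sets_into_space[OF D] by (auto simp: V_def intro!: exI[of _ 0])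
  then have "prob D \<le> prob (V 0)" by (intro finite_measure_mono) auto
  moreover have "T -` W \<inter> space M = W"
  proof -
    have "T -` W \<inter> space M = (\<Inter>n. V (Suc n))" by (auto simp: W_def simp flip: V_Suc)
    also have "\<dots> = W" unfolding W_def using decseq_Suc_iff[of V] dec by blast
    finally show ?thesis .
  qed
  then have "prob W = 0 \<or> prob W = 1" using erg W by (auto simp: ergodic_measure_def)
  ultimately have "prob W = 1" using pos by linarith
  then have "AE x in M. x \<in> W" by (simp add: prob_eq_1)
  then show ?thesis by eventually_elim (auto simp: W_def V_def)
qed

text \<open>The fraction \<open>\<delta>\<close> bounds the times outside \<open>K\<close> in \<^emph>\<open>every\<close> initial segment of the orbit, not only
asymptotically; for \<open>\<delta> < 1\<close> this forces \<open>x \<in> K\<close>.\<close>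

definition frequently_in :: "('a \<Rightarrow> 'a) \<Rightarrow> 'a set \<Rightarrow> real \<Rightarrow> 'a \<Rightarrow> bool" where
  "frequently_in T K \<delta> x \<longleftrightarrow> (\<forall>n. (\<Sum>k<n. indicat_real (- K) ((T ^^ k) x)) \<le> \<delta> * real n)"

lemma sets_frequently_in:
  assumes T [measurable]: "T \<in> measurable M M" and K [measurable]: "K \<in> sets M"
  shows "{x \<in> space M. frequently_in T K \<delta> x} \<in> sets M"
proof -
  have "{x \<in> space M. frequently_in T K \<delta> x} =
     {x \<in> space M. \<forall>n. (\<Sum>k<n. 1 - indicat_real K ((T ^^ k) x)) \<le> \<delta> * real n}"
    by (simp add: frequently_in_def indicator_compl)
  also have "\<dots> \<in> sets M" by measurable
  finally show ?thesis .
qed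

lemma prob_frequently_in:
  assumes erg: "ergodic_measure T M" and K [measurable]: "K \<in> sets M" and "0 < \<delta>"
  shows "measure M {x \<in> space M. frequently_in T K \<delta> x} \<ge> 1 - measure M (space M - K) / \<delta>"
proof -
  interpret prob_space M using erg by (simp add: ergodic_measure_def)
  have T [measurable]: "T \<in> measurable M M" and inv: "distr M M T = M"
    using erg by (auto simp: ergodic_measure_def)
  let ?E = "{x \<in> space M. \<exists>n. \<delta> * n < (\<Sum>k<n. indicat_real (space M - K) ((T ^^ k) x))}"
  have "(T ^^ k) x \<in> space M" if "x \<in> space M" for x k
    using measurable_space[OF funpow_measurable[OF T] that] .
  then have "(\<Sum>k<n. indicat_real (space M - K) ((T ^^ k) x)) = (\<Sum>k<n. indicat_real (- K) ((T ^^ k) x))"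
    if "x \<in> space M" for x n
    using that by (intro sum.cong) (auto simp: indicator_def)
  then have "x \<in> ?E \<longleftrightarrow> \<not> frequently_in T K \<delta> x" if "x \<in> space M" for x
    using that by (simp add: frequently_in_def not_le)
  then have "{x \<in> space M. frequently_in T K \<delta> x} = space M - ?E" by blast
  moreover have "?E \<in> events" by measurable
  ultimately have "prob {x \<in> space M. frequently_in T K \<delta> x} = 1 - prob ?E"
    by (simp add: prob_compl)
  moreover have "prob ?E \<le> prob (space M - K) / \<delta>"
    using maximal_ergodic_inequality[OF T inv, of "space M - K" \<delta>] assms by auto
  ultimately show ?thesis by linarith
qed

lemma AE_eventually_frequently_in:
  assumes erg: "ergodic_measure T M" and K: "K \<in> sets M" and "0 < \<delta>"
    and small: "measure M (space M - K) < \<delta>"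
  shows "AE x in M. \<exists>m. frequently_in T K \<delta> ((T ^^ m) x)"
proof -
  have T: "T \<in> measurable M M" using erg by (auto simp: ergodic_measure_def)
  have "measure M (space M - K) / \<delta> < 1" using small \<open>0 < \<delta>\<close> by simp
  then have "measure M {x \<in> space M. frequently_in T K \<delta> x} > 0"
    using prob_frequently_in[OF erg K \<open>0 < \<delta>\<close>] by linarith
  from ergodic_AE_visits[OF erg sets_frequently_in[OF T K] this]
  show ?thesis by eventually_elim auto
qed

text \<open>Two orbits that each spend most of their time in \<open>K\<close> are there simultaneously at arbitrarily late
times. Different delays \<open>m\<close> and \<open>m'\<close> are harmless since only densities matter.\<close>

lemma common_visit:
  assumes x: "frequently_in T K \<delta> ((T ^^ m) x)" and y: "frequently_in T K \<delta> ((T ^^ m') y)"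
    and \<delta>: "\<delta> \<le> 1/6"
  shows "\<exists>k\<ge>n0. (T ^^ k) x \<in> K \<and> (T ^^ k) y \<in> K"
proof (rule ccontr)
  assume none: "\<not> ?thesis"
  \<comment> \<open>Among the \<open>L + 1\<close> times from \<open>L\<close> to \<open>2 L\<close>, each orbit is outside \<open>K\<close> at most \<open>(2 L + 1) / 6\<close> times,
    so together less often than \<open>L + 1\<close> times.\<close>
  define L where "L = m + m' + n0"
  have late: "(\<Sum>k=L..<2 * L + 1. indicat_real (- K) ((T ^^ k) z)) \<le> (2 * real L + 1) / 6"
    if z: "frequently_in T K \<delta> ((T ^^ m) z)" and m: "m \<le> L" for z m
  proof -
    have "(\<Sum>k=L..<2 * L + 1. indicat_real (- K) ((T ^^ k) z) :: real)
        \<le> (\<Sum>k=m..<2 * L + 1. indicat_real (- K) ((T ^^ k) z))"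
      using m by (intro sum_mono2) auto
    also have "\<dots> = (\<Sum>k<2 * L + 1 - m. indicat_real (- K) ((T ^^ k) ((T ^^ m) z)))"
    proof (rule sum.reindex_bij_witness[of _ "\<lambda>k. k + m" "\<lambda>k. k - m"])
      fix k assume "k \<in> {m..<2 * L + 1}"
      then have "(T ^^ (k - m)) ((T ^^ m) z) = (T ^^ k) z"
        by (metis atLeastLessThan_iff comp_apply funpow_add le_add_diff_inverse2)
      then show "indicat_real (- K) ((T ^^ (k - m)) ((T ^^ m) z)) = indicat_real (- K) ((T ^^ k) z)"
        by simp
    qed (use m in auto)
    also have "\<dots> \<le> \<delta> * real (2 * L + 1 - m)" using z by (simp add: frequently_in_def)
    also have "\<dots> \<le> 1/6 * real (2 * L + 1)" 
      using \<delta> by (intro mult_mono) auto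
    finally show ?thesis by simp
  qed
  have "real (L + 1) = (\<Sum>k=L..<2 * L + 1. 1)" by simp
  also have "\<dots> \<le> (\<Sum>k=L..<2 * L + 1. indicat_real (- K) ((T ^^ k) x) + indicat_real (- K) ((T ^^ k) y))"
    using none by (intro sum_mono) (auto simp: indicator_def L_def)
  also have "\<dots> \<le> (2 * real L + 1) / 6 + (2 * real L + 1) / 6"
    using late[OF x] late[OF y] by (simp add: sum.distrib L_def)
  finally show False by simp
qed

section \<open>Local product structure as a statement about almost all pairs\<close>

lemma measurable_coordinate: "(\<lambda>x :: int \<Rightarrow> nat. x n) \<in> borel_measurable borel"
  by (rule measurable_product_coordinates)

lemma sets_coordinate_vimage: "(\<lambda>x :: int \<Rightarrow> nat. x n) -` B \<in> sets borel"
  using measurable_sets[OF measurable_coordinate, of B n]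
  by (simp add: borel_open Topological_Spaces.open_discrete)

lemma sets_subshift: "subshift l q \<in> sets borel"
proof -
  have "subshift l q = (\<Inter>n. (\<lambda>x. x n) -` {1..l} \<inter>
      (\<Union>k. (\<lambda>x. x n) -` {k} \<inter> (\<lambda>x. x (n + 1)) -` {j. q k j = 1}))"
    by (auto simp: subshift_def)
  also have "\<dots> \<in> sets borel"
    by (rule sets.countable_INT)
      (intro UNIV_not_empty image_subsetI sets.Int sets.countable_UN sets_coordinate_vimage)+
  finally show ?thesis .
qed

lemma sets_cyl: "cyl l q i \<in> sets borel"
proof -
  have "cyl l q i = subshift l q \<inter> (\<lambda>x. x 0) -` {i}" by (auto simp: cyl_def)
  then show ?thesis using sets_subshift sets_coordinate_vimage by auto
qed

text \<open>The pasts that fit a symbol \<open>i\<close> form a measurable set, because being continued by \<open>i\<close> depends on the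
last coordinate only. (Images of measurable sets need not be measurable in general.)\<close>

lemma proj_s_cyl:
  assumes "cyl l q i \<noteq> {}"
  shows "proj_s ` cyl l q i = {a \<in> subshift_s l q. q (a (-1)) i = 1}"
proof safe
  fix x assume x: "x \<in> cyl l q i"
  then show "proj_s x \<in> subshift_s l q" by (auto intro: proj_s_in simp: cyl_def)
  have "q (x (-1)) (x (-1 + 1)) = 1" using x unfolding cyl_def subshift_def by blast
  then show "q (proj_s x (-1)) i = 1" using x by (simp add: proj_s_def cyl_def)
next
  fix a assume a: "a \<in> subshift_s l q" "q (a (-1)) i = 1"
  obtain x where x: "x \<in> cyl l q i" using assms by blast
  have "glue (a, x) \<in> cyl l q i"
  proof -
    have "q (glue (a, x) n) (glue (a, x) (n + 1)) = 1" for n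
    proof -
      consider "n \<ge> 0" | "n = -1" | "n \<le> -2" by linarith
      then show ?thesis
        by cases (use a x in \<open>auto simp: glue_def subshift_s_def cyl_def subshift_def\<close>)
    qed
    then show ?thesis using a x by (auto simp: glue_def subshift_s_def cyl_def subshift_def)
  qed
  moreover have "proj_s (glue (a, x)) = a"
    using a by (auto simp: proj_s_def glue_def subshift_s_def extensional_def fun_eq_iff)
  ultimately show "a \<in> proj_s ` cyl l q i" by (metis imageI)
qed

lemma proj_u_cyl:
  assumes "cyl l q i \<noteq> {}"
  shows "proj_u ` cyl l q i = {b \<in> subshift_u l q. b 0 = i}"
proof safe
  fix x assume x: "x \<in> cyl l q i"
  then show "proj_u x \<in> subshift_u l q" by (auto intro: proj_u_in simp: cyl_def)
  show "proj_u x 0 = i" using x by (simp add: proj_u_def cyl_def)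
next
  fix b assume b: "b \<in> subshift_u l q" "i = b 0"
  obtain x where x: "x \<in> cyl l q i" using assms b by blast
  have "glue (x, b) \<in> cyl l q i"
  proof -
    have "q (glue (x, b) n) (glue (x, b) (n + 1)) = 1" for n
    proof -
      consider "n \<ge> 0" | "n = -1" | "n \<le> -2" by linarith
      then show ?thesis
      proof cases
        case 2
        have "q (x (-1)) (x (-1 + 1)) = 1" using x unfolding cyl_def subshift_def by blast
        then show ?thesis using 2 b x by (simp add: glue_def cyl_def)
      qed (use b x in \<open>auto simp: glue_def subshift_u_def cyl_def subshift_def\<close>)
    qed
    then show ?thesis using b x by (auto simp: glue_def subshift_u_def cyl_def subshift_def)
  qed
  moreover have "proj_u (glue (x, b)) = b"
    using b by (auto simp: proj_u_def glue_def subshift_u_def extensional_def fun_eq_iff)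
  ultimately show "b \<in> proj_u ` cyl l q (b 0)" using b(2) by (metis imageI)
qed

text \<open>The only consequence of local product structure that is used. The point \<open>glue (y, x)\<close> has the
past of \<open>y\<close> and the present and future of \<open>x\<close>. As the density \<open>\<xi>\<close> is positive, within each cylinder a null set of \<open>\<mu>\<close> is
a null set of the product of the two projections of \<open>\<mu>\<close>, and Fubini's theorem gives both orders of
quantification.\<close>

lemma AE_glue:
  assumes \<mu>: "prob_space \<mu>" and sets: "sets \<mu> = sets (restrict_space borel (subshift l q))"
    and lps: "local_product_structure l q \<mu>" and AE: "AE z in \<mu>. \<phi> z"
  shows "AE x in \<mu>. AE y in \<mu>. x 0 = y 0 \<longrightarrow> \<phi> (glue (y, x))"
    and "AE y in \<mu>. AE x in \<mu>. x 0 = y 0 \<longrightarrow> \<phi> (glue (y, x))"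
proof -
  interpret prob_space \<mu> by fact
  have space: "space \<mu> = subshift l q"
    using sets_eq_imp_space_eq[OF sets] by (simp add: space_restrict_space)
  have cyl: "cyl l q i \<in> sets \<mu>" for i
    unfolding sets by (subst sets_restrict_space) (auto simp: image_iff cyl_def intro!: bexI[OF _ sets_cyl[of l q i]])
  have coord: "(\<lambda>x. x n) \<in> borel_measurable \<mu>" for n :: int
    unfolding measurable_cong_sets[OF sets refl]
    by (intro measurable_restrict_space1 measurable_coordinate)
  have "(\<lambda>x. proj_s x n) \<in> borel_measurable \<mu>" for n
    by (cases "n < 0") (simp_all add: proj_s_def coord)
  then have proj_s_meas: "proj_s \<in> measurable \<mu> (restrict_space borel (subshift_s l q))"
    by (intro measurable_restrict_space2 measurable_coordinatewise_then_product)
      (auto simp: space intro: proj_s_in)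
  have "(\<lambda>x. proj_u x n) \<in> borel_measurable \<mu>" for n
    by (cases "n < 0") (simp_all add: proj_u_def coord)
  then have proj_u_meas: "proj_u \<in> measurable \<mu> (restrict_space borel (subshift_u l q))"
    by (intro measurable_restrict_space2 measurable_coordinatewise_then_product)
      (auto simp: space intro: proj_u_in)
  from lps obtain \<xi> :: "(int \<Rightarrow> nat) \<Rightarrow> real" where
    \<xi>_lps: "continuous_on (subshift l q) \<xi> \<and> (\<forall>x\<in>subshift l q. \<xi> x > 0) \<and>
        (\<forall>i\<in>{1..l}. restrict_space \<mu> (cyl l q i) =
           distr
             (density
               (restrict_space (measure_s l q \<mu>) (proj_s ` cyl l q i) \<Otimes>\<^sub>M
                restrict_space (measure_u l q \<mu>) (proj_u ` cyl l q i))
               (\<lambda>p. ennreal (\<xi> (glue p))))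
             (restrict_space \<mu> (cyl l q i))
             glue)"
    unfolding local_product_structure_def by (rule exE)
  note \<xi> = \<xi>_lps[THEN conjunct1] bspec[OF \<xi>_lps[THEN conjunct2, THEN conjunct1]]
  note eq = bspec[OF \<xi>_lps[THEN conjunct2, THEN conjunct2]]
  have both: "(AE x in \<mu>. x \<in> cyl l q i \<longrightarrow> (AE y in \<mu>. y \<in> cyl l q i \<longrightarrow> \<phi> (glue (y, x)))) \<and>
     (AE y in \<mu>. y \<in> cyl l q i \<longrightarrow> (AE x in \<mu>. x \<in> cyl l q i \<longrightarrow> \<phi> (glue (y, x))))"
    if i: "i \<in> {1..l}" for i
  proof (cases "cyl l q i = {}")
    case False
    define \<sigma> where "\<sigma> = restrict_space (measure_s l q \<mu>) (proj_s ` cyl l q i)"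
    define \<upsilon> where "\<upsilon> = restrict_space (measure_u l q \<mu>) (proj_u ` cyl l q i)"
    have \<Omega>s: "proj_s ` cyl l q i \<in> sets (measure_s l q \<mu>)"
    proof -
      have "proj_s ` cyl l q i =
          subshift_s l q \<inter> (\<lambda>a. a (-1)) -` {k. q k i = 1}"
        unfolding proj_s_cyl[OF False] by (simp add: set_eq_iff)
      with sets_coordinate_vimage show ?thesis
        unfolding measure_s_def sets_distr sets_restrict_space by (rule rev_image_eqI)
    qed
    have \<Omega>u: "proj_u ` cyl l q i \<in> sets (measure_u l q \<mu>)"
    proof -
      have "proj_u ` cyl l q i =
          subshift_u l q \<inter> (\<lambda>b. b 0) -` {i}"
        unfolding proj_u_cyl[OF False] by (simp add: set_eq_iff)
      with sets_coordinate_vimage show ?thesis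
        unfolding measure_u_def sets_distr sets_restrict_space by (rule rev_image_eqI)
    qed
    have space_\<sigma>: "space \<sigma> = proj_s ` cyl l q i" and space_\<upsilon>: "space \<upsilon> = proj_u ` cyl l q i"
      using sets.sets_into_space[OF \<Omega>s] sets.sets_into_space[OF \<Omega>u]
      by (auto simp: \<sigma>_def \<upsilon>_def space_restrict_space)
    interpret s: prob_space "measure_s l q \<mu>"
      unfolding measure_s_def by (rule prob_space_distr[OF proj_s_meas])
    interpret u: prob_space "measure_u l q \<mu>"
      unfolding measure_u_def by (rule prob_space_distr[OF proj_u_meas])
    interpret \<sigma>: finite_measure \<sigma>
      unfolding \<sigma>_def using s.finite_measure_axioms \<Omega>s by (rule finite_measure_restrict_space)
    interpret \<upsilon>: finite_measure \<upsilon>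
      unfolding \<upsilon>_def using u.finite_measure_axioms \<Omega>u by (rule finite_measure_restrict_space)
    interpret su: pair_sigma_finite \<sigma> \<upsilon>
      by (rule pair_sigma_finite.intro[OF \<sigma>.sigma_finite_measure_axioms \<upsilon>.sigma_finite_measure_axioms])
    interpret us: pair_sigma_finite \<upsilon> \<sigma>
      by (rule pair_sigma_finite.intro[OF \<upsilon>.sigma_finite_measure_axioms \<sigma>.sigma_finite_measure_axioms])
    have coord_\<sigma>: "(\<lambda>a. a n) \<in> borel_measurable \<sigma>" for n :: int
      unfolding \<sigma>_def measure_s_def
      by (intro measurable_restrict_space1) (simp add: measurable_restrict_space1)
    have coord_\<upsilon>: "(\<lambda>a. a n) \<in> borel_measurable \<upsilon>" for n :: int
      unfolding \<upsilon>_def measure_u_def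
      by (intro measurable_restrict_space1) (simp add: measurable_restrict_space1)
    have glue_cyl: "glue p \<in> cyl l q i" if "p \<in> space (\<sigma> \<Otimes>\<^sub>M \<upsilon>)" for p
      using that glue_in_cyl by (auto simp: space_pair_measure space_\<sigma> space_\<upsilon>)
    have glue_borel: "glue \<in> borel_measurable (\<sigma> \<Otimes>\<^sub>M \<upsilon>)"
    proof (rule measurable_coordinatewise_then_product)
      fix n :: int
      show "(\<lambda>p. glue p n) \<in> borel_measurable (\<sigma> \<Otimes>\<^sub>M \<upsilon>)"
        using measurable_compose[OF measurable_fst coord_\<sigma>[of n]]
          measurable_compose[OF measurable_snd coord_\<upsilon>[of n]]
        by (cases "n < 0") (simp_all add: glue_def split_def)
    qed
    have glue_shift: "glue \<in> measurable (\<sigma> \<Otimes>\<^sub>M \<upsilon>) (restrict_space borel (subshift l q))"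
      using glue_cyl by (intro measurable_restrict_space2 glue_borel) (auto simp: cyl_def)
    then have glue_meas: "glue \<in> measurable (\<sigma> \<Otimes>\<^sub>M \<upsilon>) (restrict_space \<mu> (cyl l q i))"
      using glue_cyl unfolding measurable_cong_sets[OF refl sets, symmetric]
      by (intro measurable_restrict_space2) auto
    have dens: "(\<lambda>p. ennreal (\<xi> (glue p))) \<in> borel_measurable (\<sigma> \<Otimes>\<^sub>M \<upsilon>)"
      using measurable_compose[OF glue_shift borel_measurable_continuous_on_restrict[OF \<xi>(1)]]
      by measurable
    have "AE z in restrict_space \<mu> (cyl l q i). \<phi> z"
      using AE cyl[of i] by (subst AE_restrict_space_iff) auto
    then have "AE p in density (\<sigma> \<Otimes>\<^sub>M \<upsilon>) (\<lambda>p. ennreal (\<xi> (glue p))). \<phi> (glue p)"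
      using AE_distrD[of glue "density (\<sigma> \<Otimes>\<^sub>M \<upsilon>) (\<lambda>p. ennreal (\<xi> (glue p)))" "restrict_space \<mu> (cyl l q i)" \<phi>] 
        glue_meas unfolding \<sigma>_def \<upsilon>_def eq[OF i, symmetric] by simp
    then have pair: "AE p in \<sigma> \<Otimes>\<^sub>M \<upsilon>. \<phi> (glue p)"
      unfolding AE_density[OF dens] by (rule AE_mp) (use glue_cyl \<xi>(2) in \<open>auto simp: cyl_def\<close>)
    have from_\<sigma>: "AE y in \<mu>. y \<in> cyl l q i \<longrightarrow> \<psi> (proj_s y)" if "AE a in \<sigma>. \<psi> a" for \<psi>
    proof -
      have "AE a in measure_s l q \<mu>. a \<in> proj_s ` cyl l q i \<longrightarrow> \<psi> a"
        using that \<Omega>s unfolding \<sigma>_def by (subst (asm) AE_restrict_space_iff) auto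
      from AE_distrD[OF proj_s_meas this[unfolded measure_s_def]] show ?thesis
        by eventually_elim auto
    qed
    have from_\<upsilon>: "AE y in \<mu>. y \<in> cyl l q i \<longrightarrow> \<psi> (proj_u y)" if "AE a in \<upsilon>. \<psi> a" for \<psi>
    proof -
      have "AE a in measure_u l q \<mu>. a \<in> proj_u ` cyl l q i \<longrightarrow> \<psi> a"
        using that \<Omega>u unfolding \<upsilon>_def by (subst (asm) AE_restrict_space_iff) auto
      from AE_distrD[OF proj_u_meas this[unfolded measure_u_def]] show ?thesis
        by eventually_elim auto
    qed
    have glue_proj': "glue (proj_s y, proj_u x) = glue (y, x)" for x y
      by (auto simp: glue_def proj_s_def proj_u_def)
    have "AE a in \<sigma>. AE b in \<upsilon>. \<phi> (glue (a, b))" using su.AE_pair[OF pair] .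
    then have 1: "AE y in \<mu>. y \<in> cyl l q i \<longrightarrow> (AE b in \<upsilon>. \<phi> (glue (proj_s y, b)))"
      by (rule from_\<sigma>)
    \<comment> \<open>The other order of quantification, by exchanging the factors of the product.\<close>
    have "AE p in \<upsilon> \<Otimes>\<^sub>M \<sigma>. \<phi> (glue (case p of (x, y) \<Rightarrow> (y, x)))"
      using pair by (subst (asm) su.distr_pair_swap) (rule AE_distrD[OF measurable_pair_swap'])
    from us.AE_pair[OF this] have "AE b in \<upsilon>. AE a in \<sigma>. \<phi> (glue (a, b))" by simp
    then have 2: "AE x in \<mu>. x \<in> cyl l q i \<longrightarrow> (AE a in \<sigma>. \<phi> (glue (a, proj_u x)))"
      by (rule from_\<upsilon>)
    show ?thesis
    proof
      show "AE x in \<mu>. x \<in> cyl l q i \<longrightarrow> (AE y in \<mu>. y \<in> cyl l q i \<longrightarrow> \<phi> (glue (y, x)))"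
        using 2 by eventually_elim (use from_\<sigma> glue_proj' in fastforce)
      show "AE y in \<mu>. y \<in> cyl l q i \<longrightarrow> (AE x in \<mu>. x \<in> cyl l q i \<longrightarrow> \<phi> (glue (y, x)))"
        using 1 by eventually_elim (use from_\<upsilon> glue_proj' in fastforce)
    qed
  qed auto
  have cyl_iff: "x \<in> cyl l q i \<longleftrightarrow> x 0 = i" if "x \<in> space \<mu>" for x i
    using that by (auto simp: cyl_def space)
  have sym: "x 0 \<in> {1..l}" if "x \<in> space \<mu>" for x using that by (auto simp: space subshift_def)
  have fin: "AE x in \<mu>. \<forall>i\<in>{1..l}. x \<in> cyl l q i \<longrightarrow> (AE y in \<mu>. y \<in> cyl l q i \<longrightarrow> \<phi> (glue (y, x)))"
    "AE y in \<mu>. \<forall>i\<in>{1..l}. y \<in> cyl l q i \<longrightarrow> (AE x in \<mu>. x \<in> cyl l q i \<longrightarrow> \<phi> (glue (y, x)))"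
    using both by (intro AE_finite_allI, auto)+
  show "AE x in \<mu>. AE y in \<mu>. x 0 = y 0 \<longrightarrow> \<phi> (glue (y, x))"
    using fin(1) AE_space
  proof eventually_elim
    case (elim x)
    then have "AE y in \<mu>. y \<in> cyl l q (x 0) \<longrightarrow> \<phi> (glue (y, x))"
      using sym[of x] cyl_iff[of x] by auto
    then show ?case using AE_space by eventually_elim (use cyl_iff in auto)
  qed
  show "AE y in \<mu>. AE x in \<mu>. x 0 = y 0 \<longrightarrow> \<phi> (glue (y, x))"
    using fin(2) AE_space
  proof eventually_elim
    case (elim y)
    then have "AE x in \<mu>. x \<in> cyl l q (y 0) \<longrightarrow> \<phi> (glue (y, x))"
      using sym[of y] cyl_iff[of y] by auto
    then show ?case using AE_space by eventually_elim (use cyl_iff in auto)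
  qed
qed

section \<open>Measurable functions are nearly uniformly continuous\<close>

text \<open>Agreement on the window of radius \<open>N\<close>, that is \<open>rho \<tau> x y \<le> exp (- \<tau> N)\<close>. Hoelder continuity with
exponent \<open>\<alpha>\<close> is used below in the form of a bound \<open>c \<theta>\<^sup>N\<close> for points that agree on this window, where
\<open>\<theta> = exp (- \<tau> \<alpha>)\<close>.\<close>

definition agree :: "nat \<Rightarrow> (int \<Rightarrow> nat) \<Rightarrow> (int \<Rightarrow> nat) \<Rightarrow> bool" where
  "agree N x y \<longleftrightarrow> (\<forall>n. \<bar>n\<bar> < int N \<longrightarrow> x n = y n)"

lemma agree_mono: "agree N x y \<Longrightarrow> N' \<le> N \<Longrightarrow> agree N' x y"
  by (auto simp: agree_def)

text \<open>Up to a set of small measure, membership in \<open>B\<close> is decided by finitely many coordinates.\<close>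

definition nearly_clopen :: "(int \<Rightarrow> nat) measure \<Rightarrow> (int \<Rightarrow> nat) set \<Rightarrow> bool" where
  "nearly_clopen M B \<longleftrightarrow> (\<forall>\<eta>>0. \<exists>K\<in>sets M. measure M (space M - K) < \<eta> \<and>
     (\<exists>N. \<forall>x\<in>K. \<forall>y\<in>K. agree N x y \<longrightarrow> (x \<in> B \<longleftrightarrow> y \<in> B)))"

lemma nearly_clopen_finite_family:
  assumes "finite_measure M" and "finite I" "\<And>i. i \<in> I \<Longrightarrow> nearly_clopen M (B i)" "0 < \<eta>"
  shows "\<exists>K\<in>sets M. measure M (space M - K) < \<eta> \<and>
     (\<exists>N. \<forall>i\<in>I. \<forall>x\<in>K. \<forall>y\<in>K. agree N x y \<longrightarrow> (x \<in> B i \<longleftrightarrow> y \<in> B i))"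
  using assms(2-)
proof (induction I arbitrary: \<eta> rule: finite_induct)
  case empty
  then show ?case by (intro bexI[of _ "space M"]) auto
next
  case (insert i I)
  interpret finite_measure M by fact
  have "\<exists>K\<in>sets M. measure M (space M - K) < \<eta>/2 \<and>
     (\<exists>N. \<forall>i\<in>I. \<forall>x\<in>K. \<forall>y\<in>K. agree N x y \<longrightarrow> (x \<in> B i \<longleftrightarrow> y \<in> B i))"
    using insert.prems by (intro insert.IH) auto
  then obtain K N where K: "K \<in> sets M" "measure M (space M - K) < \<eta>/2"
    "\<forall>i\<in>I. \<forall>x\<in>K. \<forall>y\<in>K. agree N x y \<longrightarrow> (x \<in> B i \<longleftrightarrow> y \<in> B i)"
    by blast
  have "nearly_clopen M (B i)" "0 < \<eta>/2" using insert.prems by auto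
  then obtain K' N' where K': "K' \<in> sets M" "measure M (space M - K') < \<eta>/2"
    "\<forall>x\<in>K'. \<forall>y\<in>K'. agree N' x y \<longrightarrow> (x \<in> B i \<longleftrightarrow> y \<in> B i)"
    unfolding nearly_clopen_def by blast
  have "measure M (space M - K \<inter> K') = measure M ((space M - K) \<union> (space M - K'))"
    by (simp add: Diff_Int)
  also have "\<dots> \<le> measure M (space M - K) + measure M (space M - K')"
    using K K' by (intro measure_Un_le) auto
  finally have "measure M (space M - K \<inter> K') < \<eta>" using K(2) K'(2) by simp
  moreover have "\<forall>j\<in>insert i I. \<forall>x\<in>K \<inter> K'. \<forall>y\<in>K \<inter> K'. agree (max N N') x y \<longrightarrow> (x \<in> B j \<longleftrightarrow> y \<in> B j)"
  proof (intro ballI impI)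
    fix j x y assume j: "j \<in> insert i I" and xy: "x \<in> K \<inter> K'" "y \<in> K \<inter> K'" "agree (max N N') x y"
    have "agree N x y" "agree N' x y" using agree_mono[OF xy(3)] by auto
    then show "x \<in> B j \<longleftrightarrow> y \<in> B j" using j xy K(3) K'(3) by blast
  qed
  ultimately show ?case using K(1) K'(1) by (intro bexI[of _ "K \<inter> K'"]) blast+
qed

text \<open>The sets with this property form a sigma-algebra that contains the coordinate cylinders. For a
countable union one discards the part that is not covered by finitely many of the sets, and then
treats these finitely many together.\<close>

lemma nearly_clopen_borel:
  fixes S :: "(int \<Rightarrow> nat) set"
  assumes fin: "finite_measure M" and M: "sets M = sets (restrict_space borel S)" and B: "B \<in> sets borel"
  shows "nearly_clopen M B"
proof -
  interpret finite_measure M by fact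
  have trace: "space M \<inter> B \<in> sets M" if "B \<in> sets borel" for B
    using that sets_eq_imp_space_eq[OF M] by (auto simp: M sets_restrict_space space_restrict_space)
  have borel_eq: "sets borel = sigma_sets UNIV {{f :: int \<Rightarrow> nat. f i \<in> A} |i A. A \<in> sets borel}"
    using sets_PiM_single[of UNIV "\<lambda>_ :: int. borel :: nat measure"]
      sets_PiM_equal_borel[where 'a = int and 'b = nat] by simp
  have "B \<in> sigma_sets UNIV {{f :: int \<Rightarrow> nat. f i \<in> A} |i A. A \<in> sets borel}"
    using B borel_eq by simp
  then show ?thesis
  proof (induction rule: sigma_sets.induct)
    case (Basic B)
    then obtain i A where B: "B = {f. f i \<in> A}" by blast
    have "x \<in> B \<longleftrightarrow> y \<in> B" if "agree (nat \<bar>i\<bar> + 1) x y" for x y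
    proof -
      have "x i = y i" using that by (simp add: agree_def)
      then show ?thesis by (simp add: B)
    qed
    then show ?case unfolding nearly_clopen_def
      by (intro allI impI bexI[of _ "space M"] conjI exI[of _ "nat \<bar>i\<bar> + 1"]) auto
  next
    case Empty
    then show ?case unfolding nearly_clopen_def by (intro allI impI bexI[of _ "space M"]) auto
  next
    case (Compl B)
    then show ?case unfolding nearly_clopen_def by simp
  next
    case (Union B)
    have B: "B i \<in> sets borel" for i using Union.hyps borel_eq by simp
    show ?case unfolding nearly_clopen_def
    proof (intro allI impI)
      fix \<eta> :: real assume \<eta>: "\<eta> > 0"
      \<comment> \<open>The part of the union that the first \<open>k\<close> sets miss; it becomes small and is removed.\<close>
      define T where "T k = space M \<inter> ((\<Union>i. B i) - (\<Union>i<k. B i))" for k :: nat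
      have T: "T k \<in> sets M" for k unfolding T_def by (intro trace) (use B in auto)
      have "decseq T" unfolding T_def by (intro decseq_SucI) (auto simp: less_Suc_eq)
      then have "(\<lambda>k. measure M (T k)) \<longlonglongrightarrow> measure M (\<Inter>k. T k)"
        using T by (intro finite_Lim_measure_decseq) auto
      moreover have "(\<Inter>k. T k) = {}" unfolding T_def by blast
      ultimately have "\<forall>\<^sub>F k in sequentially. measure M (T k) < \<eta>/2"
        using \<eta> by (intro order_tendstoD) auto
      then obtain k where k: "measure M (T k) < \<eta>/2"
        by (meson eventually_sequentially order_refl)
      have "\<exists>K\<in>sets M. measure M (space M - K) < \<eta>/2 \<and>
         (\<exists>N. \<forall>i\<in>{..<k}. \<forall>x\<in>K. \<forall>y\<in>K. agree N x y \<longrightarrow> (x \<in> B i \<longleftrightarrow> y \<in> B i))"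
        using Union.IH \<eta> by (intro nearly_clopen_finite_family[OF fin]) auto
      then obtain K N where K: "K \<in> sets M" "measure M (space M - K) < \<eta>/2"
        "\<forall>i\<in>{..<k}. \<forall>x\<in>K. \<forall>y\<in>K. agree N x y \<longrightarrow> (x \<in> B i \<longleftrightarrow> y \<in> B i)"
        by blast
      have "measure M (space M - (K - T k)) \<le> measure M ((space M - K) \<union> T k)"
        using K(1) T by (intro finite_measure_mono) auto
      also have "\<dots> \<le> measure M (space M - K) + measure M (T k)"
        using K T by (intro measure_Un_le) auto
      finally have small: "measure M (space M - (K - T k)) < \<eta>" using K(2) k by simp
      have early: "x \<in> (\<Union>i. B i) \<longleftrightarrow> (\<exists>i\<in>{..<k}. x \<in> B i)" if "x \<in> K - T k" for x
        using that sets.sets_into_space[OF K(1)] unfolding T_def by blast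
      have "\<forall>x\<in>K - T k. \<forall>y\<in>K - T k. agree N x y \<longrightarrow> (x \<in> (\<Union>i. B i) \<longleftrightarrow> y \<in> (\<Union>i. B i))"
      proof (intro ballI impI)
        fix x y assume xy: "x \<in> K - T k" "y \<in> K - T k" "agree N x y"
        show "x \<in> (\<Union>i. B i) \<longleftrightarrow> y \<in> (\<Union>i. B i)"
          unfolding early[OF xy(1)] early[OF xy(2)] using K(3) xy by blast
      qed
      with small show "\<exists>K\<in>sets M. measure M (space M - K) < \<eta> \<and>
          (\<exists>N. \<forall>x\<in>K. \<forall>y\<in>K. agree N x y \<longrightarrow> (x \<in> (\<Union>i. B i) \<longleftrightarrow> y \<in> (\<Union>i. B i)))"
        using K(1) T[of k] by (intro bexI[of _ "K - T k"]) blast+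
    qed
  qed
qed

text \<open>A Lusin-type theorem. A bounded range is covered by finitely many small balls, and on a large set
the preimage of each ball is determined by a window.\<close>

lemma nearly_uniformly_continuous:
  fixes S :: "(int \<Rightarrow> nat) set" and P :: "(int \<Rightarrow> nat) \<Rightarrow> 'b::euclidean_space"
  assumes fin: "finite_measure M" and M: "sets M = sets (restrict_space borel S)" and P: "P \<in> borel_measurable M"
    and U: "U \<in> sets M" "\<And>x. x \<in> U \<Longrightarrow> norm (P x) \<le> R" and "0 < \<eta>" "0 < \<epsilon>"
  shows "\<exists>K\<in>sets M. K \<subseteq> U \<and> measure M (U - K) < \<eta> \<and>
     (\<exists>N. \<forall>x\<in>K. \<forall>y\<in>K. agree N x y \<longrightarrow> norm (P x - P y) < \<epsilon>)"
proof -
  interpret finite_measure M by fact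
  have "seq_compact (cball (0 :: 'b) R)" using compact_cball compact_imp_seq_compact by blast
  then obtain C where C: "finite C" "cball (0 :: 'b) R \<subseteq> (\<Union>c\<in>C. ball c (\<epsilon>/2))"
    using seq_compact_imp_totally_bounded \<open>0 < \<epsilon>\<close> half_gt_zero by metis
  have "nearly_clopen M (P -` ball c (\<epsilon>/2) \<inter> space M)" for c
  proof -
    have "P -` ball c (\<epsilon>/2) \<inter> space M \<in> sets M" using measurable_sets[OF P] by auto
    then obtain B where B: "B \<in> sets borel" "P -` ball c (\<epsilon>/2) \<inter> space M = S \<inter> B"
      unfolding M sets_restrict_space by auto
    have S: "space M = S" using sets_eq_imp_space_eq[OF M] by (simp add: space_restrict_space)
    show ?thesis unfolding nearly_clopen_def
    proof (intro allI impI)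
      fix \<eta> :: real assume "\<eta> > 0"
      with nearly_clopen_borel[OF fin M B(1)] obtain K N where K: "K \<in> sets M" "measure M (space M - K) < \<eta>"
        "\<forall>x\<in>K. \<forall>y\<in>K. agree N x y \<longrightarrow> (x \<in> B \<longleftrightarrow> y \<in> B)"
        unfolding nearly_clopen_def by blast
      have "K \<subseteq> S" using sets.sets_into_space[OF K(1)] S by simp
      then show "\<exists>K\<in>sets M. measure M (space M - K) < \<eta> \<and> (\<exists>N. \<forall>x\<in>K. \<forall>y\<in>K. agree N x y \<longrightarrow>
          (x \<in> P -` ball c (\<epsilon>/2) \<inter> space M \<longleftrightarrow> y \<in> P -` ball c (\<epsilon>/2) \<inter> space M))"
        unfolding B(2) using K by (intro bexI[of _ K] conjI exI[of _ N]) auto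
    qed
  qed
  from nearly_clopen_finite_family[where B = "\<lambda>c. P -` ball c (\<epsilon>/2) \<inter> space M", OF fin C(1) this \<open>0 < \<eta>\<close>]
  obtain K N where
    K: "K \<in> sets M" "measure M (space M - K) < \<eta>"
    "\<forall>c\<in>C. \<forall>x\<in>K. \<forall>y\<in>K. agree N x y \<longrightarrow>
      (x \<in> P -` ball c (\<epsilon>/2) \<inter> space M \<longleftrightarrow> y \<in> P -` ball c (\<epsilon>/2) \<inter> space M)"
    by blast
  have "measure M (U - U \<inter> K) \<le> measure M (space M - K)"
    using K(1) sets.sets_into_space[OF U(1)] by (intro finite_measure_mono) auto
  then have "measure M (U - U \<inter> K) < \<eta>" using K(2) by simp
  moreover have "norm (P x - P y) < \<epsilon>" if xy: "x \<in> U \<inter> K" "y \<in> U \<inter> K" "agree N x y" for x y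
  proof -
    have "P x \<in> cball 0 R" using U(2) xy by simp
    then obtain c where c: "c \<in> C" "P x \<in> ball c (\<epsilon>/2)" using C(2) by blast
    moreover have "x \<in> space M" using sets.sets_into_space[OF K(1)] xy by blast
    ultimately have "P y \<in> ball c (\<epsilon>/2)" using K(3) c(1) xy by blast
    with c(2) have "dist c (P x) < \<epsilon>/2" "dist c (P y) < \<epsilon>/2" by (simp_all only: mem_ball)
    then have "dist (P x) (P y) < \<epsilon>" by (rule dist_triangle_half_r)
    then show "norm (P x - P y) < \<epsilon>" unfolding dist_norm .
  qed
  then have "\<exists>N. \<forall>x\<in>U \<inter> K. \<forall>y\<in>U \<inter> K. agree N x y \<longrightarrow> norm (P x - P y) < \<epsilon>" by blast
  ultimately show ?thesis using K(1) U(1) by (intro bexI[of _ "U \<inter> K"]) blast+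
qed

section \<open>The cocycle along orbits\<close>

text \<open>All integer powers of the left shift at once.\<close>

definition shift_by :: "int \<Rightarrow> (int \<Rightarrow> nat) \<Rightarrow> (int \<Rightarrow> nat)" where
  "shift_by k x = (\<lambda>n. x (n + k))"

lemma shift_apply: "shift_by k x n = x (n + k)"
  by (simp add: shift_by_def)

lemma shift_shift [simp]: "shift_by j (shift_by k x) = shift_by (j + k) x"
  by (simp add: shift_by_def add.commute add.left_commute)

lemma shift_0 [simp]: "shift_by 0 x = x"
  by (simp add: shift_by_def)

lemma left_shift_eq: "left_shift = shift_by 1"
  by (auto simp: left_shift_def shift_by_def)

lemma funpow_shift: "(shift_by s ^^ n) x = shift_by (s * int n) x"
  by (induction n) (simp_all add: algebra_simps)

lemma shift_in_subshift [simp]: "shift_by k x \<in> subshift l q \<longleftrightarrow> x \<in> subshift l q"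
proof
  assume *: "x \<in> subshift l q"
  have "x (n + k) \<in> {1..l} \<and> q (x (n + k)) (x (n + k + 1)) = 1" for n
    using * unfolding subshift_def by blast
  then show "shift_by k x \<in> subshift l q"
    by (simp add: subshift_def shift_by_def add.assoc add.commute[of 1])
next
  assume *: "shift_by k x \<in> subshift l q"
  have "x n \<in> {1..l} \<and> q (x n) (x (n + 1)) = 1" for n
  proof -
    have "shift_by k x (n - k) \<in> {1..l} \<and> q (shift_by k x (n - k)) (shift_by k x (n - k + 1)) = 1"
      using * unfolding subshift_def by blast
    then show ?thesis by (simp add: shift_by_def)
  qed
  then show "x \<in> subshift l q" by (simp add: subshift_def)
qed

text \<open>For \<open>s = 1\<close> the points have the same future and for \<open>s = -1\<close> the same past; the zeroth coordinate is
included in both cases.\<close>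

definition same_side :: "int \<Rightarrow> (int \<Rightarrow> nat) \<Rightarrow> (int \<Rightarrow> nat) \<Rightarrow> bool" where
  "same_side s x y \<longleftrightarrow> (\<forall>n. x (s * int n) = y (s * int n))"

text \<open>Points on the same side converge under iteration in that direction of time: the window of agreement
grows by one in each step.\<close>

lemma agree_shift_same_side:
  assumes "s \<in> {1, -1}" "same_side s x y" "agree N x y"
  shows "agree (N + k) (shift_by (s * int k) x) (shift_by (s * int k) y)"
  unfolding agree_def shift_by_def
proof (intro allI impI)
  fix n :: int assume n: "\<bar>n\<bar> < int (N + k)"
  show "x (n + s * int k) = y (n + s * int k)"
  proof (cases "s * n + int k \<ge> 0")
    case True
    then have "n + s * int k = s * int (nat (s * n + int k))" using assms(1) by auto
    then show ?thesis using assms(2) unfolding same_side_def by metis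
  next
    case False
    then have "\<bar>n + s * int k\<bar> < int N" using n assms(1) by auto
    then show ?thesis using assms(3) by (auto simp: agree_def)
  qed
qed

text \<open>The hypotheses of the theorem, with Hoelder continuity expressed through windows and with the bounds
\<open>M\<close> that compactness provides.\<close>

locale measurable_coboundary =
  fixes l :: nat and q :: "nat \<Rightarrow> nat \<Rightarrow> nat" and \<mu> :: "(int \<Rightarrow> nat) measure"
    and A P :: "(int \<Rightarrow> nat) \<Rightarrow> real^'d^'d" and \<theta> H M :: real
  assumes sets_\<mu>: "sets \<mu> = sets (restrict_space borel (subshift l q))"
    and ergodic: "ergodic_measure left_shift \<mu>"
    and support: "fully_supported_on (subshift l q) \<mu>"
    and lps: "local_product_structure l q \<mu>"
    and inv_A: "\<And>x. x \<in> subshift l q \<Longrightarrow> invertible (A x)"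
    and \<theta>: "0 < \<theta>" "\<theta> < 1"
    and holder_A: "\<And>x y N. x \<in> subshift l q \<Longrightarrow> y \<in> subshift l q \<Longrightarrow> agree N x y \<Longrightarrow>
      norm (A x - A y) \<le> H * \<theta> ^ N"
    and M: "1 \<le> M" "\<And>x. x \<in> subshift l q \<Longrightarrow> norm (A x) \<le> M"
      "\<And>x. x \<in> subshift l q \<Longrightarrow> norm (matrix_inv (A x)) \<le> M"
    and P_meas: "P \<in> borel_measurable \<mu>"
    and inv_P: "\<And>x. x \<in> subshift l q \<Longrightarrow> invertible (P x)"
    and coboundary: "AE x in \<mu>. A x = P (left_shift x) ** matrix_inv (P x)"
begin

abbreviation "\<Sigma> \<equiv> subshift l q"

sublocale prob_space \<mu>
  using ergodic by (simp add: ergodic_measure_def)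

lemma space_\<mu>: "space \<mu> = \<Sigma>"
  using sets_eq_imp_space_eq[OF sets_\<mu>] by (simp add: space_restrict_space)

lemma sets_\<mu>_Int: "B \<in> sets borel \<Longrightarrow> \<Sigma> \<inter> B \<in> sets \<mu>"
  by (auto simp: sets_\<mu> sets_restrict_space)

lemma pos_open: "open U \<Longrightarrow> x \<in> U \<Longrightarrow> x \<in> \<Sigma> \<Longrightarrow> prob (U \<inter> \<Sigma>) > 0"
  using support unfolding fully_supported_on_def by (force simp: emeasure_eq_measure)

lemma AE_pos_witness:
  assumes "AE x in \<mu>. \<phi> x" "prob E > 0" "E \<in> sets \<mu>"
  shows "\<exists>x\<in>E. \<phi> x"
proof (rule ccontr)
  assume "\<not> ?thesis"
  then have "AE x in \<mu>. x \<notin> E" using assms(1) by (auto elim: eventually_mono)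
  then have "prob E = 0" using AE_iff_measurable[of E \<mu> "\<lambda>x. x \<notin> E"] assms(3) sets.sets_into_space[OF assms(3)]
    by (auto simp: emeasure_eq_measure)
  then show False using assms(2) by simp
qed

lemma open_window: "open {x :: int \<Rightarrow> nat. \<forall>k\<in>{a..b :: int}. x k = y k}"
proof -
  have "{x :: int \<Rightarrow> nat. \<forall>k\<in>{a..b}. x k = y k} = (\<Inter>k\<in>{a..b}. (\<lambda>x. x k) -` {y k})" by auto
  moreover have "open ((\<lambda>x :: int \<Rightarrow> nat. x k) -` {y k})" for k
    by (rule open_vimage[OF Topological_Spaces.open_discrete continuous_on_product_coordinates])
  ultimately show ?thesis by auto
qed

lemma shift_measurable: "shift_by k \<in> measurable \<mu> \<mu>"
proof -
  have coord: "(\<lambda>x. x n) \<in> borel_measurable \<mu>" for n :: int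
    unfolding measurable_cong_sets[OF sets_\<mu> refl]
    by (intro measurable_restrict_space1 measurable_coordinate)
  have "shift_by k \<in> measurable \<mu> (restrict_space borel \<Sigma>)"
    by (intro measurable_restrict_space2 measurable_coordinatewise_then_product)
      (auto simp: space_\<mu> shift_apply coord)
  then show ?thesis unfolding measurable_cong_sets[OF refl sets_\<mu>] .
qed

lemma distr_shift_1: "distr \<mu> \<mu> (shift_by 1) = \<mu>"
  using ergodic by (simp add: ergodic_measure_def left_shift_eq)

lemma distr_shift_minus_1: "distr \<mu> \<mu> (shift_by (-1)) = \<mu>"
proof -
  have "distr \<mu> \<mu> (shift_by (-1)) = distr (distr \<mu> \<mu> (shift_by 1)) \<mu> (shift_by (-1))"
    by (simp add: distr_shift_1)
  also have "\<dots> = distr \<mu> \<mu> (shift_by (-1) \<circ> shift_by 1)"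
    by (rule distr_distr[OF shift_measurable shift_measurable])
  also have "shift_by (-1) \<circ> shift_by 1 = (\<lambda>x. x)" by (simp add: fun_eq_iff)
  finally show ?thesis by simp
qed

lemma ergodic_shift:
  assumes "s \<in> {1, -1}"
  shows "ergodic_measure (shift_by s) \<mu>"
proof (cases "s = 1")
  case True
  then show ?thesis using ergodic by (simp add: left_shift_eq)
next
  case False
  then have s: "s = -1" using assms by simp
  have "measure \<mu> B = 0 \<or> measure \<mu> B = 1"
    if B: "B \<in> sets \<mu>" "shift_by (-1) -` B \<inter> space \<mu> = B" for B
  proof -
    have "shift_by 1 -` B \<inter> space \<mu> = B"
    proof (intro equalityI subsetI)
      fix x assume x: "x \<in> shift_by 1 -` B \<inter> space \<mu>"
      then have "shift_by 1 x \<in> shift_by (-1) -` B" using B(2) by blast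
      then show "x \<in> B" by simp
    next
      fix x assume x: "x \<in> B"
      then have sp: "x \<in> space \<mu>" using sets.sets_into_space[OF B(1)] by blast
      then have "shift_by 1 x \<in> shift_by (-1) -` B \<inter> space \<mu>" using x by (simp add: space_\<mu>)
      then show "x \<in> shift_by 1 -` B \<inter> space \<mu>" using sp B(2) by blast
    qed
    then show ?thesis using ergodic B(1) unfolding ergodic_measure_def left_shift_eq by blast
  qed
  then show ?thesis
    using prob_space_axioms shift_measurable distr_shift_minus_1 by (auto simp: ergodic_measure_def s)
qed

text \<open>Shift invariance of null sets, in both directions of time.\<close>

lemma AE_shift:
  assumes "AE x in \<mu>. \<phi> x"
  shows "AE x in \<mu>. \<phi> (shift_by k x)"
proof -
  have one: "AE x in \<mu>. \<phi> (shift_by s x)" if "AE x in \<mu>. \<phi> x" "s \<in> {1, -1}" for s \<phi>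
  proof -
    have inv: "distr \<mu> \<mu> (shift_by s) = \<mu>" using that(2) distr_shift_1 distr_shift_minus_1 by auto
    have "AE x in distr \<mu> \<mu> (shift_by s). \<phi> x" unfolding inv by (rule that(1))
    from AE_distrD[OF shift_measurable this] show ?thesis .
  qed
  have "AE x in \<mu>. \<phi> (shift_by (s * int n) x)" if "s \<in> {1, -1}" for s n
  proof (induction n)
    case (Suc n)
    from one[OF this that] show ?case
      by (rule eventually_mono) (simp add: algebra_simps)
  qed (use assms in simp)
  from this[of 1 "nat k"] this[of "-1" "nat (- k)"] show ?thesis
    by (cases "k \<ge> 0") auto
qed

text \<open>The generator of the cocycle over the shift in direction \<open>s\<close>. For \<open>s = -1\<close> it is the generator of the
inverse cocycle over the inverse shift.\<close>

definition generator :: "int \<Rightarrow> (int \<Rightarrow> nat) \<Rightarrow> real^'d^'d" where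
  "generator s x = (if s = 1 then A x else matrix_inv (A (shift_by (-1) x)))"

lemma generator_invertible: "x \<in> \<Sigma> \<Longrightarrow> invertible (generator s x)"
  and generator_bound: "x \<in> \<Sigma> \<Longrightarrow> norm (generator s x) \<le> M" "x \<in> \<Sigma> \<Longrightarrow> norm (matrix_inv (generator s x)) \<le> M"
proof -
  assume x: "x \<in> \<Sigma>"
  have i: "invertible (A x)" "invertible (A (shift_by (-1) x))" using inv_A x by auto
  have r: "matrix_inv (A (shift_by (-1) x)) ** A (shift_by (-1) x) = mat 1"
    using matrix_inv_left[OF i(2)] .
  have "invertible (matrix_inv (A (shift_by (-1) x)))"
    using r invertible_right_inverse by blast
  then show "invertible (generator s x)" using i by (simp add: generator_def)
  show "norm (generator s x) \<le> M" using M x by (simp add: generator_def)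
  show "norm (matrix_inv (generator s x)) \<le> M" using M x matrix_inv_unique[OF r] by (simp add: generator_def)
qed

text \<open>A Hoelder constant for both generators: inversion costs a factor \<open>M\<^sup>2\<close>, and the shift in the
definition of the inverse generator shrinks the window by one, hence the division by \<open>\<theta>\<close>.\<close>

definition G :: real where "G = M * M * H / \<theta>"

lemma H_nonneg: "0 \<le> H"
proof -
  obtain x where "x \<in> \<Sigma>" using not_empty space_\<mu> by blast
  from holder_A[OF this this, of 0] show ?thesis by (simp add: agree_def)
qed

lemma G_ge: "H \<le> G" "0 \<le> G"
proof -
  have "H * 1 \<le> H * (M * M / \<theta>)"
    using H_nonneg M(1) \<theta> mult_mono[of 1 M 1 M] by (intro mult_left_mono) (auto simp: field_simps)
  then show "H \<le> G" by (simp add: G_def mult_ac)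
  then show "0 \<le> G" using H_nonneg by simp
qed

lemma generator_holder:
  assumes "x \<in> \<Sigma>" "y \<in> \<Sigma>" "agree N x y"
  shows "norm (generator s x - generator s y) \<le> G * \<theta> ^ N"
proof (cases "s = 1")
  case True
  have "H * \<theta> ^ N \<le> G * \<theta> ^ N" using G_ge \<theta> by (intro mult_right_mono) auto
  then show ?thesis using holder_A[OF assms] True by (simp add: generator_def)
next
  case False
  let ?x = "shift_by (-1) x" and ?y = "shift_by (-1) y"
  have "agree (N - 1) ?x ?y"
    using assms(3) by (auto simp: agree_def shift_by_def)
  then have "norm (A ?x - A ?y) \<le> H * \<theta> ^ (N - 1)" using holder_A assms by simp
  moreover have "norm (matrix_inv (A ?x) - matrix_inv (A ?y))
      \<le> norm (matrix_inv (A ?x)) * norm (A ?x - A ?y) * norm (matrix_inv (A ?y))"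
    using assms inv_A by (intro norm_matrix_inv_diff_le) auto
  ultimately have "norm (matrix_inv (A ?x) - matrix_inv (A ?y)) \<le> M * (H * \<theta> ^ (N - 1)) * M"
    using assms M H_nonneg \<theta> by (elim order.trans, intro mult_mono) auto
  also have "\<dots> \<le> M * (H * (\<theta> ^ N / \<theta>)) * M"
  proof (intro mult_right_mono mult_left_mono)
    show "\<theta> ^ (N - 1) \<le> \<theta> ^ N / \<theta>" using \<theta> by (cases N) (auto simp: field_simps)
  qed (use M H_nonneg in auto)
  finally show ?thesis using False by (simp add: generator_def G_def mult_ac)
qed

text \<open>Requiring the equation along the whole orbit makes the set of typical points invariant, so that
\<open>P\<close> along the orbit of a typical point is given exactly by the cocycle.\<close>

definition typical :: "(int \<Rightarrow> nat) \<Rightarrow> bool" where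
  "typical x \<longleftrightarrow> x \<in> \<Sigma> \<and> (\<forall>k. A (shift_by k x) ** P (shift_by k x) = P (shift_by (k + 1) x))"

lemma AE_typical: "AE x in \<mu>. typical x"
proof -
  have "AE x in \<mu>. x \<in> \<Sigma> \<and> A x ** P x = P (shift_by 1 x)"
    using coboundary AE_space
    by eventually_elim (simp add: space_\<mu> left_shift_eq matrix_inv_cancel inv_P)
  from AE_shift[OF this] have "AE x in \<mu>. \<forall>k. shift_by k x \<in> \<Sigma> \<and>
      A (shift_by k x) ** P (shift_by k x) = P (shift_by 1 (shift_by k x))"
    by (subst AE_all_countable) auto
  then show ?thesis by (rule eventually_mono) (auto simp: typical_def add.commute)
qed

lemma typical_shift: "typical x \<Longrightarrow> typical (shift_by k x)"
  unfolding typical_def shift_shift by (metis add.assoc add.commute shift_in_subshift)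

lemma typical_step:
  assumes "typical x" "s \<in> {1, -1}"
  shows "P (shift_by (s * int (Suc n)) x) = generator s (shift_by (s * int n) x) ** P (shift_by (s * int n) x)"
proof (cases "s = 1")
  case True
  have "A (shift_by (int n) x) ** P (shift_by (int n) x) = P (shift_by (int n + 1) x)"
    using assms(1) by (simp add: typical_def)
  then show ?thesis using True by (simp add: generator_def add.commute)
next
  case False
  then have s: "s = -1" using assms(2) by simp
  let ?y = "shift_by (- 1 - int n) x"
  have "A ?y ** P ?y = P (shift_by (- 1 - int n + 1) x)"
    using assms(1) unfolding typical_def by blast
  moreover have "invertible (A ?y)" using assms(1) inv_A by (simp add: typical_def)
  ultimately have "P ?y = matrix_inv (A ?y) ** P (shift_by (- int n) x)"
    using matrix_inv_cancel(1)[of "A ?y" "P ?y"] by simp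
  then show ?thesis by (simp add: generator_def s)
qed

lemma P_growth:
  assumes x: "typical x" and s: "s \<in> {1, -1}"
  shows "norm (P (shift_by (s * int n) x)) \<le> M ^ n * norm (P x)"
    and "norm (matrix_inv (P (shift_by (s * int n) x))) \<le> M ^ n * norm (matrix_inv (P x))"
proof -
  have S: "shift_by k x \<in> \<Sigma>" for k using x by (simp add: typical_def)
  show "norm (P (shift_by (s * int n) x)) \<le> M ^ n * norm (P x)"
  proof (induction n)
    case (Suc n)
    have "norm (P (shift_by (s * int (Suc n)) x))
        \<le> norm (generator s (shift_by (s * int n) x)) * norm (P (shift_by (s * int n) x))"
      unfolding typical_step[OF x s] by (rule norm_matrix_mult_le)
    also have "\<dots> \<le> M * (M ^ n * norm (P x))"
      using M(1) by (intro mult_mono generator_bound S Suc.IH) auto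
    finally show ?case by (simp add: mult_ac)
  qed simp
  show "norm (matrix_inv (P (shift_by (s * int n) x))) \<le> M ^ n * norm (matrix_inv (P x))"
  proof (induction n)
    case (Suc n)
    have "matrix_inv (P (shift_by (s * int (Suc n)) x))
        = matrix_inv (P (shift_by (s * int n) x)) ** matrix_inv (generator s (shift_by (s * int n) x))"
      unfolding typical_step[OF x s] by (intro matrix_inv_mult generator_invertible inv_P S)
    then have "norm (matrix_inv (P (shift_by (s * int (Suc n)) x)))
        \<le> norm (matrix_inv (P (shift_by (s * int n) x))) * norm (matrix_inv (generator s (shift_by (s * int n) x)))"
      by (simp only: norm_matrix_mult_le)
    also have "\<dots> \<le> (M ^ n * norm (matrix_inv (P x))) * M"
      using M(1) by (intro mult_mono generator_bound S Suc.IH) auto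
    finally show ?case by (simp add: mult_ac)
  qed simp
qed

end

section \<open>Orbits that rarely leave a set on which P is bounded\<close>

lemma norm_matrix_mult4_le:
  fixes X Y Z W :: "real^'n^'n"
  shows "norm (X ** Y ** Z ** W) \<le> norm X * norm Y * norm Z * norm W"
  by (rule order.trans[OF norm_matrix_mult_le mult_right_mono[OF order.trans[OF norm_matrix_mult_le
        mult_right_mono[OF norm_matrix_mult_le]]]]) auto

text \<open>On each set \<open>K j\<close>, \<open>P\<close> and its inverse are bounded by \<open>R\<close> and the oscillation of \<open>P\<close> on a suitable
window scale is less than \<open>1 / (j + 1)\<close>. The set \<open>K 0\<close> is used for growth estimates and the sets with
large \<open>j\<close> for limits. The condition \<open>\<delta>_domination\<close> makes growth of rate \<open>M powr \<delta>\<close> weaker than the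
contraction \<open>\<theta>\<close>, and \<open>K_cyl\<close> makes the points with frequent visits to \<open>K 0\<close> too numerous to miss a
cylinder.\<close>

locale coboundary_with_blocks = measurable_coboundary l q \<mu> A P \<theta> H M
  for l :: nat and q :: "nat \<Rightarrow> nat \<Rightarrow> nat" and \<mu> :: "(int \<Rightarrow> nat) measure"
    and A P :: "(int \<Rightarrow> nat) \<Rightarrow> real^'d^'d" and \<theta> H M :: real +
  fixes \<delta> R :: real and K :: "nat \<Rightarrow> (int \<Rightarrow> nat) set"
  assumes \<delta>: "0 < \<delta>" "\<delta> \<le> 1/6" and \<delta>_domination: "M powr \<delta> * M powr \<delta> * \<theta> < 1"
    and sets_K: "\<And>j. K j \<in> sets \<mu>"
    and K_bound: "\<And>j x. x \<in> K j \<Longrightarrow> norm (P x) \<le> R" "\<And>j x. x \<in> K j \<Longrightarrow> norm (matrix_inv (P x)) \<le> R"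
    and K_large: "\<And>j. prob (space \<mu> - K j) < \<delta>"
    and K_cyl: "\<And>x. x \<in> subshift l q \<Longrightarrow> prob (space \<mu> - K 0) / \<delta> < prob (cyl l q (x 0))"
    and K_osc: "\<And>j. \<exists>N. \<forall>x\<in>K j. \<forall>y\<in>K j. agree N x y \<longrightarrow> norm (P x - P y) < 1 / real (Suc j)"
begin

text \<open>Besides being typical, a good point visits each \<open>K j\<close> with high frequency in both directions of time,
from some time on. Almost every point is good, while \<open>block s\<close> below, where no delay is permitted, is
merely large.\<close>

definition good :: "(int \<Rightarrow> nat) \<Rightarrow> bool" where
  "good x \<longleftrightarrow> typical x \<and>
     (\<forall>s\<in>{1, -1}. \<forall>j. \<exists>m. frequently_in (shift_by s) (K j) \<delta> ((shift_by s ^^ m) x))"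

lemma AE_good: "AE x in \<mu>. good x"
proof -
  have "AE x in \<mu>. \<forall>j. \<exists>m. frequently_in (shift_by s) (K j) \<delta> ((shift_by s ^^ m) x)" if "s \<in> {1, -1}" for s
    unfolding AE_all_countable
    using AE_eventually_frequently_in[OF ergodic_shift[OF that] sets_K \<delta>(1) K_large] by blast
  from this[of 1] this[of "-1"] AE_typical show ?thesis
    by (simp add: good_def)
qed

lemma good_typical: "good x \<Longrightarrow> typical x"
  by (simp add: good_def)

definition block :: "int \<Rightarrow> (int \<Rightarrow> nat) set" where
  "block s = {x \<in> \<Sigma>. frequently_in (shift_by s) (K 0) \<delta> x}"

lemma block_meets_cyl:
  assumes s: "s \<in> {1, -1}" and x: "x \<in> \<Sigma>" and AE: "AE z in \<mu>. \<phi> z"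
  shows "\<exists>z\<in>block s. z 0 = x 0 \<and> \<phi> z"
proof -
  have block_eq: "block s = {x \<in> space \<mu>. frequently_in (shift_by s) (K 0) \<delta> x}"
    by (simp only: block_def space_\<mu>)
  have block: "block s \<in> sets \<mu>"
    using sets_frequently_in[OF shift_measurable[of s] sets_K[of 0], of \<delta>] by (simp only: block_eq)
  have "cyl l q (x 0) = \<Sigma> \<inter> cyl l q (x 0)" by (auto simp: cyl_def)
  then have cyl: "cyl l q (x 0) \<in> sets \<mu>" using sets_\<mu>_Int[OF sets_cyl, of l q "x 0"] by (simp only:)
  have "1 - prob (space \<mu> - K 0) / \<delta> \<le> prob (block s)"
    using prob_frequently_in[OF ergodic_shift[OF s] sets_K \<delta>(1), of 0] by (simp only: block_eq)
  moreover have "prob (space \<mu> - block s) = 1 - prob (block s)" using block by (rule prob_compl)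
  moreover have "prob (cyl l q (x 0)) \<le> prob (block s \<inter> cyl l q (x 0)) + prob (space \<mu> - block s)"
  proof -
    have "prob (cyl l q (x 0)) \<le> prob ((block s \<inter> cyl l q (x 0)) \<union> (space \<mu> - block s))"
      using block cyl sets.sets_into_space[OF cyl] by (intro finite_measure_mono) auto
    also have "\<dots> \<le> prob (block s \<inter> cyl l q (x 0)) + prob (space \<mu> - block s)"
      using block cyl by (intro measure_Un_le) auto
    finally show ?thesis .
  qed
  ultimately have "prob (block s \<inter> cyl l q (x 0)) > 0" using K_cyl[OF x] by linarith
  from AE_pos_witness[OF AE this] block cyl show ?thesis by (auto simp: cyl_def)
qed

text \<open>Going back from time \<open>n\<close> to the last visit to \<open>K 0\<close> takes at most \<open>\<delta> (n + 1)\<close> steps. Each of them costs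
a factor at most \<open>M\<close>, and at the visit \<open>P\<close> is bounded by \<open>R\<close>.\<close>

lemma block_growth:
  assumes x: "x \<in> block s" "typical x" and s: "s \<in> {1, -1}"
  shows "norm (P (shift_by (s * int n) x) ** matrix_inv (P x)) \<le> R * R * M powr \<delta> * (M powr \<delta>) ^ n"
    and "norm (P x ** matrix_inv (P (shift_by (s * int n) x))) \<le> R * R * M powr \<delta> * (M powr \<delta>) ^ n"
    and "x \<in> K 0"
proof -
  have freq: "(\<Sum>k<n. indicat_real (- K 0) (shift_by (s * int k) x)) \<le> \<delta> * real n" for n
    using x(1) by (simp add: block_def frequently_in_def funpow_shift)
  show x0: "x \<in> K 0" using freq[of 1] \<delta>(2) by (cases "x \<in> K 0") auto
  have R: "0 \<le> R" by (rule order.trans[OF norm_ge_zero K_bound(1)[OF x0]])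
  \<comment> \<open>The last visit to \<open>K 0\<close> up to time \<open>n\<close>; there is one because \<open>x\<close> itself lies in \<open>K 0\<close>.\<close>
  define k where "k = (GREATEST k. k \<le> n \<and> shift_by (s * int k) x \<in> K 0)"
  have k: "k \<le> n" "shift_by (s * int k) x \<in> K 0"
    using GreatestI_nat[of "\<lambda>k. k \<le> n \<and> shift_by (s * int k) x \<in> K 0" 0 n] x0 by (auto simp: k_def)
  have after: "shift_by (s * int j) x \<notin> K 0" if "k < j" "j \<le> n" for j
    using Greatest_le_nat[of "\<lambda>k. k \<le> n \<and> shift_by (s * int k) x \<in> K 0" j n] that by (auto simp: k_def)
  have "real (n - k) = (\<Sum>j\<in>{k<..n}. indicat_real (- K 0) (shift_by (s * int j) x))"
    using after by (simp add: indicator_def)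
  also have "\<dots> \<le> (\<Sum>j<Suc n. indicat_real (- K 0) (shift_by (s * int j) x))"
    by (intro sum_mono2) auto
  also have "\<dots> \<le> \<delta> * real (Suc n)" by (rule freq)
  finally have gap: "real (n - k) \<le> \<delta> * real (Suc n)" .
  have "M ^ (n - k) = M powr real (n - k)" using M(1) by (simp add: powr_realpow)
  also have "\<dots> \<le> M powr (\<delta> * real (Suc n))" using gap M(1) by (rule powr_mono)
  also have "\<dots> = (M powr \<delta>) ^ Suc n"
    using M(1) by (simp add: powr_powr[symmetric] powr_realpow del: power_Suc of_nat_Suc)
  finally have Mk: "M ^ (n - k) \<le> M powr \<delta> * (M powr \<delta>) ^ n" by simp
  have typical_k: "typical (shift_by (s * int k) x)" using x(2) by (rule typical_shift)
  have split: "shift_by (s * int (n - k)) (shift_by (s * int k) x) = shift_by (s * int n) x"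
    using k(1) by (simp add: of_nat_diff algebra_simps)
  have 1: "norm (P (shift_by (s * int n) x)) \<le> M powr \<delta> * (M powr \<delta>) ^ n * R"
  proof -
    have "norm (P (shift_by (s * int n) x)) \<le> M ^ (n - k) * norm (P (shift_by (s * int k) x))"
      using P_growth(1)[OF typical_k s, of "n - k"] by (simp only: split)
    also have "\<dots> \<le> M powr \<delta> * (M powr \<delta>) ^ n * R"
      using Mk K_bound(1)[OF k(2)] R by (intro mult_mono) auto
    finally show ?thesis .
  qed
  have 2: "norm (matrix_inv (P (shift_by (s * int n) x))) \<le> M powr \<delta> * (M powr \<delta>) ^ n * R"
  proof -
    have "norm (matrix_inv (P (shift_by (s * int n) x))) \<le> M ^ (n - k) * norm (matrix_inv (P (shift_by (s * int k) x)))"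
      using P_growth(2)[OF typical_k s, of "n - k"] by (simp only: split)
    also have "\<dots> \<le> M powr \<delta> * (M powr \<delta>) ^ n * R"
      using Mk K_bound(2)[OF k(2)] R by (intro mult_mono) auto
    finally show ?thesis .
  qed
  have "norm (P (shift_by (s * int n) x) ** matrix_inv (P x))
      \<le> norm (P (shift_by (s * int n) x)) * norm (matrix_inv (P x))" by (rule norm_matrix_mult_le)
  also have "\<dots> \<le> (M powr \<delta> * (M powr \<delta>) ^ n * R) * R"
    using 1 K_bound(2)[OF x0] R by (intro mult_mono) auto
  finally show "norm (P (shift_by (s * int n) x) ** matrix_inv (P x)) \<le> R * R * M powr \<delta> * (M powr \<delta>) ^ n"
    by (simp add: mult_ac)
  have "norm (P x ** matrix_inv (P (shift_by (s * int n) x)))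
      \<le> norm (P x) * norm (matrix_inv (P (shift_by (s * int n) x)))" by (rule norm_matrix_mult_le)
  also have "\<dots> \<le> R * (M powr \<delta> * (M powr \<delta>) ^ n * R)"
    using 2 K_bound(1)[OF x0] R by (intro mult_mono) auto
  finally show "norm (P x ** matrix_inv (P (shift_by (s * int n) x))) \<le> R * R * M powr \<delta> * (M powr \<delta>) ^ n"
    by (simp add: mult_ac)
qed

text \<open>The abstract drift estimate for two points on the same side. The distance of the generators decays
like \<open>G \<theta>\<^sup>N \<theta>\<^sup>n\<close>, so both the initial window \<open>N\<close> and the time \<open>n\<close> contribute.\<close>

lemma same_side_drift:
  assumes x: "typical x" and z: "typical z" and s: "s \<in> {1, -1}"
    and side: "same_side s x z" and N: "agree N x z"
    and growth: "\<And>n. norm (P (shift_by (s * int n) x) ** matrix_inv (P x)) \<le> C * \<kappa> ^ n"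
      "\<And>n. norm (P x ** matrix_inv (P (shift_by (s * int n) x))) \<le> C * \<kappa> ^ n"
    and \<kappa>: "0 \<le> \<kappa>" "\<kappa> * \<kappa> * \<theta> < 1"
  defines "L \<equiv> C * C * M / (1 - \<kappa> * \<kappa> * \<theta>) * exp (C * C * M * G / (1 - \<kappa> * \<kappa> * \<theta>))
      * norm (mat 1 :: real^'d^'d)"
  shows "norm (P z ** matrix_inv (P (shift_by (s * int n) z)) ** P (shift_by (s * int n) x) ** matrix_inv (P x)
      - mat 1) \<le> L * (G * \<theta> ^ N)"
    and "norm (P x ** matrix_inv (P (shift_by (s * int n) x)) ** P (shift_by (s * int n) z) ** matrix_inv (P z)
      - mat 1) \<le> L * (G * \<theta> ^ N)"
proof -
  let ?p = "\<lambda>n. P (shift_by (s * int n) x)" and ?q = "\<lambda>n. P (shift_by (s * int n) z)"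
  let ?a = "\<lambda>n. generator s (shift_by (s * int n) x)" and ?b = "\<lambda>n. generator s (shift_by (s * int n) z)"
  have S: "shift_by k x \<in> \<Sigma>" "shift_by k z \<in> \<Sigma>" for k using x z by (simp_all add: typical_def)
  have close: "norm (?a n - ?b n) \<le> G * \<theta> ^ N * \<theta> ^ n" for n
    using generator_holder[OF S agree_shift_same_side[OF s side N, of n]] by (simp add: power_add mult_ac)
  have h: "0 \<le> G * \<theta> ^ N" "G * \<theta> ^ N \<le> G"
    using G_ge(2) \<theta> mult_left_mono[OF power_le_one[of \<theta> N] G_ge(2)] by auto
  note drift = norm_conjugacy_drift_le[of ?p ?q ?a ?b C \<kappa> M "G * \<theta> ^ N" \<theta> G n,
      OF inv_P[OF S(1)] inv_P[OF S(2)] generator_invertible[OF S(1)] generator_invertible[OF S(2)]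
        typical_step[OF x s] typical_step[OF z s] _ _ generator_bound(2)[OF S(1)] generator_bound(2)[OF S(2)] close h \<kappa>(1) _ \<kappa>(2)]
  show "norm (P z ** matrix_inv (P (shift_by (s * int n) z)) ** P (shift_by (s * int n) x) ** matrix_inv (P x)
      - mat 1) \<le> L * (G * \<theta> ^ N)"
    using drift(1) growth \<theta> by (simp add: L_def)
  show "norm (P x ** matrix_inv (P (shift_by (s * int n) x)) ** P (shift_by (s * int n) z) ** matrix_inv (P z)
      - mat 1) \<le> L * (G * \<theta> ^ N)"
    using drift(2) growth \<theta> by (simp add: L_def)
qed

text \<open>At a common visit to \<open>K 0\<close> at time \<open>n\<close> the values of \<open>P\<close> at the two points are bounded. They are carried
back to time \<open>0\<close> by the drift, which is bounded independently of \<open>n\<close>. The constant depends on neither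
of the points, and \<open>z\<close> need not belong to a block.\<close>

lemma bounded_on_side_of_block:
  "\<exists>R'. \<forall>s\<in>{1, -1}. \<forall>x z. x \<in> block s \<and> typical x \<and> good z \<and> same_side s x z
     \<longrightarrow> norm (P z) \<le> R' \<and> norm (matrix_inv (P z)) \<le> R'"
proof -
  define C where "C = R * R * M powr \<delta>"
  define L where "L = C * C * M / (1 - M powr \<delta> * M powr \<delta> * \<theta>) *
      exp (C * C * M * G / (1 - M powr \<delta> * M powr \<delta> * \<theta>)) * norm (mat 1 :: real^'d^'d)"
  define B where "B = norm (mat 1 :: real^'d^'d) + L * G"
  have "norm (P z) \<le> B * R * R * R \<and> norm (matrix_inv (P z)) \<le> B * R * R * R"
    if s: "s \<in> {1, -1}" and x: "x \<in> block s" "typical x" and z: "good z" and side: "same_side s x z" for s x z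
  proof -
    obtain m where "frequently_in (shift_by s) (K 0) \<delta> ((shift_by s ^^ m) z)"
      using z s unfolding good_def by blast
    moreover have "frequently_in (shift_by s) (K 0) \<delta> ((shift_by s ^^ 0) x)"
      using x(1) by (simp add: block_def)
    ultimately obtain n where n: "shift_by (s * int n) x \<in> K 0" "shift_by (s * int n) z \<in> K 0"
      using common_visit[OF _ _ \<delta>(2), of "shift_by s" "K 0" 0 x m z 0] unfolding funpow_shift by blast
    let ?p = "P (shift_by (s * int n) x)" and ?q = "P (shift_by (s * int n) z)"
    have S: "x \<in> \<Sigma>" "z \<in> \<Sigma>" using x good_typical[OF z] by (auto simp: typical_def)
    have inv: "invertible (P x)" "invertible (P z)" "invertible ?p" "invertible ?q"
      using S by (auto intro!: inv_P)
    have x0: "x \<in> K 0" using block_growth(3)[OF x s] .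
    have R: "0 \<le> R" by (rule order.trans[OF norm_ge_zero K_bound(1)[OF x0]])
    have "agree 0 x z" by (simp add: agree_def)
    note drift = same_side_drift[OF x(2) good_typical[OF z] s side this, of C "M powr \<delta>" n,
        unfolded C_def, OF block_growth(1,2)[OF x s] _ \<delta>_domination, folded C_def, folded L_def]
    let ?Y = "P z ** matrix_inv ?q ** ?p ** matrix_inv (P x)"
    let ?Z = "P x ** matrix_inv ?p ** ?q ** matrix_inv (P z)"
    have Y: "norm ?Y \<le> B" using drift(1) norm_triangle_ineq2[of ?Y "mat 1"] by (simp add: B_def)
    have Z: "norm ?Z \<le> B" using drift(2) norm_triangle_ineq2[of ?Z "mat 1"] by (simp add: B_def)
    have B: "0 \<le> B" by (rule order.trans[OF norm_ge_zero Y])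
    have "P z = ?Y ** P x ** matrix_inv ?p ** ?q" by (simp add: matrix_inv_cancel inv)
    then have "norm (P z) \<le> norm ?Y * norm (P x) * norm (matrix_inv ?p) * norm ?q"
      using norm_matrix_mult4_le by metis
    also have "\<dots> \<le> B * R * R * R"
      using B R Y K_bound x0 n by (intro mult_mono mult_nonneg_nonneg) auto
    finally have 1: "norm (P z) \<le> B * R * R * R" .
    have "matrix_inv (P z) = matrix_inv ?q ** ?p ** matrix_inv (P x) ** ?Z"
      by (simp add: matrix_mul_assoc matrix_inv_cancel matrix_inv_left inv)
    then have "norm (matrix_inv (P z)) \<le> norm (matrix_inv ?q) * norm ?p * norm (matrix_inv (P x)) * norm ?Z"
      using norm_matrix_mult4_le by metis
    also have "\<dots> \<le> R * R * R * B"
      using B R Z K_bound x0 n by (intro mult_mono mult_nonneg_nonneg) auto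
    finally show ?thesis using 1 by (simp add: mult_ac)
  qed
  then show ?thesis by blast
qed

text \<open>Given the word \<open>y\<^sub>0 \<dots> y\<^sub>n\<close>, choose a block point \<open>b\<close> for the future that starts with \<open>y\<^sub>n\<close>, then a
block point \<open>a\<close> for the past that ends in \<open>y\<^sub>0\<close>, and then \<open>v\<close> in the cylinder of the word. Put \<open>z\<close>
together from the past of \<open>a\<close>, the word, and the future of \<open>b\<close>. Then \<open>z\<close> lies on the side of \<open>a\<close>, and
its \<open>n\<close>-th shift lies on the side of \<open>b\<close>. For almost all choices, made in this order, \<open>z\<close> and its shift
are good.\<close>

lemma controlled_orbit_segments:
  "\<exists>R'. \<forall>y\<in>\<Sigma>. \<forall>n::nat. \<exists>z. typical z \<and> (\<forall>k\<in>{0..int n}. z k = y k) \<and>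
     norm (P z) \<le> R' \<and> norm (matrix_inv (P z)) \<le> R' \<and>
     norm (P (shift_by n z)) \<le> R' \<and> norm (matrix_inv (P (shift_by n z))) \<le> R'"
proof -
  from bounded_on_side_of_block obtain R' where R': "\<forall>s\<in>{1, -1}. \<forall>x z. x \<in> block s \<and> typical x \<and> good z \<and>
      same_side s x z \<longrightarrow> norm (P z) \<le> R' \<and> norm (matrix_inv (P z)) \<le> R'" ..
  have "\<exists>z. typical z \<and> (\<forall>k\<in>{0..int n}. z k = y k) \<and>
     norm (P z) \<le> R' \<and> norm (matrix_inv (P z)) \<le> R' \<and>
     norm (P (shift_by n z)) \<le> R' \<and> norm (matrix_inv (P (shift_by n z))) \<le> R'"
    if y: "y \<in> \<Sigma>" for y and n :: nat
  proof -
    define \<phi> where "\<phi> z \<longleftrightarrow> good z \<and> good (shift_by (- int n) z)" for z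
    have "AE z in \<mu>. \<phi> z" using AE_good AE_shift[OF AE_good] by (simp add: \<phi>_def)
    note glue = AE_glue[OF prob_space_axioms sets_\<mu> lps]
    from glue(1)[OF \<open>AE z in \<mu>. \<phi> z\<close>] AE_typical
    have "AE b in \<mu>. typical b \<and> (AE v in \<mu>. b 0 = v 0 \<longrightarrow> \<phi> (glue (v, b)))" by simp
    from block_meets_cyl[of 1, OF _ _ this, of "shift_by n y"] y obtain b where
      b: "b \<in> block 1" "b 0 = y (int n)" "typical b" "AE v in \<mu>. b 0 = v 0 \<longrightarrow> \<phi> (glue (v, b))"
      by (auto simp: shift_apply)
    \<comment> \<open>The property of \<open>v\<close> relative to \<open>b\<close> is shifted to time \<open>n\<close> and then required with the past of \<open>v\<close>
      replaced by that of \<open>a\<close>.\<close>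
    from glue(2)[OF AE_shift[OF b(4), of n]] AE_typical
    have "AE a in \<mu>. typical a \<and> (AE v in \<mu>. v 0 = a 0 \<longrightarrow> b 0 = shift_by n (glue (a, v)) 0 \<longrightarrow>
        \<phi> (glue (shift_by n (glue (a, v)), b)))" by simp
    from block_meets_cyl[of "-1", OF _ y this] obtain a where
      a: "a \<in> block (-1)" "a 0 = y 0" "typical a" and
      av: "AE v in \<mu>. v 0 = a 0 \<longrightarrow> b 0 = shift_by n (glue (a, v)) 0 \<longrightarrow>
        \<phi> (glue (shift_by n (glue (a, v)), b))"
      by auto
    let ?W = "{x. \<forall>k\<in>{0..int n}. x k = y k}"
    have "prob (?W \<inter> \<Sigma>) > 0" by (rule pos_open[OF open_window, of y]) (use y in auto)
    moreover have "?W \<inter> \<Sigma> \<in> sets \<mu>"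
      using sets_\<mu>_Int[OF borel_open[OF open_window]] by (simp only: Int_commute)
    ultimately obtain v where v: "v \<in> ?W" "v 0 = a 0 \<longrightarrow> b 0 = shift_by n (glue (a, v)) 0 \<longrightarrow>
        \<phi> (glue (shift_by n (glue (a, v)), b))"
      using AE_pos_witness[OF av] by blast
    have v_eq: "v k = y k" if "0 \<le> k" "k \<le> int n" for k using v(1) that by simp
    define z where "z = shift_by (- int n) (glue (shift_by n (glue (a, v)), b))"
    have "v 0 = a 0" using v_eq a(2) by simp
    moreover have "b 0 = shift_by n (glue (a, v)) 0" using v_eq b(2) by (simp add: shift_apply glue_def)
    ultimately have "\<phi> (glue (shift_by n (glue (a, v)), b))" using v(2) by blast
    then have good: "good z" "good (shift_by n z)" by (simp_all add: \<phi>_def z_def)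
    have z: "z k = (if k < 0 then a k else if k < int n then v k else b (k - int n))" for k
      by (auto simp: z_def shift_apply glue_def)
    have window: "\<forall>k\<in>{0..int n}. z k = y k"
      using v_eq b(2) by (auto simp: z)
    have "same_side 1 b (shift_by n z)"
      by (simp add: same_side_def shift_apply z)
    moreover have "same_side (-1) a z"
      unfolding same_side_def
    proof
      fix k :: nat
      show "a (-1 * int k) = z (-1 * int k)"
      proof (cases "k = 0")
        case True
        have "z 0 = y 0" using window by simp
        then show ?thesis using True a(2) by simp
      qed (simp add: z)
    qed
    ultimately show ?thesis
      using R' a b good window good_typical by blast
  qed
  then show ?thesis by blast
qed

end

section \<open>Subexponential growth of the cocycle\<close>

context coboundary_with_blocks
begin

primrec cocycle :: "int \<Rightarrow> nat \<Rightarrow> (int \<Rightarrow> nat) \<Rightarrow> real^'d^'d" where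
  "cocycle s 0 x = mat 1"
| "cocycle s (Suc n) x = generator s (shift_by (s * int n) x) ** cocycle s n x"

lemma cocycle_typical:
  assumes x: "typical x" and s: "s \<in> {1, -1}"
  shows "cocycle s n x = P (shift_by (s * int n) x) ** matrix_inv (P x)"
proof (induction n)
  case 0
  have "x \<in> \<Sigma>" using x by (simp add: typical_def)
  then show ?case by (simp add: matrix_inv_right inv_P)
next
  case (Suc n)
  show ?case unfolding cocycle.simps Suc.IH typical_step[OF x s] by (simp only: matrix_mul_assoc)
qed

text \<open>Telescoping: the products differ by the sum over \<open>k\<close> of the terms in which the \<open>k\<close>-th factor is
exchanged.\<close>

lemma cocycle_diff_expand:
  "cocycle s n y - cocycle s n z = (\<Sum>k<n. cocycle s (n - Suc k) (shift_by (s * int (Suc k)) y) **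
     ((generator s (shift_by (s * int k) y) - generator s (shift_by (s * int k) z)) ** cocycle s k z))"
proof (induction n)
  case (Suc n)
  let ?g = "\<lambda>k x. generator s (shift_by (s * int k) x)"
  let ?t = "\<lambda>k. (?g k y - ?g k z) ** cocycle s k z"
  have front: "?g n y ** cocycle s (n - Suc k) (shift_by (s * int (Suc k)) y)
      = cocycle s (Suc n - Suc k) (shift_by (s * int (Suc k)) y)" if "k < n" for k
  proof -
    have "Suc n - Suc k = Suc (n - Suc k)" using that by simp
    moreover have "s * int (n - Suc k) + s * int (Suc k) = s * int n"
      using that by (simp add: of_nat_diff algebra_simps)
    ultimately show ?thesis by (simp del: of_nat_Suc)
  qed
  have "cocycle s (Suc n) y - cocycle s (Suc n) z = ?g n y ** (cocycle s n y - cocycle s n z) + ?t n"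
    by (simp add: matrix_mult_diff_left matrix_mult_diff_right)
  also have "?g n y ** (cocycle s n y - cocycle s n z)
      = (\<Sum>k<n. ?g n y ** (cocycle s (n - Suc k) (shift_by (s * int (Suc k)) y) ** ?t k))"
    unfolding Suc.IH by (rule bounded_bilinear.sum_right[OF bounded_bilinear_matrix_mult])
  also have "\<dots> = (\<Sum>k<n. cocycle s (Suc n - Suc k) (shift_by (s * int (Suc k)) y) ** ?t k)"
    by (intro sum.cong refl) (simp only: matrix_mul_assoc[of "?g n y"] front lessThan_iff)
  finally show ?case by simp
qed simp

text \<open>The bound is uniform over all points of the shift space, not over almost all.\<close>

definition growth_rate :: "int \<Rightarrow> real \<Rightarrow> bool" where
  "growth_rate s r \<longleftrightarrow> (\<exists>C. \<forall>n. \<forall>y\<in>\<Sigma>. norm (cocycle s n y) \<le> C * exp (r * real n))"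

lemma growth_rate_mono: "growth_rate s r \<Longrightarrow> r \<le> r' \<Longrightarrow> growth_rate s r'"
  unfolding growth_rate_def
proof (elim exE)
  fix C assume C: "\<forall>n. \<forall>y\<in>\<Sigma>. norm (cocycle s n y) \<le> C * exp (r * real n)" and r: "r \<le> r'"
  obtain x where "x \<in> \<Sigma>" using not_empty space_\<mu> by blast
  then have "norm (cocycle s 0 x) \<le> C * exp (r * real 0)" using C by blast
  then have "0 \<le> C" using norm_ge_zero[of "cocycle s 0 x"] by (simp only: of_nat_0 mult_zero_right exp_zero mult_1_right)
  then have "C * exp (r * real n) \<le> C * exp (r' * real n)" for n
    using r by (intro mult_left_mono) (auto intro: mult_right_mono)
  then show "\<exists>C. \<forall>n. \<forall>y\<in>\<Sigma>. norm (cocycle s n y) \<le> C * exp (r' * real n)"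
    using C order.trans by meson
qed

lemma growth_rate_ln_M: "growth_rate s (ln M)"
  unfolding growth_rate_def
proof (intro exI allI ballI)
  fix n y assume y: "y \<in> \<Sigma>"
  have "norm (cocycle s n y) \<le> norm (mat 1 :: real^'d^'d) * M ^ n"
  proof (induction n)
    case (Suc n)
    have "norm (cocycle s (Suc n) y) \<le> norm (generator s (shift_by (s * int n) y)) * norm (cocycle s n y)"
      by (simp add: norm_matrix_mult_le)
    also have "\<dots> \<le> M * (norm (mat 1 :: real^'d^'d) * M ^ n)"
      using y M(1) by (intro mult_mono Suc.IH generator_bound) auto
    finally show ?case by (simp add: mult_ac)
  qed simp
  moreover have "M ^ n = exp (ln M * real n)"
    using M(1) by (simp add: exp_of_nat2_mult)
  ultimately show "norm (cocycle s n y) \<le> norm (mat 1 :: real^'d^'d) * exp (ln M * real n)" by simp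
qed

lemma cocycle_diff_bound:
  assumes C: "\<And>n y. y \<in> \<Sigma> \<Longrightarrow> norm (cocycle s n y) \<le> C * exp (r * real n)" and r: "0 \<le> r"
    and y: "y \<in> \<Sigma>" and z: "z \<in> \<Sigma>"
    and h: "\<And>k. k < n \<Longrightarrow> norm (generator s (shift_by (s * int k) y) - generator s (shift_by (s * int k) z)) \<le> h"
  shows "norm (cocycle s n y - cocycle s n z) \<le> real n * (C * C * h * exp (r * real n))"
proof -
  have C0: "0 \<le> C" using order.trans[OF norm_ge_zero C[OF y, of 0]] by simp
  have term_le: "norm (cocycle s (n - Suc k) (shift_by (s * int (Suc k)) y) **
      ((generator s (shift_by (s * int k) y) - generator s (shift_by (s * int k) z)) ** cocycle s k z))
      \<le> C * C * h * exp (r * real n)" if k: "k < n" for k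
  proof -
    let ?u = "cocycle s (n - Suc k) (shift_by (s * int (Suc k)) y)"
    let ?d = "generator s (shift_by (s * int k) y) - generator s (shift_by (s * int k) z)"
    have h0: "0 \<le> h" using order.trans[OF norm_ge_zero h[OF k]] .
    have "norm (?u ** (?d ** cocycle s k z)) \<le> norm ?u * (norm ?d * norm (cocycle s k z))"
      by (intro order.trans[OF norm_matrix_mult_le] mult_left_mono norm_matrix_mult_le) auto
    also have "\<dots> \<le> (C * exp (r * real (n - Suc k))) * (h * (C * exp (r * real k)))"
      using C0 h0 y z by (intro mult_mono C h k) auto
    also have "\<dots> = C * C * h * exp (r * (real (n - Suc k) + real k))"
      by (simp add: exp_add distrib_left mult_ac)
    also have "\<dots> \<le> C * C * h * exp (r * real n)"
      using C0 h0 r k by (intro mult_left_mono) (auto intro!: mult_left_mono)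
    finally show ?thesis .
  qed
  show ?thesis unfolding cocycle_diff_expand
    using sum_norm_le[of "{..<n}", OF term_le] by simp
qed

text \<open>The segment is extended by \<open>m\<close> symbols on either side before it is replaced by a controlled one.
Agreement along the original segment is then exponentially good in \<open>m\<close>, and cutting the extensions
off costs a factor \<open>M\<^sup>m\<close> at each end.\<close>

lemma controlled_shadowing:
  "\<exists>B\<ge>0. \<forall>y\<in>\<Sigma>. \<forall>n m. \<exists>z. typical z \<and> norm (cocycle s n z) \<le> B * M ^ (2 * m) \<and>
     (\<forall>k\<le>n. agree m (shift_by (s * int k) y) (shift_by (s * int k) z))"
  if s: "s \<in> {1, -1}"
proof -
  from controlled_orbit_segments obtain R' where R': "\<forall>y\<in>\<Sigma>. \<forall>n::nat. \<exists>z. typical z \<and>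
     (\<forall>k\<in>{0..int n}. z k = y k) \<and> norm (P z) \<le> R' \<and> norm (matrix_inv (P z)) \<le> R' \<and>
     norm (P (shift_by n z)) \<le> R' \<and> norm (matrix_inv (P (shift_by n z))) \<le> R'" ..
  have "\<exists>z. typical z \<and> norm (cocycle s n z) \<le> (R' * R') * M ^ (2 * m) \<and>
     (\<forall>k\<le>n. agree m (shift_by (s * int k) y) (shift_by (s * int k) z))" if y: "y \<in> \<Sigma>" for y n m
  proof -
    \<comment> \<open>In the direction \<open>s\<close> the orbit segment of \<open>y\<close> occupies the positions from \<open>- a\<close> to \<open>n + 2 m - a\<close>, once it is
      extended on both sides. For \<open>s = -1\<close> it is traversed backwards, so that the position \<open>0\<close> is near the
      right end.\<close>
    define a where "a = (if s = 1 then int m else int (n + m))"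
    have "shift_by (- a) y \<in> \<Sigma>" using y by simp
    then obtain w where w: "typical w" "\<And>k. k \<in> {0..int (n + 2 * m)} \<Longrightarrow> w k = shift_by (- a) y k"
      "norm (P w) \<le> R'" "norm (matrix_inv (P w)) \<le> R'"
      "norm (P (shift_by (int (n + 2 * m)) w)) \<le> R'" "norm (matrix_inv (P (shift_by (int (n + 2 * m)) w))) \<le> R'"
      using R' by blast
    define z where "z = shift_by a w"
    have z: "typical z" unfolding z_def using w(1) by (rule typical_shift)
    have R0: "0 \<le> R'" using order.trans[OF norm_ge_zero w(3)] .
    have first: "norm (P (shift_by (int m) w)) \<le> M ^ m * R'" "norm (matrix_inv (P (shift_by (int m) w))) \<le> M ^ m * R'"
      using P_growth[OF w(1), of 1 m] w(3,4) M(1)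
      by (auto elim!: order.trans intro!: mult_left_mono)
    have "shift_by (-1 * int m) (shift_by (int (n + 2 * m)) w) = shift_by (int (n + m)) w"
      by (simp add: algebra_simps)
    then have second: "norm (P (shift_by (int (n + m)) w)) \<le> M ^ m * R'"
        "norm (matrix_inv (P (shift_by (int (n + m)) w))) \<le> M ^ m * R'"
      using P_growth[OF typical_shift[OF w(1), of "int (n + 2 * m)"], of "-1" m] w(5,6) M(1)
      by (auto elim!: order.trans intro!: mult_left_mono)
    have "norm (P (shift_by (s * int n) z)) \<le> M ^ m * R' \<and> norm (matrix_inv (P z)) \<le> M ^ m * R'"
      using s first second by (auto simp: z_def a_def algebra_simps)
    then have "norm (cocycle s n z) \<le> (M ^ m * R') * (M ^ m * R')"
      unfolding cocycle_typical[OF z s]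
      using R0 M(1) by (intro order.trans[OF norm_matrix_mult_le] mult_mono) auto
    also have "\<dots> = (R' * R') * (M ^ m * M ^ m)" by (simp only: mult_ac)
    also have "M ^ m * M ^ m = M ^ (2 * m)" by (simp only: mult_2 power_add)
    finally have 1: "norm (cocycle s n z) \<le> (R' * R') * M ^ (2 * m)" .
    have "agree m (shift_by (s * int k) y) (shift_by (s * int k) z)" if k: "k \<le> n" for k
      unfolding agree_def
    proof (intro allI impI)
      fix j :: int assume j: "\<bar>j\<bar> < int m"
      have "j + s * int k + a \<in> {0..int (n + 2 * m)}" using s j k by (auto simp: a_def)
      from w(2)[OF this] show "shift_by (s * int k) y j = shift_by (s * int k) z j"
        by (simp add: z_def shift_by_def algebra_simps)
    qed
    then show ?thesis using z 1 by blast
  qed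
  then show ?thesis by (intro exI[of _ "R' * R'"]) auto
qed

text \<open>Compare the product along \<open>y\<close> with that along a point \<open>z\<close> that shadows with \<open>m\<close> close to \<open>\<gamma> n\<close>. The product
along \<open>z\<close> has rate at most \<open>2 b \<gamma> \<le> r / 2\<close> where \<open>b = ln M\<close>. In the difference, the shadowing error
contributes \<open>\<theta>\<^sup>m\<close>, which beats the loss \<open>\<eta>\<close> in the rate of the factors and the number \<open>n\<close> of terms.\<close>

lemma growth_rate_improve:
  assumes s: "s \<in> {1, -1}" and r: "0 < r" and rate: "\<And>\<eta>. 0 < \<eta> \<Longrightarrow> growth_rate s (r + \<eta>)"
  shows "\<exists>r'\<ge>0. r' < r \<and> growth_rate s r'"
proof -
  define a where "a = - ln \<theta>"
  define b where "b = ln M"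
  have a: "0 < a" and \<theta>_exp: "\<theta> = exp (- a)" using \<theta> by (simp_all add: a_def)
  have b: "0 \<le> b" and M_exp: "M = exp b" using M(1) by (simp_all add: b_def)
  \<comment> \<open>Adding \<open>4\<close> in the denominator makes \<open>\<gamma>\<close> well defined if \<open>M = 1\<close>.\<close>
  define \<gamma> where "\<gamma> = r / (4 * b + 4)"
  have \<gamma>: "0 < \<gamma>" "2 * b * \<gamma> \<le> r / 2"
    using r b by (auto simp: \<gamma>_def field_simps)
  \<comment> \<open>The shadowing error gains \<open>4 c\<close> in the rate. The factors lose \<open>2 c\<close> and the number of terms
    loses \<open>c\<close>, so the net gain is \<open>c\<close>.\<close>
  define c where "c = a * \<gamma> / 4"
  have c: "0 < c" using a \<gamma> by (simp add: c_def)
  obtain C where C: "\<And>n y. y \<in> \<Sigma> \<Longrightarrow> norm (cocycle s n y) \<le> C * exp ((r + 2 * c) * real n)"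
    using rate[of "2 * c"] c unfolding growth_rate_def by auto
  obtain B where B: "0 \<le> B" "\<And>y n m. y \<in> \<Sigma> \<Longrightarrow> \<exists>z. typical z \<and> norm (cocycle s n z) \<le> B * M ^ (2 * m) \<and>
     (\<forall>k\<le>n. agree m (shift_by (s * int k) y) (shift_by (s * int k) z))"
    using controlled_shadowing[OF s] by blast
  define r' where "r' = max (r / 2) (r - c)"
  have "norm (cocycle s n y) \<le> (B * exp (2 * b) + C * C * G / c) * exp (r' * real n)" if y: "y \<in> \<Sigma>" for n y
  proof -
    define m where "m = nat \<lceil>\<gamma> * real n\<rceil>"
    have m: "\<gamma> * real n \<le> real m" "real m \<le> \<gamma> * real n + 1"
      using \<gamma>(1) by (auto simp: m_def of_nat_nat ceiling_le_iff of_int_ceiling_le_add_one)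
    obtain z where z: "typical z" "norm (cocycle s n z) \<le> B * M ^ (2 * m)"
      "\<And>k. k \<le> n \<Longrightarrow> agree m (shift_by (s * int k) y) (shift_by (s * int k) z)"
      using B(2)[OF y] by blast
    have zS: "z \<in> \<Sigma>" using z(1) by (simp add: typical_def)
    have "norm (cocycle s n y - cocycle s n z) \<le> real n * (C * C * (G * \<theta> ^ m) * exp ((r + 2 * c) * real n))"
      using c r by (intro cocycle_diff_bound C y zS generator_holder z(3)) (simp_all add: y zS)
    also have "\<dots> = C * C * G * (real n * (\<theta> ^ m * exp ((r + 2 * c) * real n)))" by (simp add: mult_ac)
    also have "\<dots> \<le> C * C * G * (exp (c * real n) / c * (exp (- 4 * c * real n) * exp ((r + 2 * c) * real n)))"
    proof (intro mult_left_mono mult_mono mult_right_mono)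
      have "c * real n \<le> exp (c * real n)" using exp_ge_add_one_self[of "c * real n"] by linarith
      then show "real n \<le> exp (c * real n) / c" using c by (simp add: field_simps)
      have "\<theta> ^ m = exp (- a * real m)" by (simp add: \<theta>_exp flip: exp_of_nat2_mult)
      also have "\<dots> \<le> exp (- a * (\<gamma> * real n))" using m(1) a by simp
      finally show "\<theta> ^ m \<le> exp (- 4 * c * real n)" by (simp add: c_def mult_ac)
    qed (use c G_ge \<theta> in auto)
    also have "\<dots> = C * C * G / c * exp ((r - c) * real n)"
      by (simp add: algebra_simps flip: exp_add)
    also have "\<dots> \<le> C * C * G / c * exp (r' * real n)"
      using c G_ge by (intro mult_left_mono) (auto simp: r'_def intro!: mult_right_mono)
    finally have diff: "norm (cocycle s n y - cocycle s n z) \<le> C * C * G / c * exp (r' * real n)" .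
    have "M ^ (2 * m) = exp (2 * b * real m)" 
      using exp_of_nat2_mult[of b "2 * m"] by (simp add: M_exp mult_ac)
    also have "\<dots> \<le> exp (2 * b * (\<gamma> * real n + 1))" using m(2) b by (simp add: mult_left_mono)
    also have "\<dots> = exp (2 * b) * exp (2 * b * \<gamma> * real n)" by (simp add: algebra_simps flip: exp_add)
    also have "\<dots> \<le> exp (2 * b) * exp (r' * real n)"
    proof -
      have "2 * b * \<gamma> \<le> r'" using \<gamma>(2) by (simp add: r'_def)
      then show ?thesis by (intro mult_left_mono) (auto intro: mult_right_mono)
    qed
    finally have "B * M ^ (2 * m) \<le> B * (exp (2 * b) * exp (r' * real n))"
      using B(1) by (rule mult_left_mono)
    then have "norm (cocycle s n z) \<le> B * exp (2 * b) * exp (r' * real n)" using z(2) by (simp add: mult_ac)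
    then show ?thesis using diff norm_triangle_ineq2[of "cocycle s n y" "cocycle s n z"] by (simp add: distrib_right)
  qed
  then have "growth_rate s r'" unfolding growth_rate_def by blast
  moreover have "0 \<le> r'" "r' < r" using r c by (auto simp: r'_def)
  ultimately show ?thesis by blast
qed

text \<open>The infimum of the nonnegative growth rates cannot be positive, since it could be improved.\<close>

lemma subexponential_growth:
  assumes s: "s \<in> {1, -1}" and \<epsilon>: "0 < \<epsilon>"
  shows "growth_rate s \<epsilon>"
proof -
  define X where "X = {r. 0 \<le> r \<and> growth_rate s r}"
  have "ln M \<in> X" using growth_rate_ln_M M(1) by (simp add: X_def)
  then have ne: "X \<noteq> {}" by blast
  have bdd: "bdd_below X" by (rule bdd_belowI[of _ 0]) (simp add: X_def)
  have above: "growth_rate s (Inf X + \<eta>)" if \<eta>: "0 < \<eta>" for \<eta>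
  proof -
    obtain r where "r \<in> X" "r < Inf X + \<eta>" using cInf_lessD[OF ne, of "Inf X + \<eta>"] \<eta> by auto
    then show ?thesis using growth_rate_mono[of s r] by (simp add: X_def)
  qed
  have "0 \<le> Inf X" using ne by (rule cInf_greatest) (simp add: X_def)
  moreover have "\<not> 0 < Inf X"
  proof
    assume "0 < Inf X"
    from growth_rate_improve[OF s this above] obtain r' where "r' \<in> X" "r' < Inf X"
      by (auto simp: X_def)
    then show False using cInf_lower[OF _ bdd, of r'] by simp
  qed
  ultimately have "Inf X = 0" by simp
  then show ?thesis using above[OF \<epsilon>] by simp
qed

end

section \<open>Hoelder continuity of P\<close>

context measurable_coboundary
begin

text \<open>Full support in the form in which it is used: almost sure properties hold on a dense set.\<close>

lemma window_witness:
  assumes x: "x \<in> \<Sigma>" and AE: "AE z in \<mu>. \<phi> z"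
  shows "\<exists>z\<in>\<Sigma>. agree N z x \<and> \<phi> z"
proof -
  let ?W = "{z. \<forall>k\<in>{- int N..int N}. z k = x k}"
  have "prob (?W \<inter> \<Sigma>) > 0" by (rule pos_open[OF open_window, of x]) (use x in auto)
  moreover have "?W \<inter> \<Sigma> \<in> sets \<mu>"
    using sets_\<mu>_Int[OF borel_open[OF open_window]] by (simp only: Int_commute)
  ultimately obtain z where "z \<in> ?W \<inter> \<Sigma>" "\<phi> z" using AE_pos_witness[OF AE] by blast
  moreover have "z n = x n" if "\<bar>n\<bar> < int N" for n
  proof -
    have "n \<in> {- int N..int N}" using that by auto
    then show ?thesis using \<open>z \<in> ?W \<inter> \<Sigma>\<close> by blast
  qed
  then have "agree N z x" by (simp add: agree_def)
  ultimately show ?thesis by blast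
qed

text \<open>Continuity along sequences that agree with the limit on growing windows, which for the metric
\<open>rho \<tau>\<close> is the same as continuity on the shift space.\<close>

definition seq_continuous :: "((int \<Rightarrow> nat) \<Rightarrow> 'b::topological_space) \<Rightarrow> bool" where
  "seq_continuous g \<longleftrightarrow> (\<forall>x\<in>\<Sigma>. \<forall>\<zeta>. (\<forall>n. \<zeta> n \<in> \<Sigma> \<and> agree n (\<zeta> n) x) \<longrightarrow> (\<lambda>n. g (\<zeta> n)) \<longlonglongrightarrow> g x)"

lemma AE_eq_imp_eq:
  fixes g h :: "(int \<Rightarrow> nat) \<Rightarrow> 'b::t2_space"
  assumes g: "seq_continuous g" and h: "seq_continuous h" and eq: "AE x in \<mu>. g x = h x"
    and x: "x \<in> \<Sigma>"
  shows "g x = h x"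
proof -
  have "\<forall>n. \<exists>z\<in>\<Sigma>. agree n z x \<and> g z = h z" using window_witness[OF x eq] by blast
  then obtain \<zeta> where \<zeta>: "\<And>n. \<zeta> n \<in> \<Sigma> \<and> agree n (\<zeta> n) x \<and> g (\<zeta> n) = h (\<zeta> n)" by metis
  have "(\<lambda>n. g (\<zeta> n)) \<longlonglongrightarrow> g x" "(\<lambda>n. h (\<zeta> n)) \<longlonglongrightarrow> h x"
    using g h x \<zeta> unfolding seq_continuous_def by blast+
  moreover have "(\<lambda>n. g (\<zeta> n)) = (\<lambda>n. h (\<zeta> n))" using \<zeta> by auto
  ultimately show ?thesis by (simp only: LIMSEQ_unique)
qed

lemma seq_continuous_of_holder:
  fixes g :: "(int \<Rightarrow> nat) \<Rightarrow> 'b::real_normed_vector"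
  assumes "\<And>x y N. x \<in> \<Sigma> \<Longrightarrow> y \<in> \<Sigma> \<Longrightarrow> agree N x y \<Longrightarrow> norm (g x - g y) \<le> c * \<theta> ^ N"
  shows "seq_continuous g"
  unfolding seq_continuous_def
proof (intro ballI allI impI)
  fix x \<zeta> assume x: "x \<in> \<Sigma>" and \<zeta>: "\<forall>n. \<zeta> n \<in> \<Sigma> \<and> agree n (\<zeta> n) x"
  have "(\<lambda>n. c * \<theta> ^ n) \<longlonglongrightarrow> c * 0" using \<theta> by (intro tendsto_intros LIMSEQ_realpow_zero) auto
  then have "(\<lambda>n. c * \<theta> ^ n) \<longlonglongrightarrow> 0" by simp
  then have "(\<lambda>n. g (\<zeta> n) - g x) \<longlonglongrightarrow> 0"
    by (rule Lim_null_comparison[rotated]) (use assms x \<zeta> in auto)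
  then show "(\<lambda>n. g (\<zeta> n)) \<longlonglongrightarrow> g x" by (simp add: LIM_zero_iff)
qed

lemma seq_continuous_shift:
  assumes "seq_continuous g"
  shows "seq_continuous (\<lambda>x. g (shift_by 1 x))"
  unfolding seq_continuous_def
proof (intro ballI allI impI)
  fix x \<zeta> assume x: "x \<in> \<Sigma>" and \<zeta>: "\<forall>n. \<zeta> n \<in> \<Sigma> \<and> agree n (\<zeta> n) x"
  have "agree n (shift_by 1 (\<zeta> (Suc n))) (shift_by 1 x)" for n
    using \<zeta>[rule_format, of "Suc n"] by (auto simp: agree_def shift_by_def)
  then have "(\<lambda>n. g (shift_by 1 (\<zeta> (Suc n)))) \<longlonglongrightarrow> g (shift_by 1 x)"
    using assms x \<zeta> unfolding seq_continuous_def by simp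
  then show "(\<lambda>n. g (shift_by 1 (\<zeta> n))) \<longlonglongrightarrow> g (shift_by 1 x)" 
    by (rule filterlim_sequentially_Suc[THEN iffD1])
qed

lemma seq_continuous_mult:
  fixes g h :: "(int \<Rightarrow> nat) \<Rightarrow> real^'n^'n"
  assumes "seq_continuous g" "seq_continuous h"
  shows "seq_continuous (\<lambda>x. g x ** h x)"
  unfolding seq_continuous_def
proof (intro ballI allI impI)
  fix x \<zeta> assume "x \<in> \<Sigma>" "\<forall>n. \<zeta> n \<in> \<Sigma> \<and> agree n (\<zeta> n) x"
  then have "(\<lambda>n. g (\<zeta> n)) \<longlonglongrightarrow> g x" "(\<lambda>n. h (\<zeta> n)) \<longlonglongrightarrow> h x"
    using assms unfolding seq_continuous_def by blast+
  then show "(\<lambda>n. g (\<zeta> n) ** h (\<zeta> n)) \<longlonglongrightarrow> g x ** h x"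
    by (rule bounded_bilinear.tendsto[OF bounded_bilinear_matrix_mult])
qed

text \<open>If almost every \<open>z\<close> satisfies the estimate with almost every \<open>x\<close>, then any two such \<open>z, z'\<close> satisfy it with
twice the constant, by comparison with a common \<open>x\<close> close to \<open>z\<close>. So \<open>g\<close> is Hoelder continuous on a
set of full measure, which is dense, and extends.\<close>

lemma holder_version:
  fixes g :: "(int \<Rightarrow> nat) \<Rightarrow> 'b::banach"
  assumes pairs: "AE z in \<mu>. AE x in \<mu>. \<forall>N. agree N x z \<longrightarrow> norm (g x - g z) \<le> c * \<theta> ^ N"
  shows "\<exists>h. (\<forall>x\<in>\<Sigma>. \<forall>y\<in>\<Sigma>. \<forall>N. agree N x y \<longrightarrow> norm (h x - h y) \<le> 2 * c * \<theta> ^ N) \<and>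
    (AE x in \<mu>. g x = h x)"
proof -
  define Z where "Z = {z \<in> \<Sigma>. AE x in \<mu>. \<forall>N. agree N x z \<longrightarrow> norm (g x - g z) \<le> c * \<theta> ^ N}"
  have AE_Z: "AE z in \<mu>. z \<in> Z" using pairs AE_space by eventually_elim (simp add: Z_def space_\<mu>)
  have Z: "norm (g z - g z') \<le> 2 * c * \<theta> ^ N" if z: "z \<in> Z" "z' \<in> Z" and N: "agree N z z'" for z z' N
  proof -
    have "AE x in \<mu>. (\<forall>N. agree N x z \<longrightarrow> norm (g x - g z) \<le> c * \<theta> ^ N) \<and>
        (\<forall>N. agree N x z' \<longrightarrow> norm (g x - g z') \<le> c * \<theta> ^ N)"
      using z by (simp add: Z_def)
    from window_witness[OF _ this, of z N] z(1) obtain x where x: "agree N x z"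
      "\<forall>N. agree N x z \<longrightarrow> norm (g x - g z) \<le> c * \<theta> ^ N" "\<forall>N. agree N x z' \<longrightarrow> norm (g x - g z') \<le> c * \<theta> ^ N"
      unfolding Z_def by blast
    have "agree N x z'" using x(1) N by (simp add: agree_def)
    then have "norm (g x - g z) \<le> c * \<theta> ^ N" "norm (g x - g z') \<le> c * \<theta> ^ N" using x by blast+
    then show ?thesis using norm_triangle_ineq4[of "g x - g z'" "g x - g z"] by simp
  qed
  have "\<forall>x\<in>\<Sigma>. \<forall>n. \<exists>z\<in>Z. agree n z x" using window_witness[OF _ AE_Z] by blast
  then obtain \<zeta> where \<zeta>: "\<And>x n. x \<in> \<Sigma> \<Longrightarrow> \<zeta> x n \<in> Z \<and> agree n (\<zeta> x n) x" by metis
  define h where "h x = lim (\<lambda>n. g (\<zeta> x n))" for x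
  have null: "(\<lambda>n. 2 * c * \<theta> ^ n) \<longlonglongrightarrow> 0"
    using tendsto_mult_right_zero[OF LIMSEQ_realpow_zero[of \<theta>], of "2 * c"] \<theta> by simp
  have agree_\<zeta>: "agree N (\<zeta> x n) (\<zeta> y m)" if "x \<in> \<Sigma>" "y \<in> \<Sigma>" "agree N x y" "N \<le> n" "N \<le> m" for x y N n m
    using agree_mono[OF conjunct2[OF \<zeta>[OF that(1)]] that(4)] agree_mono[OF conjunct2[OF \<zeta>[OF that(2)]] that(5)] that(3)
    by (simp add: agree_def)
  have lim: "(\<lambda>n. g (\<zeta> x n)) \<longlonglongrightarrow> h x" if x: "x \<in> \<Sigma>" for x
  proof -
    have "Cauchy (\<lambda>n. g (\<zeta> x n))"
    proof (rule metric_CauchyI)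
      fix e :: real assume "0 < e"
      with null have "\<forall>\<^sub>F N in sequentially. 2 * c * \<theta> ^ N < e" by (rule order_tendstoD)
      then obtain N where N: "2 * c * \<theta> ^ N < e" by (auto simp: eventually_sequentially)
      have "dist (g (\<zeta> x m)) (g (\<zeta> x n)) < e" if "N \<le> m" "N \<le> n" for m n
      proof -
        have "agree N x x" by (simp add: agree_def)
        then have "norm (g (\<zeta> x m) - g (\<zeta> x n)) \<le> 2 * c * \<theta> ^ N"
          using \<zeta>[OF x] that x by (intro Z agree_\<zeta>) auto
        then show ?thesis unfolding dist_norm using N by linarith
      qed
      then show "\<exists>N. \<forall>m\<ge>N. \<forall>n\<ge>N. dist (g (\<zeta> x m)) (g (\<zeta> x n)) < e" by blast
    qed
    then show ?thesis unfolding h_def by (simp only: Cauchy_convergent convergent_LIMSEQ_iff[symmetric])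
  qed
  have "norm (h x - h y) \<le> 2 * c * \<theta> ^ N" if xy: "x \<in> \<Sigma>" "y \<in> \<Sigma>" "agree N x y" for x y N
  proof (rule LIMSEQ_le_const2)
    show "(\<lambda>n. norm (g (\<zeta> x n) - g (\<zeta> y n))) \<longlonglongrightarrow> norm (h x - h y)"
      using lim xy by (intro tendsto_intros) auto
    have "norm (g (\<zeta> x n) - g (\<zeta> y n)) \<le> 2 * c * \<theta> ^ N" if "N \<le> n" for n
      using \<zeta> xy that by (intro Z agree_\<zeta>) auto
    then show "\<exists>M. \<forall>n\<ge>M. norm (g (\<zeta> x n) - g (\<zeta> y n)) \<le> 2 * c * \<theta> ^ N" by blast
  qed
  moreover have "g x = h x" if x: "x \<in> Z" for x
  proof -
    have xS: "x \<in> \<Sigma>" using x by (simp add: Z_def)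
    have "(\<lambda>n. g (\<zeta> x n) - g x) \<longlonglongrightarrow> 0"
      by (rule Lim_null_comparison[OF _ null]) (use Z[OF _ x] \<zeta>[OF xS] in auto)
    then have "(\<lambda>n. g (\<zeta> x n)) \<longlonglongrightarrow> g x" by (simp add: LIM_zero_iff)
    then show ?thesis using lim[OF xS] LIMSEQ_unique by blast
  qed
  then have "AE x in \<mu>. g x = h x" using AE_Z by (auto elim: eventually_mono)
  ultimately show ?thesis by blast
qed

end

context coboundary_with_blocks
begin

text \<open>By subexponential growth the drift estimate holds for all good points at the exact Hoelder rate. Along
common visits to \<open>K j\<close> at late times, the drift converges to \<open>P z ** matrix_inv (P x)\<close> up to an error of
order \<open>1 / (j + 1)\<close>, and \<open>j\<close> is arbitrary.\<close>

lemma same_side_holder: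
  "\<exists>L\<ge>0. \<forall>s\<in>{1, -1}. \<forall>x z N. good x \<and> good z \<and> same_side s x z \<and> agree N x z \<longrightarrow>
     norm (P z ** matrix_inv (P x) - mat 1) \<le> L * \<theta> ^ N"
proof -
  \<comment> \<open>Any rate below \<open>- ln \<theta> / 2\<close> ensures \<open>\<kappa>\<^sup>2 \<theta> < 1\<close>.\<close>
  define \<epsilon> where "\<epsilon> = - ln \<theta> / 4"
  define \<kappa> where "\<kappa> = exp \<epsilon>"
  have \<epsilon>: "0 < \<epsilon>" using \<theta> by (simp add: \<epsilon>_def)
  have "\<theta> = exp (- 4 * \<epsilon>)" using \<theta> by (simp add: \<epsilon>_def)
  then have \<kappa>: "0 \<le> \<kappa>" "\<kappa> * \<kappa> * \<theta> < 1" using \<epsilon> by (simp_all add: \<kappa>_def flip: exp_add)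
  obtain C1 C2 where C12: "\<forall>n. \<forall>y\<in>\<Sigma>. norm (cocycle 1 n y) \<le> C1 * exp (\<epsilon> * real n)"
      "\<forall>n. \<forall>y\<in>\<Sigma>. norm (cocycle (-1) n y) \<le> C2 * exp (\<epsilon> * real n)"
    using subexponential_growth[of 1, OF _ \<epsilon>] subexponential_growth[of "-1", OF _ \<epsilon>]
    unfolding growth_rate_def by auto
  define C where "C = max C1 C2"
  have C: "norm (cocycle s n y) \<le> C * \<kappa> ^ n" if "s \<in> {1, -1}" "y \<in> \<Sigma>" for s n y
  proof -
    have "exp (\<epsilon> * real n) = \<kappa> ^ n" by (simp add: \<kappa>_def exp_of_nat2_mult)
    moreover have "C1 * \<kappa> ^ n \<le> C * \<kappa> ^ n" "C2 * \<kappa> ^ n \<le> C * \<kappa> ^ n"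
      by (intro mult_right_mono; simp add: C_def \<kappa>_def)+
    ultimately show ?thesis using C12 that by (metis insertE order.trans singletonD)
  qed
  define L where "L = C * C * M / (1 - \<kappa> * \<kappa> * \<theta>) * exp (C * C * M * G / (1 - \<kappa> * \<kappa> * \<theta>))
      * norm (mat 1 :: real^'d^'d)"
  have L: "0 \<le> L * G"
    using \<kappa> M(1) G_ge(2) by (simp add: L_def)
  have "norm (P z ** matrix_inv (P x) - mat 1) \<le> (L * G) * \<theta> ^ N"
    if s: "s \<in> {1, -1}" and x: "good x" and z: "good z" and side: "same_side s x z" and N: "agree N x z"
    for s x z N
  proof -
    have x': "typical x" and z': "typical z" using x z by (auto intro: good_typical)
    have S: "x \<in> \<Sigma>" "z \<in> \<Sigma>" using x' z' by (auto simp: typical_def)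
    let ?p = "\<lambda>n. P (shift_by (s * int n) x)" and ?q = "\<lambda>n. P (shift_by (s * int n) z)"
    have g1: "norm (?p n ** matrix_inv (P x)) \<le> C * \<kappa> ^ n" for n
      using C[OF s S(1), of n] by (simp only: cocycle_typical[OF x' s])
    have g2: "norm (P x ** matrix_inv (?p n)) \<le> C * \<kappa> ^ n" for n
    proof -
      have "- s \<in> {1, -1}" using s by auto
      from C[OF this, of "shift_by (s * int n) x" n] S(1) show ?thesis
        by (simp add: cocycle_typical[OF typical_shift[OF x'] \<open>- s \<in> {1, -1}\<close>])
    qed
    have drift: "norm (P z ** matrix_inv (?q n) ** ?p n ** matrix_inv (P x) - mat 1) \<le> L * (G * \<theta> ^ N)" for n
      using same_side_drift(1)[OF x' z' s side N g1 g2 \<kappa>] by (simp add: L_def)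
    define b where "b = norm (P z) * R * norm (matrix_inv (P x))"
    have bound: "norm (P z ** matrix_inv (P x) - mat 1) \<le> L * (G * \<theta> ^ N) + b * (1 / real (Suc j))" for j
    proof -
      obtain N' where N': "\<forall>x\<in>K j. \<forall>y\<in>K j. agree N' x y \<longrightarrow> norm (P x - P y) < 1 / real (Suc j)"
        using K_osc by blast
      obtain m m' where "frequently_in (shift_by s) (K j) \<delta> ((shift_by s ^^ m) x)"
          "frequently_in (shift_by s) (K j) \<delta> ((shift_by s ^^ m') z)"
        using x z s unfolding good_def by blast
      from common_visit[OF this \<delta>(2), of N'] obtain n where n: "n \<ge> N'"
        "shift_by (s * int n) x \<in> K j" "shift_by (s * int n) z \<in> K j"
        unfolding funpow_shift by blast
      have "agree N' (shift_by (s * int n) x) (shift_by (s * int n) z)"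
        using agree_mono[OF agree_shift_same_side[OF s side N]] n(1) by simp
      then have osc: "norm (?p n - ?q n) \<le> 1 / real (Suc j)" using N' n by (meson less_imp_le)
      let ?Y = "P z ** matrix_inv (?q n) ** ?p n ** matrix_inv (P x)"
      have "?Y - P z ** matrix_inv (P x) = P z ** matrix_inv (?q n) ** (?p n - ?q n) ** matrix_inv (P x)"
        by (simp add: matrix_mult_diff_left matrix_mult_diff_right matrix_inv_cancel inv_P S)
      then have "norm (?Y - P z ** matrix_inv (P x))
          \<le> norm (P z) * norm (matrix_inv (?q n)) * norm (?p n - ?q n) * norm (matrix_inv (P x))"
        by (simp only: norm_matrix_mult4_le)
      also have "\<dots> \<le> norm (P z) * R * (1 / real (Suc j)) * norm (matrix_inv (P x))"
        using osc K_bound(2)[OF n(3)] order.trans[OF norm_ge_zero K_bound(2)[OF n(3)]]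
        by (intro mult_right_mono mult_mono) auto
      also have "\<dots> = b * (1 / real (Suc j))" by (simp add: b_def)
      finally show ?thesis
        using drift[of n] norm_triangle_ineq4[of "?Y - mat 1" "?Y - P z ** matrix_inv (P x)"] by simp
    qed
    have "(\<lambda>j. L * (G * \<theta> ^ N) + b * (1 / real (Suc j))) \<longlonglongrightarrow> L * (G * \<theta> ^ N) + b * 0"
      using LIMSEQ_inverse_real_of_nat by (intro tendsto_intros) (simp add: inverse_eq_divide)
    from LIMSEQ_le_const[OF this] bound show ?thesis by (simp add: mult.assoc)
  qed
  then show ?thesis using L by blast
qed

text \<open>The intermediate point \<open>w\<close> has the past of \<open>x\<close> and the future of \<open>z\<close>. It agrees with both points wherever
they agree with each other, so passing from \<open>z\<close> to \<open>w\<close> and from \<open>w\<close> to \<open>x\<close> keeps the window \<open>N\<close>.\<close>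

lemma AE_pairs_holder_same_symbol:
  "\<exists>L\<ge>0. AE z in \<mu>. AE x in \<mu>. x 0 = z 0 \<longrightarrow> (\<forall>N. agree N x z \<longrightarrow>
     norm (P x ** matrix_inv (P z) - mat 1) \<le> L * \<theta> ^ N \<and>
     norm (P z ** matrix_inv (P x) - mat 1) \<le> L * \<theta> ^ N)"
proof -
  from same_side_holder obtain L where L: "0 \<le> L" "\<forall>s\<in>{1, -1}. \<forall>x z N. good x \<and> good z \<and>
     same_side s x z \<and> agree N x z \<longrightarrow> norm (P z ** matrix_inv (P x) - mat 1) \<le> L * \<theta> ^ N" by blast
  let ?I = "norm (mat 1 :: real^'d^'d)"
  define L' where "L' = L * (?I + L) + L"
  have trans: "norm (X ** Y - mat 1) \<le> L' * \<theta> ^ N"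
    if X: "norm (X - mat 1) \<le> L * \<theta> ^ N" and Y: "norm (Y - mat 1) \<le> L * \<theta> ^ N" for X Y :: "real^'d^'d" and N
  proof -
    have "L * \<theta> ^ N \<le> L" using L(1) \<theta> mult_left_mono[OF power_le_one[of \<theta> N] L(1)] by simp
    then have Y': "norm Y \<le> ?I + L" using Y norm_triangle_ineq2[of Y "mat 1"] by linarith
    have "X ** Y - mat 1 = (X - mat 1) ** Y + (Y - mat 1)" by (simp add: matrix_mult_diff_left)
    then have "norm (X ** Y - mat 1) \<le> norm ((X - mat 1) ** Y) + norm (Y - mat 1)"
      by (metis norm_triangle_ineq)
    also have "norm ((X - mat 1) ** Y) \<le> norm (X - mat 1) * norm Y" by (rule norm_matrix_mult_le)
    also have "\<dots> \<le> L * \<theta> ^ N * (?I + L)" using X Y' L(1) \<theta> by (intro mult_mono) auto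
    finally show ?thesis using Y by (simp add: L'_def algebra_simps)
  qed
  have good_pair: "norm (P x ** matrix_inv (P z) - mat 1) \<le> L' * \<theta> ^ N \<and>
      norm (P z ** matrix_inv (P x) - mat 1) \<le> L' * \<theta> ^ N"
    if g: "good x" "good z" "good (glue (x, z))" and sym: "x 0 = z 0" and N: "agree N x z" for x z N
  proof -
    define w where "w = glue (x, z)"
    have w: "w n = (if n < 0 then x n else z n)" for n by (simp add: w_def glue_def)
    have "invertible (P w)" using g(3) inv_P good_typical by (auto simp: w_def typical_def)
    note cancel = matrix_inv_cancel[OF this]
    have side: "same_side 1 z w" "same_side 1 w z" by (simp_all add: same_side_def w)
    have side': "same_side (-1) x w" "same_side (-1) w x"
      using sym by (auto simp: same_side_def w)
    have N': "agree N z w" "agree N w z" "agree N x w" "agree N w x" using N by (auto simp: agree_def w)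
    note close = L(2)[rule_format, OF _ conjI[OF _ conjI[OF _ conjI]]]
    have gw: "good w" using g(3) by (simp add: w_def)
    have "norm (P w ** matrix_inv (P z) - mat 1) \<le> L * \<theta> ^ N"
      by (rule close[of 1]) (use g gw side N' in auto)
    moreover have "norm (P z ** matrix_inv (P w) - mat 1) \<le> L * \<theta> ^ N"
      by (rule close[of 1]) (use g gw side N' in auto)
    moreover have "norm (P w ** matrix_inv (P x) - mat 1) \<le> L * \<theta> ^ N"
      by (rule close[of "-1"]) (use g gw side' N' in auto)
    moreover have "norm (P x ** matrix_inv (P w) - mat 1) \<le> L * \<theta> ^ N"
      by (rule close[of "-1"]) (use g gw side' N' in auto)
    ultimately have "norm ((P x ** matrix_inv (P w)) ** (P w ** matrix_inv (P z)) - mat 1) \<le> L' * \<theta> ^ N"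
      "norm ((P z ** matrix_inv (P w)) ** (P w ** matrix_inv (P x)) - mat 1) \<le> L' * \<theta> ^ N"
      by (auto intro: trans)
    then show ?thesis by (simp add: matrix_mul_assoc cancel)
  qed
  have "AE z in \<mu>. AE x in \<mu>. x 0 = z 0 \<longrightarrow> (\<forall>N. agree N x z \<longrightarrow>
     norm (P x ** matrix_inv (P z) - mat 1) \<le> L' * \<theta> ^ N \<and>
     norm (P z ** matrix_inv (P x) - mat 1) \<le> L' * \<theta> ^ N)"
    using AE_glue(1)[OF prob_space_axioms sets_\<mu> lps AE_good] AE_good
  proof eventually_elim
    case (elim z)
    from elim(1) AE_good show ?case
      by eventually_elim (use elim(2) good_pair in auto)
  qed
  moreover have "0 \<le> L'" using L(1) by (simp add: L'_def)
  ultimately show ?thesis by blast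
qed

text \<open>Almost every point with zeroth symbol \<open>i\<close> is compared with a single reference point for that symbol.\<close>

lemma AE_bounded: "\<exists>B. AE x in \<mu>. norm (P x) \<le> B \<and> norm (matrix_inv (P x)) \<le> B"
proof -
  from AE_pairs_holder_same_symbol obtain L where L: "0 \<le> L" and
    AE: "AE z in \<mu>. AE x in \<mu>. x 0 = z 0 \<longrightarrow> (\<forall>N. agree N x z \<longrightarrow>
     norm (P x ** matrix_inv (P z) - mat 1) \<le> L * \<theta> ^ N \<and>
     norm (P z ** matrix_inv (P x) - mat 1) \<le> L * \<theta> ^ N)" by blast
  let ?I = "norm (mat 1 :: real^'d^'d)"
  have "\<exists>B\<ge>0. AE x in \<mu>. x 0 = i \<longrightarrow> norm (P x) \<le> B \<and> norm (matrix_inv (P x)) \<le> B" for i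
  proof (cases "cyl l q i = {}")
    case True
    have "AE x in \<mu>. x 0 \<noteq> i" using AE_space by eventually_elim (use True in \<open>auto simp: cyl_def space_\<mu>\<close>)
    then show ?thesis by (intro exI[of _ 0]) (auto elim: eventually_mono)
  next
    case False
    then obtain y where y: "y \<in> \<Sigma>" "y 0 = i" by (auto simp: cyl_def)
    from window_witness[OF y(1) AE, of 1] obtain z where z: "z \<in> \<Sigma>" "agree 1 z y"
      and AE': "AE x in \<mu>. x 0 = z 0 \<longrightarrow> (\<forall>N. agree N x z \<longrightarrow>
         norm (P x ** matrix_inv (P z) - mat 1) \<le> L * \<theta> ^ N \<and>
         norm (P z ** matrix_inv (P x) - mat 1) \<le> L * \<theta> ^ N)" by blast
    have zi: "z 0 = i" using z(2) y(2) by (simp add: agree_def)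
    define B where "B = (?I + L) * max (norm (P z)) (norm (matrix_inv (P z)))"
    have "AE x in \<mu>. x 0 = i \<longrightarrow> norm (P x) \<le> B \<and> norm (matrix_inv (P x)) \<le> B"
      using AE' AE_space
    proof eventually_elim
      case (elim x)
      show ?case
      proof
        assume "x 0 = i"
        then have "x 0 = z 0" using zi by simp
        then have "\<forall>N. agree N x z \<longrightarrow>
            norm (P x ** matrix_inv (P z) - mat 1) \<le> L * \<theta> ^ N \<and>
            norm (P z ** matrix_inv (P x) - mat 1) \<le> L * \<theta> ^ N" using elim(1) by blast
        moreover have "agree 0 x z" by (simp add: agree_def)
        ultimately have 1: "norm (P x ** matrix_inv (P z) - mat 1) \<le> L * \<theta> ^ 0"
          "norm (P z ** matrix_inv (P x) - mat 1) \<le> L * \<theta> ^ 0"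
          by blast+
        have inv: "invertible (P x)" "invertible (P z)" using elim(2) z(1) inv_P by (auto simp: space_\<mu>)
        have 2: "norm (P x ** matrix_inv (P z)) \<le> ?I + L" "norm (P z ** matrix_inv (P x)) \<le> ?I + L"
          using 1 norm_triangle_ineq2[of "P x ** matrix_inv (P z)" "mat 1"]
            norm_triangle_ineq2[of "P z ** matrix_inv (P x)" "mat 1"] by simp_all
        have "norm (P x) \<le> norm (P x ** matrix_inv (P z)) * norm (P z)"
          using norm_matrix_mult_le[of "P x ** matrix_inv (P z)" "P z"] by (simp add: matrix_inv_cancel inv)
        also have "\<dots> \<le> B" unfolding B_def using 2 L by (intro mult_mono) auto
        finally have 3: "norm (P x) \<le> B" .
        have "norm (matrix_inv (P x)) \<le> norm (matrix_inv (P z)) * norm (P z ** matrix_inv (P x))"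
          using norm_matrix_mult_le[of "matrix_inv (P z)" "P z ** matrix_inv (P x)"] by (simp add: matrix_inv_cancel inv)
        also have "\<dots> \<le> max (norm (P z)) (norm (matrix_inv (P z))) * (?I + L)"
          using 2 by (intro mult_mono) (auto simp: le_max_iff_disj)
        finally show "norm (P x) \<le> B \<and> norm (matrix_inv (P x)) \<le> B" using 3 by (simp add: B_def mult.commute)
      qed
    qed
    moreover have "0 \<le> B" unfolding B_def
      using L by (intro mult_nonneg_nonneg) (auto simp: le_max_iff_disj)
    ultimately show ?thesis by blast
  qed
  then have "\<exists>B. \<forall>i. 0 \<le> B i \<and>
      (AE x in \<mu>. x 0 = i \<longrightarrow> norm (P x) \<le> B i \<and> norm (matrix_inv (P x)) \<le> B i)"
    by (intro choice) blast
  then obtain B where B: "\<And>i. 0 \<le> B i"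
    "\<And>i. AE x in \<mu>. x 0 = i \<longrightarrow> norm (P x) \<le> B i \<and> norm (matrix_inv (P x)) \<le> B i" by blast
  have "AE x in \<mu>. \<forall>i. x 0 = i \<longrightarrow> norm (P x) \<le> B i \<and> norm (matrix_inv (P x)) \<le> B i"
    unfolding AE_all_countable using B(2) by blast
  then have "AE x in \<mu>. norm (P x) \<le> (\<Sum>i\<in>{1..l}. B i) \<and> norm (matrix_inv (P x)) \<le> (\<Sum>i\<in>{1..l}. B i)"
    using AE_space
  proof eventually_elim
    case (elim x)
    have "x 0 \<in> {1..l}" using elim(2) unfolding space_\<mu> subshift_def by blast
    then have "B (x 0) \<le> (\<Sum>i\<in>{1..l}. B i)" by (intro member_le_sum) (auto simp: B)
    then show ?case using elim(1) by force
  qed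
  then show ?thesis by blast
qed

text \<open>The same argument provides a Hoelder version of the inverse of \<open>P\<close>. It is the inverse of the version of
\<open>P\<close> at every point by continuity, and this is why the version takes invertible values everywhere.\<close>

lemma holder_conjugacy:
  "\<exists>Phat c. (\<forall>x\<in>\<Sigma>. invertible (Phat x)) \<and>
     (\<forall>x\<in>\<Sigma>. \<forall>y\<in>\<Sigma>. \<forall>N. agree N x y \<longrightarrow> norm (Phat x - Phat y) \<le> c * \<theta> ^ N) \<and>
     (AE x in \<mu>. P x = Phat x) \<and>
     (\<forall>x\<in>\<Sigma>. A x = Phat (left_shift x) ** matrix_inv (Phat x))"
proof -
  from AE_bounded obtain B where B: "AE x in \<mu>. norm (P x) \<le> B \<and> norm (matrix_inv (P x)) \<le> B" by blast
  from AE_pairs_holder_same_symbol obtain L where L: "0 \<le> L" and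
    L_AE: "AE z in \<mu>. AE x in \<mu>. x 0 = z 0 \<longrightarrow> (\<forall>N. agree N x z \<longrightarrow>
     norm (P x ** matrix_inv (P z) - mat 1) \<le> L * \<theta> ^ N \<and>
     norm (P z ** matrix_inv (P x) - mat 1) \<le> L * \<theta> ^ N)" by blast
  obtain x0 where "norm (P x0) \<le> B"
    using AE_pos_witness[OF B, of "space \<mu>"] prob_space by auto
  then have B0: "0 \<le> B" using norm_ge_zero order.trans by blast
  define c where "c = L * B + 2 * B"
  have pair: "AE z in \<mu>. AE x in \<mu>. \<forall>N. agree N x z \<longrightarrow> norm (P x - P z) \<le> c * \<theta> ^ N \<and>
      norm (matrix_inv (P x) - matrix_inv (P z)) \<le> (B * c * B) * \<theta> ^ N"
    using L_AE B AE_space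
  proof eventually_elim
    case (elim z)
    from elim(1) B AE_space show ?case
    proof eventually_elim
      case x: (elim x)
      have inv: "invertible (P x)" "invertible (P z)" using x elim inv_P by (auto simp: space_\<mu>)
      show ?case
      proof (intro allI impI)
        fix N assume N: "agree N x z"
        have 1: "norm (P x - P z) \<le> c * \<theta> ^ N"
        proof (cases N)
          case 0
          have "norm (P x - P z) \<le> 2 * B"
            using norm_triangle_ineq4[of "P x" "P z"] x(2) elim(2) by simp
          then show ?thesis using 0 mult_nonneg_nonneg[OF L B0] by (simp add: c_def)
        next
          case (Suc N')
          then have "x 0 = z 0" using N by (simp add: agree_def)
          then have close: "norm (P x ** matrix_inv (P z) - mat 1) \<le> L * \<theta> ^ N" using x(1) N by blast
          have "P x - P z = (P x ** matrix_inv (P z) - mat 1) ** P z"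
            by (simp add: matrix_mult_diff_left matrix_inv_cancel inv)
          then have "norm (P x - P z) \<le> norm (P x ** matrix_inv (P z) - mat 1) * norm (P z)"
            by (simp only: norm_matrix_mult_le)
          also have "\<dots> \<le> (L * \<theta> ^ N) * B" using close elim(2) L \<theta> by (intro mult_mono) auto
          also have "\<dots> \<le> c * \<theta> ^ N" using B0 \<theta> by (simp add: c_def algebra_simps)
          finally show ?thesis .
        qed
        have "norm (matrix_inv (P x) - matrix_inv (P z))
            \<le> norm (matrix_inv (P x)) * norm (P x - P z) * norm (matrix_inv (P z))"
          by (rule norm_matrix_inv_diff_le[OF inv])
        also have "\<dots> \<le> B * (c * \<theta> ^ N) * B"
          using 1 x(2) elim(2) B0 order.trans[OF norm_ge_zero 1] by (intro mult_mono) auto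
        finally show "norm (P x - P z) \<le> c * \<theta> ^ N \<and>
            norm (matrix_inv (P x) - matrix_inv (P z)) \<le> (B * c * B) * \<theta> ^ N"
          using 1 by (simp add: mult_ac)
      qed
    qed
  qed
  have "AE z in \<mu>. AE x in \<mu>. \<forall>N. agree N x z \<longrightarrow> norm (P x - P z) \<le> c * \<theta> ^ N"
    using pair by (rule eventually_mono) (auto elim: eventually_mono)
  from holder_version[OF this] obtain Phat where
    Phat: "\<forall>x\<in>\<Sigma>. \<forall>y\<in>\<Sigma>. \<forall>N. agree N x y \<longrightarrow> norm (Phat x - Phat y) \<le> 2 * c * \<theta> ^ N"
    and P_eq: "AE x in \<mu>. P x = Phat x" by blast
  have "AE z in \<mu>. AE x in \<mu>. \<forall>N. agree N x z \<longrightarrow>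
      norm (matrix_inv (P x) - matrix_inv (P z)) \<le> (B * c * B) * \<theta> ^ N"
    using pair by (rule eventually_mono) (auto elim: eventually_mono)
  from holder_version[OF this] obtain Qhat where
    Qhat: "\<forall>x\<in>\<Sigma>. \<forall>y\<in>\<Sigma>. \<forall>N. agree N x y \<longrightarrow> norm (Qhat x - Qhat y) \<le> 2 * (B * c * B) * \<theta> ^ N"
    and Q_eq: "AE x in \<mu>. matrix_inv (P x) = Qhat x" by blast
  note cont = seq_continuous_of_holder[OF Phat[rule_format]]
    seq_continuous_of_holder[OF Qhat[rule_format]] seq_continuous_of_holder[OF holder_A]
  have PQ: "Phat x ** Qhat x = mat 1" if x: "x \<in> \<Sigma>" for x
  proof (rule AE_eq_imp_eq[OF seq_continuous_mult[OF cont(1,2)] _ _ x])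
    show "seq_continuous (\<lambda>x. mat 1)" by (simp add: seq_continuous_def)
    show "AE x in \<mu>. Phat x ** Qhat x = mat 1"
      using P_eq Q_eq AE_space
      by eventually_elim (metis inv_P matrix_inv_right space_\<mu>)
  qed
  have inv: "invertible (Phat x)" if "x \<in> \<Sigma>" for x
    using PQ[OF that] invertible_right_inverse by blast
  have "A x ** Phat x = Phat (shift_by 1 x)" if x: "x \<in> \<Sigma>" for x
  proof (rule AE_eq_imp_eq[OF seq_continuous_mult[OF cont(3,1)] seq_continuous_shift[OF cont(1)] _ x])
    show "AE x in \<mu>. A x ** Phat x = Phat (shift_by 1 x)"
      using P_eq AE_shift[OF P_eq, of 1] AE_typical
    proof eventually_elim
      case (elim x)
      have "A (shift_by 0 x) ** P (shift_by 0 x) = P (shift_by (0 + 1) x)"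
        using elim(3) unfolding typical_def by blast
      then show ?case using elim by simp
    qed
  qed
  then have "A x = Phat (left_shift x) ** matrix_inv (Phat x)" if "x \<in> \<Sigma>" for x
    using that matrix_inv_cancel(3)[OF inv[OF that], of "A x"] by (simp add: left_shift_eq)
  then show ?thesis using inv Phat P_eq by blast
qed

end

section \<open>Choice of the blocks and conclusion\<close>

context measurable_coboundary
begin

lemma ex_sublevel_set:
  assumes "0 < \<eta>"
  shows "\<exists>U\<in>sets \<mu>. \<exists>R. (\<forall>x\<in>U. norm (P x) \<le> R \<and> norm (matrix_inv (P x)) \<le> R) \<and> prob (space \<mu> - U) < \<eta>"
proof -
  note [measurable] = P_meas
  have "P \<in> measurable \<mu> (restrict_space borel {X. invertible X})"
    using P_meas inv_P by (intro measurable_restrict_space2) (auto simp: space_\<mu>)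
  from measurable_compose[OF this borel_measurable_continuous_on_restrict[OF continuous_on_matrix_inv]]
  have [measurable]: "(\<lambda>x. matrix_inv (P x)) \<in> borel_measurable \<mu>" .
  define V where "V R = {x \<in> space \<mu>. real R < norm (P x) \<or> real R < norm (matrix_inv (P x))}" for R :: nat
  have V: "V R \<in> sets \<mu>" for R unfolding V_def by measurable
  have "decseq V" unfolding V_def by (intro decseq_SucI) auto
  then have "(\<lambda>R. prob (V R)) \<longlonglongrightarrow> prob (\<Inter>R. V R)"
    using V by (intro finite_Lim_measure_decseq) auto
  moreover have "(\<Inter>R. V R) = {}"
  proof (intro equals0I)
    fix x assume x: "x \<in> (\<Inter>R. V R)"
    obtain R :: nat where "max (norm (P x)) (norm (matrix_inv (P x))) \<le> real R"
      using real_arch_simple by blast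
    then have "x \<notin> V R" by (simp add: V_def)
    then show False using x by blast
  qed
  ultimately have "\<forall>\<^sub>F R in sequentially. prob (V R) < \<eta>"
    using assms by (intro order_tendstoD) auto
  then obtain R where R: "prob (V R) < \<eta>" by (auto simp: eventually_sequentially)
  have "space \<mu> - (space \<mu> - V R) = V R" unfolding V_def by blast
  then have "prob (space \<mu> - (space \<mu> - V R)) < \<eta>" using R by simp
  moreover have "\<forall>x\<in>space \<mu> - V R. norm (P x) \<le> real R \<and> norm (matrix_inv (P x)) \<le> real R"
    unfolding V_def by (auto simp: not_less)
  moreover have "space \<mu> - V R \<in> sets \<mu>" using V by blast
  ultimately show ?thesis by blast
qed

lemma ex_blocks: "\<exists>\<delta> R K. coboundary_with_blocks l q \<mu> A P \<theta> H M \<delta> R K"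
proof -
  \<comment> \<open>The bound \<open>1/6\<close> is for common visits, and the other one for \<open>\<delta>_domination\<close>.\<close>
  define \<delta> where "\<delta> = min (1/6) (- ln \<theta> / (4 * (ln M + 1)))"
  have lnM: "0 \<le> ln M" and ln\<theta>: "ln \<theta> < 0" using M(1) \<theta> by auto
  have \<delta>: "0 < \<delta>" "\<delta> \<le> 1/6" using lnM ln\<theta> by (auto simp: \<delta>_def field_simps)
  have "\<delta> * (4 * (ln M + 1)) \<le> - ln \<theta>"
  proof -
    have "\<delta> \<le> - ln \<theta> / (4 * (ln M + 1))" unfolding \<delta>_def by (rule min.cobounded2)
    moreover have "0 < 4 * (ln M + 1)" using lnM by simp
    ultimately show ?thesis by (simp only: pos_le_divide_eq)
  qed
  moreover have "2 * (\<delta> * ln M) < \<delta> * (4 * (ln M + 1))" 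
    using \<delta>(1) mult_nonneg_nonneg[OF less_imp_le[OF \<delta>(1)] lnM] by (simp add: algebra_simps)
  ultimately have "2 * (\<delta> * ln M) + ln \<theta> < 0" by linarith
  then have "exp (2 * (\<delta> * ln M) + ln \<theta>) < 1" by simp
  moreover have "M powr \<delta> = exp (\<delta> * ln M)" using M(1) by (simp add: powr_def)
  moreover have "exp (2 * (\<delta> * ln M) + ln \<theta>) = exp (\<delta> * ln M) * exp (\<delta> * ln M) * \<theta>"
    unfolding mult_2 exp_add using \<theta> by simp
  ultimately have dom: "M powr \<delta> * M powr \<delta> * \<theta> < 1" by (simp only:)
  define c where "c = Min (insert 1 ((\<lambda>i. prob (cyl l q i)) ` {i \<in> {1..l}. cyl l q i \<noteq> {}}))"
  have cyl_pos: "0 < prob (cyl l q i)" if ne: "cyl l q i \<noteq> {}" for i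
  proof -
    obtain x where x: "x \<in> \<Sigma>" "x 0 = i" using ne by (auto simp: cyl_def)
    have "cyl l q i = {z. \<forall>k\<in>{0..0}. z k = x k} \<inter> \<Sigma>"
      using x(2) unfolding cyl_def by auto
    then show ?thesis using pos_open[OF open_window[of 0 0 x] _ x(1)] by (simp only:) blast
  qed
  have c: "0 < c" "c \<le> 1" using cyl_pos by (auto simp: c_def)
  have c_le: "c \<le> prob (cyl l q (x 0))" if "x \<in> \<Sigma>" for x
  proof -
    have "x 0 \<in> {1..l}" using that unfolding subshift_def by blast
    moreover have "x \<in> cyl l q (x 0)" using that by (simp add: cyl_def)
    ultimately show ?thesis unfolding c_def by (intro Min_le) auto
  qed
  \<comment> \<open>Half of the admissible loss is for the bound \<open>R\<close>, half for the uniform continuity.\<close>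
  define \<eta> where "\<eta> = \<delta> * c / 2"
  have \<eta>: "0 < \<eta>" using \<delta> c by (simp add: \<eta>_def)
  from ex_sublevel_set[OF \<eta>] obtain U R where U: "U \<in> sets \<mu>"
    "\<And>x. x \<in> U \<Longrightarrow> norm (P x) \<le> R \<and> norm (matrix_inv (P x)) \<le> R" "prob (space \<mu> - U) < \<eta>" by blast
  have "\<exists>K\<in>sets \<mu>. K \<subseteq> U \<and> prob (U - K) < \<eta> \<and>
     (\<exists>N. \<forall>x\<in>K. \<forall>y\<in>K. agree N x y \<longrightarrow> norm (P x - P y) < 1 / real (Suc j))" for j
    using U \<eta> by (intro nearly_uniformly_continuous[OF _ sets_\<mu> P_meas U(1)]) (auto intro: finite_measure_axioms)
  then obtain K where K: "\<And>j. K j \<in> sets \<mu>" "\<And>j. K j \<subseteq> U" "\<And>j. prob (U - K j) < \<eta>"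
    "\<And>j. \<exists>N. \<forall>x\<in>K j. \<forall>y\<in>K j. agree N x y \<longrightarrow> norm (P x - P y) < 1 / real (Suc j)" by metis
  have K_small: "prob (space \<mu> - K j) < \<delta> * c" for j
  proof -
    have "prob (space \<mu> - K j) \<le> prob ((space \<mu> - U) \<union> (U - K j))"
      using U(1) K(1) sets.sets_into_space[OF U(1)] by (intro finite_measure_mono) auto
    also have "\<dots> \<le> prob (space \<mu> - U) + prob (U - K j)"
      using U(1) K(1) by (intro measure_Un_le) auto
    also have "\<dots> < \<delta> * c" using U(3) K(3)[of j] by (simp add: \<eta>_def)
    finally show ?thesis .
  qed
  have "coboundary_with_blocks l q \<mu> A P \<theta> H M \<delta> R K"
  proof
    show "prob (space \<mu> - K j) < \<delta>" for j
    proof -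
      have "\<delta> * c \<le> \<delta> * 1" using \<delta> c by (intro mult_left_mono) auto
      then show ?thesis using K_small[of j] by simp
    qed
    show "prob (space \<mu> - K 0) / \<delta> < prob (cyl l q (x 0))" if "x \<in> \<Sigma>" for x
    proof -
      have "prob (space \<mu> - K 0) / \<delta> < c" using K_small[of 0] \<delta>(1) by (simp add: pos_divide_less_eq mult.commute)
      then show ?thesis using c_le[OF that] by simp
    qed
  qed (use \<delta> dom K U(2) in blast)+
  then show ?thesis by blast
qed

end

lemma compact_subshift: "compact (subshift l q)"
proof -
  have "compactin (product_topology (\<lambda>_. euclidean) UNIV) (PiE (UNIV :: int set) (\<lambda>_. {1..l}))"
    by (simp add: compactin_PiE finite_imp_compact)
  then have "compact (PiE (UNIV :: int set) (\<lambda>_. {1..l}))"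
    by (simp add: euclidean_product_topology)
  moreover have "closed (subshift l q)"
  proof -
    have op: "open {x :: int \<Rightarrow> nat. x n \<in> B}" for n B
    proof -
      have "open ((\<lambda>x :: int \<Rightarrow> nat. x n) -` B)"
        by (rule open_vimage[OF Topological_Spaces.open_discrete continuous_on_product_coordinates])
      then show ?thesis by (simp add: vimage_def)
    qed
    have "- subshift l q = (\<Union>n. {x. x n \<in> - {1..l}} \<union>
        (\<Union>k. {x. x n \<in> {k}} \<inter> {x. x (n + 1) \<in> {j. q k j \<noteq> 1}}))"
      by (auto simp: subshift_def)
    moreover have "open \<dots>" by (intro open_UN open_Un open_Int op ballI)
    ultimately show ?thesis by (simp add: closed_def)
  qed
  moreover have "subshift l q \<subseteq> PiE UNIV (\<lambda>_. {1..l})" by (auto simp: subshift_def)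
  ultimately show ?thesis by (metis compact_Int_closed inf.absorb_iff2)
qed

text \<open>Compactness of the shift space excludes that \<open>A\<close> comes close to singular matrices.\<close>

lemma bounded_inverse_of_holder:
  fixes A :: "(int \<Rightarrow> nat) \<Rightarrow> real^'d^'d"
  assumes inv: "\<And>x. x \<in> subshift l q \<Longrightarrow> invertible (A x)"
    and holder: "\<And>x y N. x \<in> subshift l q \<Longrightarrow> y \<in> subshift l q \<Longrightarrow> agree N x y \<Longrightarrow>
      norm (A x - A y) \<le> H * \<theta> ^ N"
    and \<theta>: "0 < \<theta>" "\<theta> < 1"
  shows "\<exists>M. \<forall>x\<in>subshift l q. norm (matrix_inv (A x)) \<le> M"
proof -
  have "\<exists>U. open U \<and> x \<in> U \<and> (\<forall>y\<in>U \<inter> subshift l q. norm (matrix_inv (A y)) \<le> 2 * norm (matrix_inv (A x)))"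
    if x: "x \<in> subshift l q" for x
  proof -
    have "(\<lambda>N. norm (matrix_inv (A x)) * (H * \<theta> ^ N)) \<longlonglongrightarrow> norm (matrix_inv (A x)) * (H * 0)"
      using \<theta> by (intro tendsto_intros LIMSEQ_realpow_zero) auto
    then have "\<forall>\<^sub>F N in sequentially. norm (matrix_inv (A x)) * (H * \<theta> ^ N) < 1/2"
      by (intro order_tendstoD) auto
    then obtain N where N: "norm (matrix_inv (A x)) * (H * \<theta> ^ N) < 1/2" by (auto simp: eventually_sequentially)
    define U where "U = (\<Inter>n\<in>{- int N<..<int N}. (\<lambda>y :: int \<Rightarrow> nat. y n) -` {x n})"
    have "open ((\<lambda>y :: int \<Rightarrow> nat. y n) -` {x n})" for n
      by (rule open_vimage[OF Topological_Spaces.open_discrete continuous_on_product_coordinates])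
    then have "open U" by (auto simp: U_def)
    moreover have "norm (matrix_inv (A y)) \<le> 2 * norm (matrix_inv (A x))" if y: "y \<in> U \<inter> subshift l q" for y
    proof (rule norm_matrix_inv_near)
      have "agree N y x" using y by (auto simp: U_def agree_def abs_less_iff)
      then have "norm (A y - A x) \<le> H * \<theta> ^ N" using holder x y by blast
      then have "norm (matrix_inv (A x)) * norm (A y - A x) \<le> norm (matrix_inv (A x)) * (H * \<theta> ^ N)"
        by (intro mult_left_mono) auto
      then show "norm (matrix_inv (A x)) * norm (A y - A x) \<le> 1/2" using N by linarith
    qed (use inv x y in auto)
    ultimately show ?thesis by (intro exI[of _ U]) (auto simp: U_def)
  qed
  then obtain U where U: "\<And>x. x \<in> subshift l q \<Longrightarrow> open (U x)" "\<And>x. x \<in> subshift l q \<Longrightarrow> x \<in> U x"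
    "\<And>x y. x \<in> subshift l q \<Longrightarrow> y \<in> U x \<inter> subshift l q \<Longrightarrow> norm (matrix_inv (A y)) \<le> 2 * norm (matrix_inv (A x))"
    by metis
  obtain F where F: "F \<subseteq> subshift l q" "finite F" "subshift l q \<subseteq> (\<Union>x\<in>F. U x)"
    by (rule compactE_image[OF compact_subshift[of l q], of "subshift l q" U]) (use U in blast)+
  have "norm (matrix_inv (A y)) \<le> (\<Sum>x\<in>F. 2 * norm (matrix_inv (A x)))" if y: "y \<in> subshift l q" for y
  proof -
    obtain x where x: "x \<in> F" "y \<in> U x" using F(3) y by blast
    then have "norm (matrix_inv (A y)) \<le> 2 * norm (matrix_inv (A x))" using U(3) F(1) y by blast
    also have "\<dots> \<le> (\<Sum>x\<in>F. 2 * norm (matrix_inv (A x)))"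
      using x(1) F(2) by (intro member_le_sum) auto
    finally show ?thesis .
  qed
  then show ?thesis by blast
qed

lemma rho_powr_le_of_agree:
  assumes "0 < \<tau>" "0 < \<alpha>" "agree N x y"
  shows "rho \<tau> x y powr \<alpha> \<le> exp (- \<tau> * \<alpha>) ^ N"
proof -
  have "rho \<tau> x y \<le> exp (- \<tau> * real N)" using rho_le_iff[OF assms(1)] assms(3) by (simp add: agree_def)
  then have "rho \<tau> x y powr \<alpha> \<le> exp (- \<tau> * real N) powr \<alpha>"
    using assms(2) by (intro powr_mono2) (auto simp: rho_def)
  also have "\<dots> = exp (- \<tau> * \<alpha>) ^ N"
    by (simp add: exp_powr_real mult_ac flip: exp_of_nat2_mult)
  finally show ?thesis .
qed

text \<open>Together with the preceding inequality this translates between Hoelder continuity for the metric and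
the estimates on windows.\<close>

lemma rho_powr_eq:
  assumes "0 < \<tau>" "x \<noteq> y"
  shows "\<exists>N. agree N x y \<and> rho \<tau> x y powr \<alpha> = exp (- \<tau> * \<alpha>) ^ N"
proof (intro exI conjI)
  have eq: "rho \<tau> x y = exp (- \<tau> * real (agreement x y))" using assms(2) by (simp add: rho_def)
  then show "agree (agreement x y) x y"
    using rho_le_iff[OF assms(1), of x y "agreement x y"] by (simp add: agree_def)
  show "rho \<tau> x y powr \<alpha> = exp (- \<tau> * \<alpha>) ^ agreement x y"
    unfolding eq by (simp add: exp_powr_real mult_ac flip: exp_of_nat2_mult)
qed

theorem theorem1p4:
  fixes l :: nat
    and q :: "nat \<Rightarrow> nat \<Rightarrow> nat"
    and \<tau> \<alpha> :: real
    and \<mu> :: "(int \<Rightarrow> nat) measure"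
    and A P :: "(int \<Rightarrow> nat) \<Rightarrow> real ^ 'd ^ 'd"
  assumes "l \<ge> 2"
    and "\<forall>i\<in>{1..l}. \<forall>j\<in>{1..l}. q i j \<in> {0, 1}"
    and "\<tau> > 0"
    and "\<alpha> > 0"
    and "sets \<mu> = sets (restrict_space borel (subshift l q))"
    and "ergodic_measure left_shift \<mu>"
    and "fully_supported_on (subshift l q) \<mu>"
    and "local_product_structure l q \<mu>"
    and "\<forall>x\<in>subshift l q. invertible (A x)"
    and "holder_on (subshift l q) \<tau> \<alpha> A"
    and "P \<in> borel_measurable \<mu>"
    and "\<forall>x\<in>subshift l q. invertible (P x)"
    and "AE x in \<mu>. A x = P (left_shift x) ** matrix_inv (P x)"
  shows "\<exists>Phat :: (int \<Rightarrow> nat) \<Rightarrow> real ^ 'd ^ 'd.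
           (\<forall>x\<in>subshift l q. invertible (Phat x)) \<and>
           holder_on (subshift l q) \<tau> \<alpha> Phat \<and>
           (AE x in \<mu>. P x = Phat x) \<and>
           (\<forall>x\<in>subshift l q. A x = Phat (left_shift x) ** matrix_inv (Phat x))"
proof -
  let ?\<Sigma> = "subshift l q"
  define \<theta> where "\<theta> = exp (- \<tau> * \<alpha>)"
  have \<theta>: "0 < \<theta>" "\<theta> < 1" using assms(3,4) by (auto simp: \<theta>_def)
  obtain H0 where H0: "\<forall>x\<in>?\<Sigma>. \<forall>y\<in>?\<Sigma>. norm (A x - A y) \<le> H0 * rho \<tau> x y powr \<alpha>"
    using assms(10) unfolding holder_on_def by blast
  define H where "H = max H0 0"
  have H: "norm (A x - A y) \<le> H * \<theta> ^ N" if "x \<in> ?\<Sigma>" "y \<in> ?\<Sigma>" "agree N x y" for x y N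
  proof -
    have "norm (A x - A y) \<le> H0 * rho \<tau> x y powr \<alpha>" using H0 that by blast
    also have "\<dots> \<le> H * rho \<tau> x y powr \<alpha>" by (intro mult_right_mono) (auto simp: H_def)
    also have "\<dots> \<le> H * \<theta> ^ N"
      unfolding \<theta>_def using assms(3,4) that by (intro mult_left_mono rho_powr_le_of_agree) (auto simp: H_def)
    finally show ?thesis .
  qed
  obtain M1 where M1: "\<forall>x\<in>?\<Sigma>. norm (matrix_inv (A x)) \<le> M1"
    using bounded_inverse_of_holder[of l q A H \<theta>] assms(9) H \<theta> by blast
  interpret prob_space \<mu> using assms(6) by (simp add: ergodic_measure_def)
  have "space \<mu> = ?\<Sigma>" using sets_eq_imp_space_eq[OF assms(5)] by (simp add: space_restrict_space)
  then obtain x0 where x0: "x0 \<in> ?\<Sigma>" using not_empty by blast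
  define M where "M = max 1 (max M1 (norm (A x0) + H))"
  have M2: "norm (A x) \<le> norm (A x0) + H" if "x \<in> ?\<Sigma>" for x
    using H[OF that x0, of 0] norm_triangle_ineq2[of "A x" "A x0"] by (simp add: agree_def)
  interpret measurable_coboundary l q \<mu> A P \<theta> H M
  proof
    show "norm (A x) \<le> M" if "x \<in> ?\<Sigma>" for x using M2[OF that] by (simp add: M_def)
    show "norm (matrix_inv (A x)) \<le> M" if "x \<in> ?\<Sigma>" for x using M1 that by (simp add: M_def le_max_iff_disj)
    show "1 \<le> M" by (simp add: M_def)
  qed (use assms H \<theta> in blast)+
  obtain \<delta> R K where "coboundary_with_blocks l q \<mu> A P \<theta> H M \<delta> R K" using ex_blocks by blast
  then interpret coboundary_with_blocks l q \<mu> A P \<theta> H M \<delta> R K .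
  from holder_conjugacy obtain Phat c where inv: "\<forall>x\<in>?\<Sigma>. invertible (Phat x)"
    and holder: "\<forall>x\<in>?\<Sigma>. \<forall>y\<in>?\<Sigma>. \<forall>N. agree N x y \<longrightarrow> norm (Phat x - Phat y) \<le> c * \<theta> ^ N"
    and eq: "AE x in \<mu>. P x = Phat x" "\<forall>x\<in>?\<Sigma>. A x = Phat (left_shift x) ** matrix_inv (Phat x)" by blast
  have "norm (Phat x - Phat y) \<le> c * rho \<tau> x y powr \<alpha>" if xy: "x \<in> ?\<Sigma>" "y \<in> ?\<Sigma>" for x y
  proof (cases "x = y")
    case False
    then obtain N where "agree N x y" "rho \<tau> x y powr \<alpha> = \<theta> ^ N"
      using rho_powr_eq[OF assms(3)] unfolding \<theta>_def by blast
    then show ?thesis using holder xy by simp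
  qed (simp add: rho_def)
  then have "holder_on ?\<Sigma> \<tau> \<alpha> Phat" unfolding holder_on_def by blast
  then show ?thesis using inv eq by blast
qed

end
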